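(* Let $\widehat{\mathbf{n}}=\{n_k\}_{k=1}^\infty$ be a sequence of integers with $n_k>1$ for all $k$, and let $\mathfrak{S}_{\widehat{\mathbf{n}}}$ be the associated inductive limit of symmetric groups. For $p\in\mathbb{N}\cup\{0\}$ let $\chi_{\mathrm{nat}}^p(\sigma)=(\chi_{\mathrm{nat}}(\sigma))^p$, and let $\chi_{\mathrm{nat}}^\infty(\sigma)=1$ if $\sigma=\mathrm{id}$ and $\chi_{\mathrm{nat}}^\infty(\sigma)=0$ if $\sigma\neq\mathrm{id}$. If $\chi$ is an indecomposable character on $\mathfrak{S}_{\widehat{\mathbf{n}}}$, then there exists $p\in\mathbb{N}\cup\{0,\infty\}$ such that $\chi=\chi_{\mathrm{nat}}^p$ or $\chi=\operatorname{sgn}_\infty\cdot\chi_{\mathrm{nat}}^p$, where $(\operatorname{sgn}_\infty\cdot\chi_{\mathrm{nat}}^p)(\sigma)=\operatorname{sgn}_\infty(\sigma)\,\chi_{\mathrm{nat}}^p(\sigma)$ for $\sigma\in\mathfrak{S}_{\widehat{\mathbf{n}}}$.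
   Context: The group. For a positive integer $N$, $\mathfrak{S}_N$ is the group of all bijections of $\mathbb{X}_N=\{0,1,\dots,N-1\}$. Put $N_k=n_1n_2\cdots n_k$. For $j>k$ identify $\mathbb{X}_{N_j}$ with $\mathbb{X}_{N_k}\times\mathbb{X}_{N_j/N_k}$ via $x_1+N_kx_2\leftrightarrow(x_1,x_2)$, and let $\mathfrak{i}_{k,j}:\mathfrak{S}_{N_k}\to\mathfrak{S}_{N_j}$ be the embedding $\mathfrak{i}_{k,j}(\sigma)(x_1,x_2)=(\sigma(x_1),x_2)$. Then $\mathfrak{S}_{\widehat{\mathbf{n}}}=\varinjlim\mathfrak{S}_{N_k}=\bigcup_k\mathfrak{S}_{N_k}$, where elements are identified with their images under the $\mathfrak{i}_{k,j}$; $\mathrm{id}$ is its identity. The natural character: for $\sigma\in\mathfrak{S}_{N_k}\subset\mathfrak{S}_{\widehat{\mathbf{n}}}$, $\chi_{\mathrm{nat}}(\sigma)=1-\frac{\#\{x\in\mathbb{X}_{N_k}:\sigma(x)\ne x\}}{N_k}$ (independent of the choice of $k$). The sign: let $\operatorname{sgn}_{N_k}$ be the usual sign of a permutation in $\mathfrak{S}_{N_k}$. For every $s\in\mathfrak{S}_{\widehat{\mathbf{n}}}$ the sequence $\operatorname{sgn}_{N_k}(s)$ (defined for all large $k$) is eventually constant, and $\operatorname{sgn}_\infty(s)=\lim_{k\to\infty}\operatorname{sgn}_{N_k}(s)$. Characters: a character on a group $G$ is a function $\chi:G\to\mathbb{C}$ such that (a) $\chi(gh)=\chi(hg)$ for all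 $g,h\in G$; (b) $\chi$ is positive-definite, i.e. for any $g_1,\dots,g_k\in G$ the matrix $[\chi(g_ig_j^{-1})]$ is Hermitian positive-semidefinite; (c) $\chi(\mathrm{id})=1$. It is indecomposable if it cannot be written as a sum of two linearly independent functions satisfying (a) and (b) (equivalently, its GNS representation is a factor representation). *)

theory Defs
  imports
    Complex_Main
    "HOL-Algebra.Group"
    "HOL-Combinatorics.Permutations"
    "HOL-Library.Extended_Nat"
begin

section \<open>The inductive limit of symmetric groups\<close>

text \<open>The sequence \<open>n\<close> is indexed from 1; its value at 0 is never used.\<close>

definition level :: "(nat \<Rightarrow> nat) \<Rightarrow> nat \<Rightarrow> nat"
  where "level n k = (\<Prod>i=1..k. n i)"

text \<open>Following the library, a permutation of \<open>{0, ..., N - 1}\<close> is a function on all of \<open>nat\<close>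
  which is the identity outside that set.\<close>

definition Sym :: "nat \<Rightarrow> (nat \<Rightarrow> nat) monoid"
  where "Sym N = \<lparr>carrier = {s. s permutes {..<N}}, monoid.mult = (\<circ>), one = id\<rparr>"

text \<open>The connecting map from stage \<open>k\<close> to stage \<open>j\<close>: under \<open>x = x1 + N_k * x2\<close> we have
  \<open>x1 = x mod N_k\<close> and \<open>x2 = x div N_k\<close>.\<close>

definition stage_embed :: "(nat \<Rightarrow> nat) \<Rightarrow> nat \<Rightarrow> nat \<Rightarrow> (nat \<Rightarrow> nat) \<Rightarrow> nat \<Rightarrow> nat"
  where "stage_embed n k j s = (\<lambda>x. if x < level n j
    then s (x mod level n k) + level n k * (x div level n k) else x)"

text \<open>The inductive limit is realised inside the bijections of \<open>nat\<close>: the same formula, without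
  the bound \<open>x < N_j\<close>, embeds every stage compatibly with the connecting maps, and the limit group
  is the union of the images. The lemmas \<open>limit_embed_hom\<close>, \<open>limit_embed_inj\<close>,
  \<open>limit_embed_stage_embed\<close>, \<open>group_sym_limit\<close> and \<open>sym_limit_universal\<close> below show that this is
  the direct limit.\<close>

definition limit_embed :: "(nat \<Rightarrow> nat) \<Rightarrow> nat \<Rightarrow> (nat \<Rightarrow> nat) \<Rightarrow> nat \<Rightarrow> nat"
  where "limit_embed n k s = (\<lambda>x. s (x mod level n k) + level n k * (x div level n k))"

definition sym_limit :: "(nat \<Rightarrow> nat) \<Rightarrow> (nat \<Rightarrow> nat) monoid"
  where "sym_limit n = \<lparr>carrier = (\<Union>k\<in>{1..}. limit_embed n k ` carrier (Sym (level n k))),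
    monoid.mult = (\<circ>), one = id\<rparr>"


section \<open>The natural character and the sign\<close>

text \<open>By \<open>chi_nat_eq\<close> below the described value exists and does not depend on the stage.\<close>

definition chi_nat :: "(nat \<Rightarrow> nat) \<Rightarrow> (nat \<Rightarrow> nat) \<Rightarrow> complex"
  where "chi_nat n g = (THE c. \<exists>k\<ge>1. \<exists>s \<in> carrier (Sym (level n k)). g = limit_embed n k s \<and>
    c = 1 - of_nat (card {x \<in> {..<level n k}. s x \<noteq> x}) / of_nat (level n k))"

definition chi_nat_pow :: "(nat \<Rightarrow> nat) \<Rightarrow> enat \<Rightarrow> (nat \<Rightarrow> nat) \<Rightarrow> complex"
  where "chi_nat_pow n p g = (case p of
      enat m \<Rightarrow> chi_nat n g ^ m
    | \<infinity> \<Rightarrow> (if g = \<one>\<^bsub>sym_limit n\<^esub> then 1 else 0))"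

text \<open>The sign of \<open>g\<close> at stage \<open>k\<close> is meaningful only if \<open>g\<close> lies in that stage, hence for all
  large \<open>k\<close>; by \<open>sgn_stage_eventually_const\<close> below the sequence is eventually constant.\<close>

definition sgn_stage :: "(nat \<Rightarrow> nat) \<Rightarrow> nat \<Rightarrow> (nat \<Rightarrow> nat) \<Rightarrow> int"
  where "sgn_stage n k g = sign (inv_into (carrier (Sym (level n k))) (limit_embed n k) g)"

definition sgn_infinity :: "(nat \<Rightarrow> nat) \<Rightarrow> (nat \<Rightarrow> nat) \<Rightarrow> complex"
  where "sgn_infinity n g = lim (\<lambda>k. of_int (sgn_stage n k g))"


section \<open>Characters\<close>

text \<open>Functions on a group are total functions on the underlying type; only their values on the
  carrier matter.\<close>

definition hermitian_psd :: "nat \<Rightarrow> (nat \<Rightarrow> nat \<Rightarrow> complex) \<Rightarrow> bool"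
  where "hermitian_psd m A \<longleftrightarrow> (\<forall>i<m. \<forall>j<m. A j i = cnj (A i j)) \<and>
    (\<forall>c :: nat \<Rightarrow> complex. let q = (\<Sum>i<m. \<Sum>j<m. cnj (c i) * A i j * c j) in q \<in> \<real> \<and> 0 \<le> Re q)"

definition central_function :: "('g, 'b) monoid_scheme \<Rightarrow> ('g \<Rightarrow> complex) \<Rightarrow> bool"
  where "central_function G f \<longleftrightarrow>
    (\<forall>g \<in> carrier G. \<forall>h \<in> carrier G. f (g \<otimes>\<^bsub>G\<^esub> h) = f (h \<otimes>\<^bsub>G\<^esub> g))"

definition positive_definite :: "('g, 'b) monoid_scheme \<Rightarrow> ('g \<Rightarrow> complex) \<Rightarrow> bool"
  where "positive_definite G f \<longleftrightarrow> (\<forall>m. \<forall>g :: nat \<Rightarrow> 'g. (\<forall>i<m. g i \<in> carrier G) \<longrightarrow>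
    hermitian_psd m (\<lambda>i j. f (g i \<otimes>\<^bsub>G\<^esub> inv\<^bsub>G\<^esub> (g j))))"

definition group_character :: "('g, 'b) monoid_scheme \<Rightarrow> ('g \<Rightarrow> complex) \<Rightarrow> bool"
  where "group_character G f \<longleftrightarrow>
    central_function G f \<and> positive_definite G f \<and> f \<one>\<^bsub>G\<^esub> = 1"

definition lin_indep_pair :: "('g, 'b) monoid_scheme \<Rightarrow> ('g \<Rightarrow> complex) \<Rightarrow> ('g \<Rightarrow> complex) \<Rightarrow> bool"
  where "lin_indep_pair G f1 f2 \<longleftrightarrow> (\<forall>a b :: complex.
    (\<forall>g \<in> carrier G. a * f1 g + b * f2 g = 0) \<longrightarrow> a = 0 \<and> b = 0)"

definition indecomposable_character :: "('g, 'b) monoid_scheme \<Rightarrow> ('g \<Rightarrow> complex) \<Rightarrow> bool"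
  where "indecomposable_character G f \<longleftrightarrow> group_character G f \<and>
    \<not> (\<exists>f1 f2. central_function G f1 \<and> positive_definite G f1 \<and>
           central_function G f2 \<and> positive_definite G f2 \<and>
           lin_indep_pair G f1 f2 \<and> (\<forall>g \<in> carrier G. f g = f1 g + f2 g))"


section \<open>Well-definedness\<close>

lemma group_Sym: "group (Sym N)"
proof (rule groupI)
  fix s assume "s \<in> carrier (Sym N)"
  then have "s permutes {..<N}" by (simp add: Sym_def)
  then show "\<exists>t \<in> carrier (Sym N). t \<otimes>\<^bsub>Sym N\<^esub> s = \<one>\<^bsub>Sym N\<^esub>"
    by (auto simp: Sym_def permutes_inv permutes_inv_o intro!: exI[of _ "Hilbert_Choice.inv s"])
qed (auto simp: Sym_def permutes_compose permutes_id comp_assoc)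

context
  fixes n :: "nat \<Rightarrow> nat"
  assumes n: "\<And>k. k \<ge> 1 \<Longrightarrow> n k > 1"
begin

lemma level_pos: "level n k > 0"
  unfolding level_def by (rule prod_pos) (use n in fastforce)

lemma level_split: "k \<le> j \<Longrightarrow> level n j = level n k * (\<Prod>i=Suc k..j. n i)"
  using prod.ub_add_nat[of 1 k n "j - k"] by (simp add: level_def)

lemma level_dvd: "k \<le> j \<Longrightarrow> level n k dvd level n j"
  using level_split by simp

lemma Sym_less: "s \<in> carrier (Sym N) \<Longrightarrow> x < N \<Longrightarrow> s x < N"
  using permutes_in_image[of s "{..<N}" x] by (simp add: Sym_def)

lemma limit_embed_mod_div:
  assumes "s \<in> carrier (Sym (level n k))"
  shows "limit_embed n k s x mod level n k = s (x mod level n k)"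
    and "limit_embed n k s x div level n k = x div level n k"
  using Sym_less[OF assms, of "x mod level n k"] level_pos[of k]
  by (simp_all add: limit_embed_def)

lemma limit_embed_comp:
  assumes "s \<in> carrier (Sym (level n k))" "t \<in> carrier (Sym (level n k))"
  shows "limit_embed n k (s \<circ> t) = limit_embed n k s \<circ> limit_embed n k t"
proof
  fix x
  show "limit_embed n k (s \<circ> t) x = (limit_embed n k s \<circ> limit_embed n k t) x"
    using limit_embed_mod_div[OF assms(2), of x]
    by (simp add: limit_embed_def[of n k s] limit_embed_def[of n k "s \<circ> t"])
qed

lemma limit_embed_id: "limit_embed n k id = id"
  by (auto simp: limit_embed_def)

lemma limit_embed_inj: "inj_on (limit_embed n k) (carrier (Sym (level n k)))"
proof (rule inj_onI, rule ext)
  fix s t x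
  assume s: "s \<in> carrier (Sym (level n k))" and t: "t \<in> carrier (Sym (level n k))"
    and eq: "limit_embed n k s = limit_embed n k t"
  show "s x = t x"
  proof (cases "x < level n k")
    case True
    then show ?thesis using fun_cong[OF eq, of x] by (simp add: limit_embed_def)
  next
    case False
    then show ?thesis using s t by (simp add: Sym_def permutes_not_in)
  qed
qed

lemma stage_embed_closed:
  assumes "k \<le> j" and s: "s \<in> carrier (Sym (level n k))"
  shows "stage_embed n k j s \<in> carrier (Sym (level n j))"
proof -
  have lt: "limit_embed n k s x < level n j" if "x < level n j" for x
  proof -
    obtain q where q: "level n j = level n k * q" using level_dvd[OF assms(1)] by (auto elim: dvdE)
    have "x div level n k < q"
      using that level_pos[of k] q by (simp add: less_mult_imp_div_less mult.commute)
    then have "limit_embed n k s x div level n k < q"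
      using limit_embed_mod_div[OF s] by simp
    then show ?thesis
      using level_pos[of k] q by (simp add: div_less_iff_less_mult mult.commute)
  qed
  have inj: "inj (limit_embed n k s)"
  proof (rule injI)
    fix x y assume eq: "limit_embed n k s x = limit_embed n k s y"
    have "inj s" using s by (simp add: Sym_def permutes_inj)
    moreover have "s (x mod level n k) = s (y mod level n k)"
      using eq limit_embed_mod_div(1)[OF s] by metis
    ultimately have "x mod level n k = y mod level n k" by (simp add: inj_eq)
    moreover have "x div level n k = y div level n k"
      using eq limit_embed_mod_div(2)[OF s] by metis
    ultimately show "x = y" by (metis div_mult_mod_eq)
  qed
  have eq: "stage_embed n k j s x = limit_embed n k s x" if "x < level n j" for x
    using that by (simp add: stage_embed_def limit_embed_def)
  have "stage_embed n k j s permutes {..<level n j}"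
  proof (rule inj_imp_permutes)
    show "inj_on (stage_embed n k j s) {..<level n j}"
      by (rule inj_onI) (metis eq inj injD lessThan_iff)
    show "stage_embed n k j s x \<in> {..<level n j}" if "x \<in> {..<level n j}" for x
      using that eq lt by simp
    show "stage_embed n k j s x = x" if "x \<notin> {..<level n j}" for x
      using that by (simp add: stage_embed_def)
  qed simp
  then show ?thesis by (simp add: Sym_def)
qed

lemma limit_embed_stage_embed:
  assumes "k \<le> j" and s: "s \<in> carrier (Sym (level n k))"
  shows "limit_embed n j (stage_embed n k j s) = limit_embed n k s"
proof
  fix x
  let ?M = "level n k" and ?N = "level n j"
  obtain q where q: "?N = ?M * q" using level_dvd[OF assms(1)] by (auto elim: dvdE)
  have "x = x mod ?N + ?N * (x div ?N)" by simp
  then have "x div ?M = (x mod ?N + ?M * (q * (x div ?N))) div ?M"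
    unfolding q by (simp add: mult.assoc)
  also have "\<dots> = x mod ?N div ?M + q * (x div ?N)"
    using level_pos[of k] by simp
  finally have d: "x div ?M = x mod ?N div ?M + q * (x div ?N)" .
  have m: "x mod ?N mod ?M = x mod ?M"
    using level_dvd[OF assms(1)] by (simp add: mod_mod_cancel)
  show "limit_embed n j (stage_embed n k j s) x = limit_embed n k s x"
  proof -
    have "limit_embed n j (stage_embed n k j s) x =
        s (x mod ?M) + ?M * (x mod ?N div ?M) + ?N * (x div ?N)"
      using level_pos[of j] m by (simp add: limit_embed_def stage_embed_def)
    also have "?N * (x div ?N) = ?M * (q * (x div ?N))"
      using q by (metis mult.assoc)
    also have "s (x mod ?M) + ?M * (x mod ?N div ?M) + ?M * (q * (x div ?N)) =
        s (x mod ?M) + ?M * (x mod ?N div ?M + q * (x div ?N))"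
      by (simp only: distrib_left add.assoc)
    finally show ?thesis by (simp only: d limit_embed_def)
  qed
qed

lemma stage_embed_eqI:
  assumes "k \<le> j" "s \<in> carrier (Sym (level n k))" "t \<in> carrier (Sym (level n j))"
    and "limit_embed n k s = limit_embed n j t"
  shows "t = stage_embed n k j s"
  using inj_onD[OF limit_embed_inj[of j], of t "stage_embed n k j s"] assms
    limit_embed_stage_embed stage_embed_closed by metis

lemma stage_embed_hom:
  assumes "k \<le> j"
  shows "stage_embed n k j \<in> hom (Sym (level n k)) (Sym (level n j))"
proof (rule homI)
  fix s t assume s: "s \<in> carrier (Sym (level n k))" and t: "t \<in> carrier (Sym (level n k))"
  interpret K: group "Sym (level n k)" by (rule group_Sym)
  interpret J: group "Sym (level n j)" by (rule group_Sym)
  have st: "s \<circ> t \<in> carrier (Sym (level n k))"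
    using K.m_closed[OF s t] by (simp add: Sym_def)
  have "stage_embed n k j s \<circ> stage_embed n k j t = stage_embed n k j (s \<circ> t)"
  proof (rule stage_embed_eqI[OF assms st])
    show "stage_embed n k j s \<circ> stage_embed n k j t \<in> carrier (Sym (level n j))"
      using J.m_closed[OF stage_embed_closed[OF assms s] stage_embed_closed[OF assms t]]
      by (simp add: Sym_def)
    show "limit_embed n k (s \<circ> t) = limit_embed n j (stage_embed n k j s \<circ> stage_embed n k j t)"
      using assms s t
      by (simp add: limit_embed_comp stage_embed_closed limit_embed_stage_embed)
  qed
  then show "stage_embed n k j (s \<otimes>\<^bsub>Sym (level n k)\<^esub> t) =
      stage_embed n k j s \<otimes>\<^bsub>Sym (level n j)\<^esub> stage_embed n k j t"
    by (simp add: Sym_def)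
qed (use assms stage_embed_closed in auto)

lemma sym_limit_obtain:
  assumes "g \<in> carrier (sym_limit n)"
  obtains k s where "k \<ge> 1" "s \<in> carrier (Sym (level n k))" "g = limit_embed n k s"
  using assms by (auto simp: sym_limit_def)

lemma sym_limit_obtain2:
  assumes "g \<in> carrier (sym_limit n)" "h \<in> carrier (sym_limit n)"
  obtains k s t where "k \<ge> 1" "s \<in> carrier (Sym (level n k))" "t \<in> carrier (Sym (level n k))"
    "g = limit_embed n k s" "h = limit_embed n k t"
proof -
  obtain k s where s: "k \<ge> 1" "s \<in> carrier (Sym (level n k))" "g = limit_embed n k s"
    using assms(1) by (rule sym_limit_obtain)
  obtain j t where t: "j \<ge> 1" "t \<in> carrier (Sym (level n j))" "h = limit_embed n j t"
    using assms(2) by (rule sym_limit_obtain)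
  show ?thesis
  proof (rule that[of "max k j" "stage_embed n k (max k j) s" "stage_embed n j (max k j) t"])
    show "g = limit_embed n (max k j) (stage_embed n k (max k j) s)"
      using s limit_embed_stage_embed[of k "max k j" s] by simp
    show "h = limit_embed n (max k j) (stage_embed n j (max k j) t)"
      using t limit_embed_stage_embed[of j "max k j" t] by simp
  qed (use s t stage_embed_closed in auto)
qed

lemma limit_embed_hom:
  assumes "k \<ge> 1"
  shows "limit_embed n k \<in> hom (Sym (level n k)) (sym_limit n)"
proof (rule homI)
  fix s t assume "s \<in> carrier (Sym (level n k))" "t \<in> carrier (Sym (level n k))"
  then show "limit_embed n k (s \<otimes>\<^bsub>Sym (level n k)\<^esub> t) =
      limit_embed n k s \<otimes>\<^bsub>sym_limit n\<^esub> limit_embed n k t"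
    using limit_embed_comp by (simp add: Sym_def sym_limit_def)
qed (use assms in \<open>auto simp: sym_limit_def\<close>)

lemma group_sym_limit: "group (sym_limit n)"
proof (rule groupI)
  fix g h assume "g \<in> carrier (sym_limit n)" "h \<in> carrier (sym_limit n)"
  then obtain k s t where kst: "k \<ge> 1" "s \<in> carrier (Sym (level n k))"
      "t \<in> carrier (Sym (level n k))" "g = limit_embed n k s" "h = limit_embed n k t"
    by (rule sym_limit_obtain2)
  interpret K: group "Sym (level n k)" by (rule group_Sym)
  have "g \<otimes>\<^bsub>sym_limit n\<^esub> h = limit_embed n k (s \<otimes>\<^bsub>Sym (level n k)\<^esub> t)"
    using hom_mult[OF limit_embed_hom[OF kst(1)] kst(2,3)] kst(4,5) by simp
  then show "g \<otimes>\<^bsub>sym_limit n\<^esub> h \<in> carrier (sym_limit n)"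
    using hom_in_carrier[OF limit_embed_hom[OF kst(1)] K.m_closed[OF kst(2,3)]] by simp
next
  have "id \<in> carrier (Sym (level n 1))" by (simp add: Sym_def permutes_id)
  from hom_in_carrier[OF limit_embed_hom this]
  show "\<one>\<^bsub>sym_limit n\<^esub> \<in> carrier (sym_limit n)"
    unfolding limit_embed_id by (simp add: sym_limit_def)
next
  fix g assume "g \<in> carrier (sym_limit n)"
  then obtain k s where ks: "k \<ge> 1" "s \<in> carrier (Sym (level n k))" "g = limit_embed n k s"
    by (rule sym_limit_obtain)
  interpret K: group "Sym (level n k)" by (rule group_Sym)
  have "limit_embed n k (inv\<^bsub>Sym (level n k)\<^esub> s) \<otimes>\<^bsub>sym_limit n\<^esub> g =
      limit_embed n k \<one>\<^bsub>Sym (level n k)\<^esub>"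
    using hom_mult[OF limit_embed_hom[OF ks(1)] K.inv_closed[OF ks(2)] ks(2)] ks(2,3) by simp
  also have "\<dots> = \<one>\<^bsub>sym_limit n\<^esub>"
    by (simp add: Sym_def sym_limit_def limit_embed_id)
  finally show "\<exists>h \<in> carrier (sym_limit n). h \<otimes>\<^bsub>sym_limit n\<^esub> g = \<one>\<^bsub>sym_limit n\<^esub>"
    using hom_in_carrier[OF limit_embed_hom[OF ks(1)] K.inv_closed[OF ks(2)]] by blast
qed (auto simp: sym_limit_def comp_assoc)

theorem sym_limit_universal:
  assumes f: "\<And>k. k \<ge> 1 \<Longrightarrow> f k \<in> hom (Sym (level n k)) H"
    and compat: "\<And>k j s. 1 \<le> k \<Longrightarrow> k \<le> j \<Longrightarrow> s \<in> carrier (Sym (level n k)) \<Longrightarrow>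
      f j (stage_embed n k j s) = f k s"
  shows "\<exists>h \<in> hom (sym_limit n) H.
    \<forall>k\<ge>1. \<forall>s \<in> carrier (Sym (level n k)). h (limit_embed n k s) = f k s"
proof -
  have wd: "f k s = f j t" if "1 \<le> k" "1 \<le> j" "s \<in> carrier (Sym (level n k))"
      "t \<in> carrier (Sym (level n j))" "limit_embed n k s = limit_embed n j t" for k j s t
  proof (cases "k \<le> j")
    case True
    then show ?thesis using stage_embed_eqI[of k j s t] compat[of k j s] that by simp
  next
    case False
    then show ?thesis using stage_embed_eqI[of j k t s] compat[of j k t] that by simp
  qed
  define h where "h g = (THE y. \<exists>k\<ge>1. \<exists>s \<in> carrier (Sym (level n k)).
    g = limit_embed n k s \<and> y = f k s)" for g
  have h: "h (limit_embed n k s) = f k s" if "k \<ge> 1" "s \<in> carrier (Sym (level n k))" for k s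
    unfolding h_def
  proof (rule the_equality)
    show "\<exists>k'\<ge>1. \<exists>s' \<in> carrier (Sym (level n k')).
        limit_embed n k s = limit_embed n k' s' \<and> f k s = f k' s'"
      using that by blast
  next
    fix y assume "\<exists>k'\<ge>1. \<exists>s' \<in> carrier (Sym (level n k')).
      limit_embed n k s = limit_embed n k' s' \<and> y = f k' s'"
    then obtain k' s' where *: "k' \<ge> 1" "s' \<in> carrier (Sym (level n k'))"
        "limit_embed n k s = limit_embed n k' s'" "y = f k' s'"
      by auto
    show "y = f k s" using wd[OF that(1) *(1) that(2) *(2,3)] *(4) by simp
  qed
  have "h \<in> hom (sym_limit n) H"
  proof (rule homI)
    fix g assume "g \<in> carrier (sym_limit n)"
    then obtain k s where ks: "k \<ge> 1" "s \<in> carrier (Sym (level n k))" "g = limit_embed n k s"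
      by (rule sym_limit_obtain)
    show "h g \<in> carrier H"
      using hom_in_carrier[OF f[OF ks(1)] ks(2)] h[OF ks(1,2)] ks(3) by simp
  next
    fix g g' assume "g \<in> carrier (sym_limit n)" "g' \<in> carrier (sym_limit n)"
    then obtain k s t where kst: "k \<ge> 1" "s \<in> carrier (Sym (level n k))"
        "t \<in> carrier (Sym (level n k))" "g = limit_embed n k s" "g' = limit_embed n k t"
      by (rule sym_limit_obtain2)
    interpret K: group "Sym (level n k)" by (rule group_Sym)
    have "h (g \<otimes>\<^bsub>sym_limit n\<^esub> g') = h (limit_embed n k (s \<otimes>\<^bsub>Sym (level n k)\<^esub> t))"
      using hom_mult[OF limit_embed_hom[OF kst(1)] kst(2,3)] kst(4,5) by simp
    also have "\<dots> = f k (s \<otimes>\<^bsub>Sym (level n k)\<^esub> t)"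
      using h[OF kst(1) K.m_closed[OF kst(2,3)]] .
    also have "\<dots> = f k s \<otimes>\<^bsub>H\<^esub> f k t" using hom_mult[OF f[OF kst(1)] kst(2,3)] .
    finally show "h (g \<otimes>\<^bsub>sym_limit n\<^esub> g') = h g \<otimes>\<^bsub>H\<^esub> h g'" using h[OF kst(1,2)] h[OF kst(1,3)] kst(4,5) by simp
  qed
  with h show ?thesis by blast
qed

lemma card_moved_stage_embed:
  assumes "k \<le> j"
  shows "card {x \<in> {..<level n j}. stage_embed n k j s x \<noteq> x} * level n k =
    card {x \<in> {..<level n k}. s x \<noteq> x} * level n j"
proof -
  let ?M = "level n k" and ?N = "level n j"
  obtain q where q: "?N = ?M * q" using level_dvd[OF assms(1)] by (auto elim: dvdE)
  have M: "?M > 0" by (rule level_pos)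
  have fix_iff: "stage_embed n k j s x = x \<longleftrightarrow> s (x mod ?M) = x mod ?M" if "x < ?N" for x
    using that by (simp add: stage_embed_def) (metis add_right_cancel mod_mult_div_eq)
  have "bij_betw (\<lambda>x. (x mod ?M, x div ?M)) {x \<in> {..<?N}. stage_embed n k j s x \<noteq> x}
      ({x \<in> {..<?M}. s x \<noteq> x} \<times> {..<q})"
  proof (rule bij_betw_byWitness[where f' = "\<lambda>(a, b). a + ?M * b"])
    have "a + ?M * b < ?N" if "a < ?M" "b < q" for a b
    proof -
      have "a + ?M * b < ?M * Suc b" using that by simp
      also have "\<dots> \<le> ?M * q" using that by (intro mult_le_mono2) simp
      finally show ?thesis using q by simp
    qed
    then show "(\<lambda>(a, b). a + ?M * b) ` ({x \<in> {..<?M}. s x \<noteq> x} \<times> {..<q})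
        \<subseteq> {x \<in> {..<?N}. stage_embed n k j s x \<noteq> x}"
      using fix_iff by auto
    have "x div ?M < q" if "x < ?N" for x
      using that unfolding q by (simp add: less_mult_imp_div_less mult.commute)
    then show "(\<lambda>x. (x mod ?M, x div ?M)) ` {x \<in> {..<?N}. stage_embed n k j s x \<noteq> x}
        \<subseteq> {x \<in> {..<?M}. s x \<noteq> x} \<times> {..<q}"
      using fix_iff M by auto
  qed auto
  then have "card {x \<in> {..<?N}. stage_embed n k j s x \<noteq> x} = card {x \<in> {..<?M}. s x \<noteq> x} * q"
    by (simp add: bij_betw_same_card card_cartesian_product)
  then show ?thesis using q by simp
qed

lemma chi_nat_eq:
  assumes "k \<ge> 1" "s \<in> carrier (Sym (level n k))"
  shows "chi_nat n (limit_embed n k s) =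
    1 - of_nat (card {x \<in> {..<level n k}. s x \<noteq> x}) / of_nat (level n k)"
proof -
  define v :: "nat \<Rightarrow> (nat \<Rightarrow> nat) \<Rightarrow> complex"
    where "v k s = 1 - of_nat (card {x \<in> {..<level n k}. s x \<noteq> x}) / of_nat (level n k)" for k s
  have stage: "v j (stage_embed n k j s) = v k s" if "k \<le> j" for k j s
  proof -
    have "of_nat (card {x \<in> {..<level n j}. stage_embed n k j s x \<noteq> x}) * of_nat (level n k) =
      (of_nat (card {x \<in> {..<level n k}. s x \<noteq> x}) * of_nat (level n j) :: complex)"
      using arg_cong[OF card_moved_stage_embed[OF that, of s], of "of_nat :: nat \<Rightarrow> complex"]
      by (simp only: of_nat_mult)
    moreover have "of_nat (level n k) \<noteq> (0 :: complex)" "of_nat (level n j) \<noteq> (0 :: complex)"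
      using level_pos[of k] level_pos[of j] by simp_all
    ultimately show ?thesis by (simp add: v_def frac_eq_eq)
  qed
  have wd: "v k s = v j t" if "s \<in> carrier (Sym (level n k))"
      "t \<in> carrier (Sym (level n j))" "limit_embed n k s = limit_embed n j t" for k j s t
  proof (cases "k \<le> j")
    case True
    show ?thesis using stage_embed_eqI[OF True that] stage[OF True, of s] by simp
  next
    case False
    then have "j \<le> k" by simp
    from stage_embed_eqI[OF this that(2,1) that(3)[symmetric]] stage[OF this, of t]
    show ?thesis by simp
  qed
  have "chi_nat n (limit_embed n k s) = v k s"
    unfolding chi_nat_def v_def[symmetric]
  proof (rule the_equality)
    show "\<exists>k'\<ge>1. \<exists>s' \<in> carrier (Sym (level n k')).
        limit_embed n k s = limit_embed n k' s' \<and> v k s = v k' s'"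
      using assms by blast
  next
    fix c assume "\<exists>k'\<ge>1. \<exists>s' \<in> carrier (Sym (level n k')).
      limit_embed n k s = limit_embed n k' s' \<and> c = v k' s'"
    then obtain k' s' where *: "s' \<in> carrier (Sym (level n k'))"
        "limit_embed n k s = limit_embed n k' s'" "c = v k' s'"
      by auto
    show "c = v k s" using wd[OF assms(2) *(1,2)] *(3) by simp
  qed
  then show ?thesis by (simp add: v_def)
qed

lemma sgn_stage_limit_embed:
  assumes "k \<le> j" and s: "s \<in> carrier (Sym (level n k))"
  shows "sgn_stage n j (limit_embed n k s) = sign (stage_embed n k j s)"
  using inv_into_f_f[OF limit_embed_inj[of j] stage_embed_closed[OF assms]]
    limit_embed_stage_embed[OF assms] by (simp add: sgn_stage_def)

lemma sign_blocks:
  assumes M: "M > 0" and s: "s permutes {..<M}"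
  shows "(\<lambda>x. if x < M * q then s (x mod M) + M * (x div M) else x) permutes {..<M * q} \<and>
    sign (\<lambda>x. if x < M * q then s (x mod M) + M * (x div M) else x) = sign s ^ q"
proof (induction q)
  case 0
  show ?case by (simp add: id_def[symmetric])
next
  case (Suc q)
  let ?f = "\<lambda>q x. if x < M * q then s (x mod M) + M * (x div M) else x"
  let ?A = "{M * q..<M * Suc q}"
  let ?t = "map_permutation {..<M} (\<lambda>x. x + M * q) s"
  have bij: "bij_betw (\<lambda>x. x + M * q) {..<M} ?A"
    by (rule bij_betw_byWitness[where f' = "\<lambda>x. x - M * q"]) auto
  have t: "?t permutes ?A" by (rule map_permutation_permutes[OF bij s])
  have st: "sign ?t = sign s"
    by (rule sign_map_permutation) (use bij s in \<open>auto simp: bij_betw_def\<close>)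
  have tv: "?t x = s (x - M * q) + M * q" if "x \<in> ?A" for x
  proof -
    have "?t ((x - M * q) + M * q) = s (x - M * q) + M * q"
      using that bij_betw_imp_inj_on[OF bij] by (subst map_permutation_apply) auto
    then show ?thesis using that by simp
  qed
  have eq: "?f (Suc q) = ?f q \<circ> ?t"
  proof
    fix x
    consider "x < M * q" | "x \<in> ?A" | "x \<ge> M * Suc q" by fastforce
    then show "?f (Suc q) x = (?f q \<circ> ?t) x"
    proof cases
      case 1
      then show ?thesis using permutes_not_in[OF t, of x] by simp
    next
      case 2
      then have "x div M = q" using M by (intro div_nat_eqI) (auto simp: mult.commute)
      then have "x mod M = x - M * q" by (simp add: modulo_nat_def mult.commute)
      then show ?thesis using 2 tv[OF 2] \<open>x div M = q\<close> by simp
    next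
      case 3
      then show ?thesis using permutes_not_in[OF t, of x] by simp
    qed
  qed
  have p1: "?f q permutes {..<M * Suc q}"
    by (rule permutes_subset[OF conjunct1[OF Suc.IH]]) auto
  have p2: "?t permutes {..<M * Suc q}"
    by (rule permutes_subset[OF t]) auto
  have "sign (?f (Suc q)) = sign (?f q) * sign ?t"
    unfolding eq by (rule sign_compose) (use p1 p2 in \<open>auto simp: permutation_permutes\<close>)
  moreover have "?f (Suc q) permutes {..<M * Suc q}"
    unfolding eq by (rule permutes_compose[OF p2 p1])
  ultimately show ?case using Suc.IH st by (simp add: mult.commute)
qed

lemma sgn_stage_eventually_const:
  assumes "g \<in> carrier (sym_limit n)"
  shows "\<exists>e. (\<forall>\<^sub>F k in sequentially. sgn_stage n k g = e) \<and> sgn_infinity n g = of_int e"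
proof -
  obtain k s where ks: "k \<ge> 1" "s \<in> carrier (Sym (level n k))" "g = limit_embed n k s"
    using assms by (rule sym_limit_obtain)
  define r where "r j = (\<Prod>i=Suc k..j. n i)" for j
  have sg: "sgn_stage n j g = sign s ^ r j" if "k \<le> j" for j
  proof -
    have "s permutes {..<level n k}" using ks by (simp add: Sym_def)
    then show ?thesis
      using sgn_stage_limit_embed[OF that ks(2)] ks(3)
        sign_blocks[OF level_pos, of s k "r j"] level_split[OF that]
      by (simp add: stage_embed_def r_def)
  qed
  have pow: "sign s ^ m = (if even m then 1 else sign s)" for m
    by (cases s rule: sign_cases) auto
  have "\<exists>e. \<forall>\<^sub>F j in sequentially. sgn_stage n j g = e"
  proof (cases "\<exists>i>k. even (n i)")
    case True
    then obtain i where i: "i > k" "even (n i)" by blast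
    have "sgn_stage n j g = 1" if "j \<ge> i" for j
    proof -
      have "n i dvd r j" unfolding r_def using i that by (intro dvd_prodI) auto
      then have "even (r j)" using i(2) dvd_trans by blast
      then show ?thesis using sg[of j] pow i that by simp
    qed
    then show ?thesis unfolding eventually_sequentially by blast
  next
    case False
    have "sgn_stage n j g = sign s" if "j \<ge> k" for j
    proof -
      have "odd (r j)" unfolding r_def using False by (auto simp: even_prod_iff)
      then show ?thesis using sg[OF that] pow by simp
    qed
    then show ?thesis unfolding eventually_sequentially by blast
  qed
  then obtain e where e: "\<forall>\<^sub>F j in sequentially. sgn_stage n j g = e" by blast
  then have "\<forall>\<^sub>F j in sequentially. of_int (sgn_stage n j g) = (of_int e :: complex)"
    by eventually_elim simp
  then have "(\<lambda>j. of_int (sgn_stage n j g)) \<longlonglongrightarrow> (of_int e :: complex)"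
    by (rule tendsto_eventually)
  then show ?thesis using e limI unfolding sgn_infinity_def by blast
qed

end

end

theory Submission
  imports Defs "HOL-Complex_Analysis.Great_Picard"
begin

text \<open>The limit group \<open>G\<close> acts on the natural numbers, so every \<open>g\<close> has a support, and the proof
  recovers \<open>\<chi>\<close> from the density of the fixed points in three steps.

  \<^emph>\<open>Dependence on the support.\<close> Fix a periodic set \<open>A\<close> and split each point into fibre points on
  which an elementary abelian \<open>p\<close>-group acts freely (some large prime power always divides the index
  of two stages). All fibrewise permutations of \<open>A\<close> without trivial component are conjugate, so
  averaging over them compresses \<open>\<chi>\<close> to a positive-definite function that agrees with \<open>\<chi>\<close> on the
  elements of support \<open>A\<close>. In the limit it takes the value \<open>W A\<close>, the supremum of the moduli of
  \<open>\<chi>\<close> on these elements, at the identity. Commutators of nearly extremal elements with a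
  transposition can be arranged to be any given product of two disjoint transpositions; these
  therefore lie in its kernel, and \<open>\<chi>\<close> equals \<open>W A\<close> on all even elements of support \<open>A\<close>.

  \<^emph>\<open>The exponent.\<close> Indecomposability makes \<open>\<chi>\<close> asymptotically multiplicative along asymptotically
  central sequences. Hence the left-continuous version of \<open>\<chi>\<close>, as a function of the density of
  fixed points, is monotone and multiplicative: it vanishes or is \<open>x powr s\<close>. Positivity on
  commuting involutions bounds all finite differences of \<open>x powr s\<close> below by zero, so \<open>s\<close> is natural.

  \<^emph>\<open>Odd elements.\<close> Odd transpositions of high stages have small support and are again
  asymptotically central, which fixes \<open>\<chi>\<close> on odd elements up to a global sign.\<close>

unbundle no vec_syntax

hide_const (open) Finite_Cartesian_Product.transpose


section \<open>Positive-definite functions\<close>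

text \<open>In the GNS picture, averaging over the fibrewise elements built from \<open>V\<close> is
  the projection onto the vectors they fix. Here the same computation is done with finite
  positive-definite forms and with limits of functions on a countable group. Two independent choices
  of components in \<open>V\<close> over a set \<open>A\<close> coincide somewhere with frequency at
  most \<open>card A / card V\<close>, so \<open>V\<close> must be huge compared with
  \<open>A\<close>. The sequence is arbitrary and a given prime need not divide any term, so
  \<open>V\<close> has to come from the size of an index alone. A priori \<chi> is complex and its
  supremum over a support need not be attained. A double transposition therefore only receives the
  lower bound \<open>4 * cmod (\<chi> g1) - 3 * W A\<close>; as the coefficients differ by one,
  letting \<open>g1\<close> approach the supremum gives exactly \<open>W A\<close>, the value at the
  identity. Even elements come first because the sign of a periodic extension depends on all later
  terms of the sequence: odd elements may not exist at all, while squares and free elements are even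
  in every case.\<close>

abbreviation iv :: "('a \<Rightarrow> 'a) \<Rightarrow> 'a \<Rightarrow> 'a"
  where "iv g \<equiv> inv_into UNIV g"

locale perm_group =
  fixes H :: "('a \<Rightarrow> 'a) set"
  assumes id_mem: "id \<in> H"
    and comp_mem: "g \<in> H \<Longrightarrow> h \<in> H \<Longrightarrow> g \<circ> h \<in> H"
    and inv_mem: "g \<in> H \<Longrightarrow> iv g \<in> H"
    and bij_mem: "g \<in> H \<Longrightarrow> bij g"
begin

lemma inv_comp: "g \<in> H \<Longrightarrow> h \<in> H \<Longrightarrow> iv (g \<circ> h) = iv h \<circ> iv g"
  by (simp add: bij_mem o_inv_distrib)

lemma inv_left: "g \<in> H \<Longrightarrow> iv g \<circ> g = id"
  by (simp add: bij_mem bij_is_inj)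

lemma inv_right: "g \<in> H \<Longrightarrow> g \<circ> iv g = id"
  by (rule surj_iff[THEN iffD1]) (simp add: bij_mem bij_is_surj)

lemma inv_inv: "g \<in> H \<Longrightarrow> iv (iv g) = g"
  by (simp add: bij_mem inv_inv_eq)

lemma inv_left': "g \<in> H \<Longrightarrow> iv g \<circ> (g \<circ> h) = h"
  by (simp only: comp_assoc[symmetric] inv_left id_comp)

lemma inv_right': "g \<in> H \<Longrightarrow> g \<circ> (iv g \<circ> h) = h"
  by (simp only: comp_assoc[symmetric] inv_right id_comp)

lemmas group_simps = inv_comp inv_left inv_right inv_inv inv_left' inv_right' comp_assoc
  id_mem comp_mem inv_mem

end

definition qform :: "(('a \<Rightarrow> 'a) \<Rightarrow> complex) \<Rightarrow> 'i set \<Rightarrow> ('i \<Rightarrow> 'a \<Rightarrow> 'a) \<Rightarrow> ('i \<Rightarrow> complex) \<Rightarrow> complex"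
  where "qform f I g c = (\<Sum>i\<in>I. \<Sum>j\<in>I. cnj (c i) * f (g i \<circ> iv (g j)) * c j)"

text \<open>Conjugate symmetry makes every form real, so a condition on the real part alone gives
  Hermitian positive semidefiniteness; see \<open>positive_definite_iff\<close>.\<close>

definition pos_def :: "('a \<Rightarrow> 'a) set \<Rightarrow> (('a \<Rightarrow> 'a) \<Rightarrow> complex) \<Rightarrow> bool"
  where "pos_def H f \<longleftrightarrow> (\<forall>g\<in>H. f (iv g) = cnj (f g)) \<and>
    (\<forall>m (g :: nat \<Rightarrow> 'a \<Rightarrow> 'a) c. (\<forall>i<m. g i \<in> H) \<longrightarrow> 0 \<le> Re (qform f {..<m} g c))"

lemma pos_def_inv: "pos_def H f \<Longrightarrow> g \<in> H \<Longrightarrow> f (iv g) = cnj (f g)"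
  by (simp add: pos_def_def)

lemma pos_def_form:
  assumes "pos_def H f" "finite I" "\<And>i. i \<in> I \<Longrightarrow> g i \<in> H"
  shows "0 \<le> Re (qform f I g c)"
proof -
  obtain h where h: "bij_betw h {..<card I} I"
    using ex_bij_betw_nat_finite[OF assms(2)] by (auto simp: atLeast0LessThan)
  have "qform f I g c = qform f {..<card I} (g \<circ> h) (c \<circ> h)"
    unfolding qform_def by (simp add: sum.reindex_bij_betw[OF h, symmetric])
  moreover have "\<forall>i<card I. (g \<circ> h) i \<in> H"
    using h assms(3) by (auto simp: bij_betw_def)
  ultimately show ?thesis using assms(1) unfolding pos_def_def by metis
qed

lemma sum_option:
  assumes "finite I"
  shows "(\<Sum>x \<in> insert None (Some ` I). F x) = F None + (\<Sum>i\<in>I. F (Some i))"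
  using assms by (simp add: sum.reindex)

context perm_group
begin

text \<open>With \<open>S\<close> the sum on the left, adjoin the identity to the family with weight
  \<open>- t * cnj S\<close>. Positivity becomes a quadratic inequality in the real parameter
  \<open>t\<close>, and \<open>t = 1 / r\<close> gives the bound; if \<open>r = 0\<close> the
  inequality is affine in \<open>t\<close>, which forces \<open>S = 0\<close>.\<close>

lemma pos_def_cauchy_schwarz:
  assumes f: "pos_def H f" and I: "finite I" and g: "\<And>i. i \<in> I \<Longrightarrow> g i \<in> H"
  shows "(cmod (\<Sum>i\<in>I. cnj (c i) * f (g i)))\<^sup>2 \<le> Re (f id) * Re (qform f I g c)"
proof -
  define S where "S = (\<Sum>i\<in>I. cnj (c i) * f (g i))"
  define Q where "Q = Re (qform f I g c)"
  define r where "r = Re (f id)"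
  have key: "0 \<le> t\<^sup>2 * (cmod S)\<^sup>2 * r - 2 * t * (cmod S)\<^sup>2 + Q" for t :: real
  proof -
    define z where "z = - of_real t * cnj S"
    let ?J = "insert None (Some ` I)"
    let ?g = "\<lambda>x. case x of None \<Rightarrow> id | Some i \<Rightarrow> g i"
    let ?c = "\<lambda>x. case x of None \<Rightarrow> z | Some i \<Rightarrow> c i"
    have "(\<Sum>j\<in>I. cnj z * f (id \<circ> iv (g j)) * c j) = cnj (z * S)"
      unfolding S_def sum_distrib_left cnj_sum
      by (rule sum.cong) (use pos_def_inv[OF f g] in auto)
    moreover have "(\<Sum>i\<in>I. cnj (c i) * f (g i \<circ> iv id) * z) = z * S"
      unfolding S_def sum_distrib_left by (rule sum.cong) auto
    ultimately have "qform f ?J ?g ?c = cnj z * f id * z + cnj (z * S) + (z * S + qform f I g c)"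
      unfolding qform_def sum_option[OF I] by (simp add: sum.distrib)
    moreover have "0 \<le> Re (qform f ?J ?g ?c)"
      by (rule pos_def_form[OF f]) (use I g id_mem in auto)
    ultimately have "0 \<le> Re (cnj z * f id * z) + 2 * Re (z * S) + Q"
      by (simp add: Q_def algebra_simps)
    moreover have "z * S = - of_real (t * (cmod S)\<^sup>2)"
      by (simp add: z_def mult.assoc complex_norm_square[symmetric] mult.commute[of "cnj S"])
    moreover have "cnj z * f id * z = of_real (t\<^sup>2 * (cmod S)\<^sup>2) * f id"
    proof -
      have "cnj z * f id * z = of_real (t\<^sup>2) * (S * cnj S) * f id"
        by (simp add: z_def power2_eq_square)
      then show ?thesis by (simp only: complex_norm_square[symmetric] of_real_mult)
    qed
    ultimately show ?thesis by (simp add: r_def)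
  qed
  have r: "r \<ge> 0"
    using pos_def_form[OF f, of "{()}" "\<lambda>_. id" "\<lambda>_. 1"] by (simp add: id_mem qform_def r_def)
  show ?thesis
  proof (cases "r = 0")
    case False
    then have "r > 0" using r by simp
    have "(1 / r)\<^sup>2 * (cmod S)\<^sup>2 * r = (cmod S)\<^sup>2 / r"
      using \<open>r > 0\<close> by (simp add: power2_eq_square)
    then have "(cmod S)\<^sup>2 / r \<le> Q" using key[of "1 / r"] by simp
    then have "(cmod S)\<^sup>2 \<le> r * Q"
      using \<open>r > 0\<close> by (simp add: divide_le_eq mult.commute)
    then show ?thesis by (simp only: S_def Q_def r_def)
  next
    case True
    have "cmod S = 0"
    proof (rule ccontr)
      assume "cmod S \<noteq> 0"
      then have "2 * ((Q + 1) / (2 * (cmod S)\<^sup>2)) * (cmod S)\<^sup>2 = Q + 1" by simp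
      then show False using key[of "(Q + 1) / (2 * (cmod S)\<^sup>2)"] True by simp
    qed
    then show ?thesis using True by (simp only: S_def r_def) simp
  qed
qed

lemma pos_def_id_nonneg: "pos_def H f \<Longrightarrow> Re (f id) \<ge> 0 \<and> f id = of_real (Re (f id))"
  using pos_def_form[of H f "{()}" "\<lambda>_. id" "\<lambda>_. 1"] pos_def_inv[of H f id]
  by (auto simp: id_mem qform_def complex_eq_iff)

lemma pos_def_norm_le:
  assumes f: "pos_def H f" and g: "g \<in> H"
  shows "cmod (f g) \<le> Re (f id)"
proof -
  have "(cmod (f g))\<^sup>2 \<le> (Re (f id))\<^sup>2"
    using pos_def_cauchy_schwarz[OF f, of "{()}" "\<lambda>_. g" "\<lambda>_. 1"] g
    by (simp add: qform_def inv_right power2_eq_square)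
  then show ?thesis using pos_def_id_nonneg[OF f] power2_le_imp_le by blast
qed

text \<open>Krein's inequality, from Cauchy-Schwarz with the weights 1 and -1. Values at two points
  are close as soon as the value at their quotient is close to the value at the identity; this later
  turns small commutators into approximate centrality.\<close>

lemma pos_def_diff_le:
  assumes f: "pos_def H f" and a: "a \<in> H" and b: "b \<in> H"
  shows "(cmod (f a - f b))\<^sup>2 \<le> 2 * Re (f id) * (Re (f id) - Re (f (a \<circ> iv b)))"
proof -
  have "f (b \<circ> iv a) = cnj (f (a \<circ> iv b))"
    using pos_def_inv[OF f, of "a \<circ> iv b"] a b by (simp add: group_simps)
  then show ?thesis
    using pos_def_cauchy_schwarz[OF f, of UNIV "\<lambda>i. if i then a else b" "\<lambda>i. if i then 1 else -1"] a b
    by (simp add: UNIV_bool qform_def inv_right algebra_simps)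
qed

text \<open>The quotient of \<open>a \<circ> g\<close> and \<open>g\<close> is conjugation-free: it
  is \<open>a\<close> itself, so the right side of \<open>pos_def_diff_le\<close> vanishes.\<close>

lemma pos_def_kernel:
  assumes f: "pos_def H f" and a: "a \<in> H" and g: "g \<in> H" and eq: "f a = f id"
  shows "f (a \<circ> g) = f g"
  using pos_def_diff_le[OF f comp_mem[OF a g] g] a g eq by (simp add: group_simps)

text \<open>Positivity for \<open>a\<close>, \<open>b\<close> and the identity with weights \<open>1, 1, -2 e\<close>, where \<open>e\<close> is the
  conjugate phase of \<open>f a = f b\<close>.\<close>

lemma pos_def_quotient_ge:
  assumes f: "pos_def H f" and a: "a \<in> H" and b: "b \<in> H" and eq: "f a = f b"
  shows "Re (f (a \<circ> iv b)) \<ge> 4 * cmod (f a) - 3 * Re (f id)"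
proof (cases "f a = 0")
  case True
  then show ?thesis
    using abs_Re_le_cmod[of "f (a \<circ> iv b)"] pos_def_norm_le[OF f, of "a \<circ> iv b"] pos_def_id_nonneg[OF f] a b
    by (simp add: group_simps)
next
  case False
  define e where "e = cnj (sgn (f a))"
  have e: "f a * e = of_real (cmod (f a))" "cnj e * e = 1"
  proof -
    show "f a * e = of_real (cmod (f a))"
      using False complex_norm_square[of "f a"]
      by (simp add: e_def sgn_div_norm power2_eq_square divide_simps scaleR_conv_of_real)
    show "cnj e * e = 1"
      using False complex_norm_square[of "sgn (f a)"] by (simp add: e_def norm_sgn)
  qed
  have inv: "f (iv a) = cnj (f a)" "f (iv b) = cnj (f a)"
    using pos_def_inv[OF f a] pos_def_inv[OF f b] eq by simp_all
  have ba: "f (b \<circ> iv a) = cnj (f (a \<circ> iv b))"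
    using pos_def_inv[OF f, of "a \<circ> iv b"] a b by (simp add: group_simps)
  let ?I = "{0, 1, 2 :: nat}"
  let ?g = "\<lambda>i :: nat. if i = 0 then a else if i = 1 then b else id"
  let ?c = "\<lambda>i :: nat. if i = 0 then 1 else if i = 1 then 1 else - 2 * e"
  have "qform f ?I ?g ?c = 2 * f id + f (a \<circ> iv b) + cnj (f (a \<circ> iv b))
      - 4 * (f a * e) - 4 * cnj (f a * e) + 4 * (cnj e * e) * f id"
    using a b eq by (simp add: qform_def inv_right inv ba algebra_simps)
  moreover have "0 \<le> Re (qform f ?I ?g ?c)"
    by (rule pos_def_form[OF f]) (use a b id_mem in auto)
  ultimately show ?thesis unfolding e by simp
qed

end

definition avg :: "'i set \<Rightarrow> ('i \<Rightarrow> complex) \<Rightarrow> complex"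
  where "avg I F = (\<Sum>i\<in>I. F i) / of_nat (card I)"

lemma cnj_avg: "cnj (avg I F) = avg I (\<lambda>i. cnj (F i))"
  by (simp add: avg_def)

lemma avg_Times: "avg (I \<times> J) F = avg I (\<lambda>i. avg J (\<lambda>j. F (i, j)))"
  by (simp add: avg_def sum.cartesian_product' card_cartesian_product sum_divide_distrib
      mult.commute)

lemma avg_cong: "(\<And>i. i \<in> I \<Longrightarrow> F i = F' i) \<Longrightarrow> avg I F = avg I F'"
  by (simp add: avg_def)

lemma avg_norm_le:
  assumes "finite I" "I \<noteq> {}" "\<And>i. i \<in> I \<Longrightarrow> cmod (F i) \<le> b"
  shows "cmod (avg I F) \<le> b"
proof -
  have "cmod (\<Sum>i\<in>I. F i) \<le> real (card I) * b"
    using sum_norm_le[of I F "\<lambda>_. b"] assms by simp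
  moreover have "card I > 0" using assms by (simp add: card_gt_0_iff)
  ultimately show ?thesis by (simp add: avg_def norm_divide field_simps)
qed

lemma avg_near:
  assumes I: "finite I" "I \<noteq> {}" and B: "B \<subseteq> I" "real (card B) \<le> \<epsilon> * real (card I)"
    and F: "\<And>i. i \<in> I \<Longrightarrow> cmod (F i) \<le> 1" "\<And>i. i \<in> I - B \<Longrightarrow> F i = w" and w: "cmod w \<le> 1"
  shows "cmod (avg I F - w) \<le> 2 * \<epsilon>"
proof -
  have c: "card I > 0" using I by (simp add: card_gt_0_iff)
  have "(\<Sum>i\<in>I. F i - w) = (\<Sum>i\<in>B. F i - w)"
    by (rule sum.mono_neutral_right) (use I B F in auto)
  also have "cmod \<dots> \<le> (\<Sum>i\<in>B. 2)"
    using F(1) w B(1) by (intro sum_norm_le) (smt (verit) norm_triangle_ineq4 subsetD)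
  also have "\<dots> \<le> 2 * \<epsilon> * real (card I)" using B(2) by simp
  finally have "cmod (\<Sum>i\<in>I. F i - w) \<le> 2 * \<epsilon> * real (card I)" .
  moreover have "avg I F - w = (\<Sum>i\<in>I. F i - w) / of_nat (card I)"
    using c by (simp add: avg_def sum_subtractf diff_divide_distrib)
  ultimately show ?thesis using c by (simp add: norm_divide divide_le_eq)
qed

context perm_group
begin

text \<open>Cauchy-Schwarz for the weights \<open>1 / card I\<close> on the \<open>g i\<close> and
  \<open>- 1 / card J\<close> on the \<open>h j\<close>. Two averages of \<open>f\<close> nearly
  agree once the three mean values of \<open>f\<close> over quotients are close to one common
  number.\<close>

lemma pos_def_avg_diff:
  assumes f: "pos_def H f" and I: "finite I" "I \<noteq> {}" and J: "finite J" "J \<noteq> {}"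
    and g: "\<And>i. i \<in> I \<Longrightarrow> g i \<in> H" and h: "\<And>j. j \<in> J \<Longrightarrow> h j \<in> H"
  shows "(cmod (avg I (\<lambda>i. f (g i)) - avg J (\<lambda>j. f (h j))))\<^sup>2 \<le>
    Re (f id) * (Re (avg I (\<lambda>i. avg I (\<lambda>i'. f (g i \<circ> iv (g i'))))) +
      Re (avg J (\<lambda>j. avg J (\<lambda>j'. f (h j \<circ> iv (h j'))))) -
      2 * Re (avg I (\<lambda>i. avg J (\<lambda>j. f (g i \<circ> iv (h j))))))"
proof -
  let ?K = "I <+> J"
  let ?g = "case_sum g h"
  let ?c = "case_sum (\<lambda>_. 1 / of_nat (card I)) (\<lambda>_. - 1 / of_nat (card J)) :: 'b + 'c \<Rightarrow> complex"
  have sum_split: "(\<Sum>x\<in>?K. F x) = (\<Sum>i\<in>I. F (Inl i)) + (\<Sum>j\<in>J. F (Inr j))"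
    for F :: "'b + 'c \<Rightarrow> complex"
    using I J by (simp add: sum.Plus)
  have eq1: "(\<Sum>i\<in>?K. cnj (?c i) * f (?g i)) = avg I (\<lambda>i. f (g i)) - avg J (\<lambda>j. f (h j))"
    unfolding sum_split avg_def sum_divide_distrib by (simp add: sum_negf)
  have eq2: "qform f ?K ?g ?c = avg I (\<lambda>i. avg I (\<lambda>i'. f (g i \<circ> iv (g i')))) +
      avg J (\<lambda>j. avg J (\<lambda>j'. f (h j \<circ> iv (h j')))) -
      avg I (\<lambda>i. avg J (\<lambda>j. f (g i \<circ> iv (h j)))) - avg J (\<lambda>j. avg I (\<lambda>i. f (h j \<circ> iv (g i))))"
    unfolding qform_def sum_split avg_def sum_divide_distrib
    by (simp add: sum.distrib sum_negf sum_subtractf mult.commute)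
  have eq3: "avg J (\<lambda>j. avg I (\<lambda>i. f (h j \<circ> iv (g i)))) =
      cnj (avg I (\<lambda>i. avg J (\<lambda>j. f (g i \<circ> iv (h j)))))"
  proof -
    have "avg J (\<lambda>j. avg I (\<lambda>i. f (h j \<circ> iv (g i)))) = avg I (\<lambda>i. avg J (\<lambda>j. f (h j \<circ> iv (g i))))"
      unfolding avg_def sum_divide_distrib by (subst sum.swap) (simp add: mult.commute)
    also have "\<dots> = avg I (\<lambda>i. avg J (\<lambda>j. cnj (f (g i \<circ> iv (h j)))))"
    proof (intro avg_cong)
      fix i j assume "i \<in> I" "j \<in> J"
      then show "f (h j \<circ> iv (g i)) = cnj (f (g i \<circ> iv (h j)))"
        using pos_def_inv[OF f, of "g i \<circ> iv (h j)"] g h by (simp add: group_simps)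
    qed
    finally show ?thesis by (simp add: cnj_avg)
  qed
  have "(cmod (\<Sum>i\<in>?K. cnj (?c i) * f (?g i)))\<^sup>2 \<le> Re (f id) * Re (qform f ?K ?g ?c)"
    by (rule pos_def_cauchy_schwarz[OF f]) (use I J g h in auto)
  moreover have "Re (qform f ?K ?g ?c) = Re (avg I (\<lambda>i. avg I (\<lambda>i'. f (g i \<circ> iv (g i'))))) +
      Re (avg J (\<lambda>j. avg J (\<lambda>j'. f (h j \<circ> iv (h j'))))) -
      2 * Re (avg I (\<lambda>i. avg J (\<lambda>j. f (g i \<circ> iv (h j)))))"
    unfolding eq2 eq3 by simp
  ultimately show ?thesis unfolding eq1 by simp
qed

end

section \<open>Permutations of the residues modulo N\<close>

text \<open>The periodic extensions of the permutations of \<open>{..<N}\<close>; \<open>stage (level n k)\<close> is the image of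
  stage \<open>k\<close> in the limit.\<close>

definition stage :: "nat \<Rightarrow> (nat \<Rightarrow> nat) set"
  where "stage N = {g. bij g \<and> (\<forall>x. g x div N = x div N \<and> g x mod N = g (x mod N))}"

lemma stage_bij: "g \<in> stage N \<Longrightarrow> bij g"
  and stage_div: "g \<in> stage N \<Longrightarrow> g x div N = x div N"
  and stage_mod: "g \<in> stage N \<Longrightarrow> g x mod N = g (x mod N)"
  by (simp_all add: stage_def)

lemma stage_apply: "g \<in> stage N \<Longrightarrow> g x = g (x mod N) + N * (x div N)"
  by (metis stage_div stage_mod mod_mult_div_eq)

lemma stage_less:
  assumes "g \<in> stage N" "x < N"
  shows "g x < N"
  using stage_div[OF assms(1), of x] assms(2) by (metis div_less div_eq_0_iff not_less_zero)

lemma stage_group: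
  assumes "N > 0"
  shows "perm_group (stage N)"
proof
  show "id \<in> stage N" by (simp add: stage_def)
  show "g \<circ> h \<in> stage N" if "g \<in> stage N" "h \<in> stage N" for g h
    using that by (auto simp: stage_def bij_comp)
  show "bij g" if "g \<in> stage N" for g using that by (rule stage_bij)
  show "iv g \<in> stage N" if g: "g \<in> stage N" for g
  proof -
    have b: "bij g" by (rule stage_bij[OF g])
    have "iv g y div N = y div N" for y
      using stage_div[OF g, of "iv g y"] by (simp add: bij_is_surj[OF b] surj_f_inv_f)
    moreover have "iv g y mod N = iv g (y mod N)" for y
    proof -
      have "g (iv g y mod N) = y mod N"
        using stage_mod[OF g, of "iv g y"] by (simp add: bij_is_surj[OF b] surj_f_inv_f)
      then show ?thesis by (metis b bij_is_inj inv_f_f)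
    qed
    ultimately show ?thesis using bij_imp_bij_inv[OF b] by (simp add: stage_def)
  qed
qed

lemma stage_mono:
  assumes "N dvd M"
  shows "stage N \<subseteq> stage M"
proof
  fix g assume g: "g \<in> stage N"
  obtain q where q: "M = N * q" using assms by auto
  have "g x div M = x div M" for x
    using stage_div[OF g, of x] by (simp add: q div_mult2_eq)
  moreover have "g x mod M = g (x mod M)" for x
  proof -
    have "g (x mod M) = g (x mod M mod N) + N * (x mod M div N)" by (rule stage_apply[OF g])
    also have "x mod M mod N = x mod N" by (simp add: q mod_mult2_eq)
    also have "x mod M div N = x div N mod q"
    proof (cases "N = 0")
      case False
      then show ?thesis by (simp add: q mod_mult2_eq)
    qed (simp add: q)
    finally show ?thesis
      using stage_div[OF g, of x] stage_mod[OF g, of x] by (simp add: q mod_mult2_eq)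
  qed
  ultimately show "g \<in> stage M" using stage_bij[OF g] by (simp add: stage_def)
qed

definition periodic :: "nat \<Rightarrow> (nat \<Rightarrow> nat) \<Rightarrow> nat \<Rightarrow> nat"
  where "periodic N s = (\<lambda>x. s (x mod N) + N * (x div N))"

lemma limit_embed_periodic: "limit_embed n k = periodic (level n k)"
  by (simp add: limit_embed_def periodic_def fun_eq_iff)

lemma permutes_less: "s permutes {..<N} \<Longrightarrow> x < N \<Longrightarrow> s x < (N :: nat)"
  using permutes_in_image[of s "{..<N}" x] by simp

lemma periodic_stage:
  assumes "N > 0" and s: "s permutes {..<N}"
  shows "periodic N s \<in> stage N"
proof -
  have lt: "s (x mod N) < N" for x using permutes_less[OF s] assms(1) by simp
  have div: "periodic N s x div N = x div N" and mod: "periodic N s x mod N = s (x mod N)" for x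
    using lt[of x] by (simp_all add: periodic_def)
  have "bij (periodic N s)"
  proof (rule bijI)
    show "inj (periodic N s)"
    proof (rule injI)
      fix x y assume eq: "periodic N s x = periodic N s y"
      have "s (x mod N) = s (y mod N)" using eq mod by metis
      then have "x mod N = y mod N" using permutes_inj[OF s] by (simp add: inj_eq)
      moreover have "x div N = y div N" using eq div by metis
      ultimately show "x = y" by (metis div_mult_mod_eq)
    qed
    show "surj (periodic N s)"
      unfolding surj_def
    proof
      fix y
      have "periodic N s (iv s (y mod N) + N * (y div N)) = y"
        using permutes_less[OF permutes_inv[OF s], of "y mod N"] assms(1)
        by (simp add: periodic_def permutes_inverses[OF s])
      then show "\<exists>x. y = periodic N s x" by metis
    qed
  qed
  moreover have "periodic N s (x mod N) = s (x mod N)" for x using assms(1) by (simp add: periodic_def)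
  ultimately show ?thesis by (simp add: stage_def div mod)
qed

definition restr :: "nat \<Rightarrow> (nat \<Rightarrow> nat) \<Rightarrow> nat \<Rightarrow> nat"
  where "restr N g x = (if x < N then g x else x)"

lemma restr_permutes:
  assumes g: "g \<in> stage N"
  shows "restr N g permutes {..<N}"
proof (rule inj_imp_permutes)
  show "inj_on (restr N g) {..<N}"
    by (rule inj_onI) (metis g stage_bij bij_is_inj injD lessThan_iff restr_def)
qed (auto simp: restr_def stage_less[OF g])

lemma periodic_restr:
  assumes "N > 0" and g: "g \<in> stage N"
  shows "periodic N (restr N g) = g"
proof
  fix x
  show "periodic N (restr N g) x = g x"
    using stage_apply[OF g, of x] assms(1) by (simp add: periodic_def restr_def)
qed

lemma periodic_image_stage: "N > 0 \<Longrightarrow> periodic N ` carrier (Sym N) = stage N"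
  using periodic_stage periodic_restr restr_permutes
  by (auto simp: Sym_def image_iff) (metis)

text \<open>The points with the same residue \<open>a\<close> form a fibre with coordinate
  \<open>x div N\<close>, on which \<open>w a\<close> acts. Such maps are the base group of a wreath
  product in which \<open>stage N\<close> permutes the fibres.\<close>

definition fibrewise :: "nat \<Rightarrow> (nat \<Rightarrow> nat \<Rightarrow> nat) \<Rightarrow> nat \<Rightarrow> nat"
  where "fibrewise N w x = x mod N + N * w (x mod N) (x div N)"

lemma fibrewise_mod: "N > 0 \<Longrightarrow> fibrewise N w x mod N = x mod N"
  and fibrewise_div: "N > 0 \<Longrightarrow> fibrewise N w x div N = w (x mod N) (x div N)"
  by (simp_all add: fibrewise_def)

lemma fibrewise_comp: "N > 0 \<Longrightarrow> fibrewise N w \<circ> fibrewise N v = fibrewise N (\<lambda>a. w a \<circ> v a)"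
  by (auto simp: fibrewise_def fun_eq_iff)

lemma fibrewise_id: "fibrewise N (\<lambda>a. id) = id"
  by (auto simp: fibrewise_def fun_eq_iff)

lemma fibrewise_inv:
  assumes "N > 0" "\<And>a. bij (w a)"
  shows "bij (fibrewise N w)" "iv (fibrewise N w) = fibrewise N (\<lambda>a. iv (w a))"
proof -
  have 1: "fibrewise N w \<circ> fibrewise N (\<lambda>a. iv (w a)) = id"
    using assms by (simp add: fibrewise_comp bij_is_surj surj_iff[THEN iffD1] fibrewise_id)
  have 2: "fibrewise N (\<lambda>a. iv (w a)) \<circ> fibrewise N w = id"
    using assms by (simp add: fibrewise_comp bij_is_inj fibrewise_id)
  show "bij (fibrewise N w)" using 1 2 by (rule o_bij[rotated])
  show "iv (fibrewise N w) = fibrewise N (\<lambda>a. iv (w a))" using 1 2 by (metis inv_unique_comp)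
qed

lemma fibrewise_stage:
  assumes N: "N > 0" and Q: "Q > 0" and w: "\<And>a. w a \<in> stage Q"
  shows "fibrewise N w \<in> stage (N * Q)"
proof -
  have "fibrewise N w x div (N * Q) = x div (N * Q)" for x
    using stage_div[OF w] N by (simp add: div_mult2_eq fibrewise_div)
  moreover have "fibrewise N w x mod (N * Q) = fibrewise N w (x mod (N * Q))" for x
  proof -
    have 1: "x mod (N * Q) mod N = x mod N" by (simp add: mod_mult2_eq)
    have 2: "x mod (N * Q) div N = x div N mod Q" using N by (simp add: mod_mult2_eq)
    show ?thesis
      using N stage_mod[OF w[of "x mod N"], of "x div N"]
      by (simp add: mod_mult2_eq[of "fibrewise N w x"] fibrewise_div fibrewise_mod)
        (simp add: fibrewise_def 1 2)
  qed
  ultimately show ?thesis using fibrewise_inv(1)[OF N] w by (simp add: stage_def)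
qed

text \<open>Wreath product rule: an element of \<open>stage N\<close> carries fibres to fibres
  without changing the coordinate, so moving it past a fibrewise map only reindexes the
  components.\<close>

lemma stage_fibrewise_comm:
  assumes N: "N > 0" and a: "a \<in> stage N"
  shows "a \<circ> fibrewise N w = fibrewise N (w \<circ> iv a) \<circ> a"
proof
  fix x
  have "iv a (a (x mod N)) = x mod N" using stage_bij[OF a] by (simp add: bij_is_inj)
  then have "fibrewise N (w \<circ> iv a) (a x) = a (x mod N) + N * w (x mod N) (x div N)"
    by (simp add: fibrewise_def stage_mod[OF a] stage_div[OF a])
  moreover have "a (fibrewise N w x) = a (x mod N) + N * w (x mod N) (x div N)"
    using stage_apply[OF a, of "fibrewise N w x"] N by (simp add: fibrewise_mod fibrewise_div)
  ultimately show "(a \<circ> fibrewise N w) x = (fibrewise N (w \<circ> iv a) \<circ> a) x" by simp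
qed

definition supp :: "('a \<Rightarrow> 'a) \<Rightarrow> 'a set"
  where "supp g = {x. g x \<noteq> x}"

lemma supp_id [simp]: "supp id = {}"
  by (simp add: supp_def)

lemma supp_empty: "supp g = {} \<Longrightarrow> g = id"
  by (auto simp: supp_def fun_eq_iff)

lemma supp_conj:
  assumes c: "bij c"
  shows "supp (c \<circ> g \<circ> iv c) = c ` supp g"
proof -
  have "c (g (iv c x)) = x \<longleftrightarrow> g (iv c x) = iv c x" for x
    by (metis c bij_inv_eq_iff)
  then have "supp (c \<circ> g \<circ> iv c) = {x. iv c x \<in> supp g}" by (simp add: supp_def)
  also have "\<dots> = c ` supp g"
    using c by (auto simp: image_iff) (metis bij_inv_eq_iff)+
  finally show ?thesis .
qed

lemma supp_stage: "g \<in> stage N \<Longrightarrow> x \<in> supp g \<longleftrightarrow> x mod N \<in> supp g"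
  using stage_apply[of g N x] unfolding supp_def
  by (metis (mono_tags, lifting) add_right_cancel mem_Collect_eq mod_mult_div_eq)

lemma supp_image: "bij g \<Longrightarrow> g ` supp g = supp g"
  using supp_conj[of g g] by (simp add: comp_assoc bij_is_surj surj_iff[THEN iffD1])

lemma finite_stage: 
  assumes "N > 0"
  shows "finite (stage N)"
proof -
  have "stage N \<subseteq> periodic N ` {s. s permutes {..<N}}"
    using periodic_restr[OF assms] restr_permutes by (metis (mono_tags) image_eqI mem_Collect_eq subsetI)
  then show ?thesis using finite_permutations[of "{..<N}"] finite_surj by blast
qed

section \<open>The limit group as a group of bijections of the natural numbers\<close>

definition lim_grp :: "(nat \<Rightarrow> nat) \<Rightarrow> (nat \<Rightarrow> nat) set"
  where "lim_grp n = (\<Union>k\<in>{1..}. stage (level n k))"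

locale radix =
  fixes n :: "nat \<Rightarrow> nat"
  assumes n: "\<And>k. k \<ge> 1 \<Longrightarrow> n k > 1"
begin

abbreviation G :: "(nat \<Rightarrow> nat) set" where "G \<equiv> lim_grp n"

lemma pos: "level n k > 0"
  by (rule level_pos[OF n])

lemma carrier_eq: "carrier (sym_limit n) = G"
  by (simp add: sym_limit_def lim_grp_def limit_embed_periodic periodic_image_stage[OF pos])

lemma dvd: "k \<le> j \<Longrightarrow> level n k dvd level n j"
  by (rule level_dvd[OF n])

lemma stage_subset: "k \<le> j \<Longrightarrow> stage (level n k) \<subseteq> stage (level n j)"
  by (rule stage_mono[OF dvd])

lemma stage_G: "g \<in> stage (level n k) \<Longrightarrow> g \<in> G"
  using stage_subset[of k "max 1 k"] by (force simp: lim_grp_def)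

lemma G_obtain:
  assumes "g \<in> G"
  obtains k where "k \<ge> 1" "\<And>j. j \<ge> k \<Longrightarrow> g \<in> stage (level n j)"
proof -
  obtain k where "k \<ge> 1" "g \<in> stage (level n k)" using assms by (auto simp: lim_grp_def)
  then show ?thesis using stage_subset that by blast
qed

lemma group_G: "perm_group G"
proof
  show "id \<in> G" using perm_group.id_mem[OF stage_group[OF pos]] by (rule stage_G)
  show "bij g" if "g \<in> G" for g using that stage_bij by (auto simp: lim_grp_def)
  show "iv g \<in> G" if g: "g \<in> G" for g
  proof -
    obtain k where "g \<in> stage (level n k)" using g G_obtain by blast
    then show ?thesis using perm_group.inv_mem[OF stage_group[OF pos]] stage_G by blast
  qed
  show "g \<circ> h \<in> G" if g: "g \<in> G" and h: "h \<in> G" for g h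
  proof -
    obtain k where "\<And>j. j \<ge> k \<Longrightarrow> g \<in> stage (level n j)" using g G_obtain by blast
    moreover obtain l where "\<And>j. j \<ge> l \<Longrightarrow> h \<in> stage (level n j)" using h G_obtain by blast
    ultimately have "g \<in> stage (level n (max k l))" "h \<in> stage (level n (max k l))" by auto
    then show ?thesis using perm_group.comp_mem[OF stage_group[OF pos]] stage_G by blast
  qed
qed

sublocale G: perm_group G by (rule group_G)

lemma countable_G: "countable G"
  unfolding lim_grp_def
  by (rule countable_UN) (auto intro: countable_finite finite_stage pos)

lemma level_less: "level n k < level n (Suc k)"
proof -
  have "level n (Suc k) = level n k * n (Suc k)" by (simp add: level_def)
  then show ?thesis using pos[of k] n[of "Suc k"] by simp
qed

lemma level_strict: "strict_mono (level n)"
  by (rule strict_mono_Suc_iff[THEN iffD2]) (simp add: level_less)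

lemma level_ge: "level n k \<ge> k"
  by (rule strict_mono_imp_increasing[OF level_strict])

lemma level_quotient_ge:
  obtains j where "j \<ge> k" "level n j = level n k * (level n j div level n k)"
    "level n j div level n k \<ge> K"
proof -
  let ?j = "max k (level n k * K)"
  have "level n k * K \<le> level n ?j" using level_ge[of ?j] by simp
  then have "level n ?j div level n k \<ge> K"
    using pos[of k] by (simp add: less_eq_div_iff_mult_less_eq mult.commute)
  then show ?thesis using that[of ?j] dvd[of k ?j] by simp
qed

lemma mult_eq: "g \<otimes>\<^bsub>sym_limit n\<^esub> h = g \<circ> h"
  and one_eq: "\<one>\<^bsub>sym_limit n\<^esub> = id"
  by (simp_all add: sym_limit_def)

lemma inv_eq:
  assumes "g \<in> G"
  shows "inv\<^bsub>sym_limit n\<^esub> g = iv g"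
proof -
  interpret S: group "sym_limit n" by (rule group_sym_limit[OF n])
  show ?thesis
    using S.inv_equality[of "iv g" g] assms
    by (simp add: carrier_eq mult_eq one_eq G.inv_left G.inv_mem)
qed

lemma central_function_iff:
  "central_function (sym_limit n) f \<longleftrightarrow> (\<forall>g\<in>G. \<forall>h\<in>G. f (g \<circ> h) = f (h \<circ> g))"
  by (simp add: central_function_def carrier_eq mult_eq)

lemma hermitian_psd_cong:
  assumes "\<And>i j. i < m \<Longrightarrow> j < m \<Longrightarrow> A i j = B i j" and A: "hermitian_psd m A"
  shows "hermitian_psd m B"
proof -
  have "(\<Sum>i<m. \<Sum>j<m. cnj (c i) * A i j * c j) = (\<Sum>i<m. \<Sum>j<m. cnj (c i) * B i j * c j)" for c
    by (intro sum.cong refl) (simp add: assms(1))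
  moreover have "\<forall>i<m. \<forall>j<m. B j i = cnj (B i j)"
    using A assms(1) unfolding hermitian_psd_def by metis
  ultimately show ?thesis using A unfolding hermitian_psd_def by metis
qed

text \<open>The two-element family \<open>g\<close>, \<open>id\<close> recovers the conjugate
  symmetry; conversely, that symmetry makes each form equal to its own conjugate.\<close>

lemma positive_definite_iff: "positive_definite (sym_limit n) f \<longleftrightarrow> pos_def G f"
proof
  assume pd: "positive_definite (sym_limit n) f"
  have herm: "hermitian_psd m (\<lambda>i j. f (g i \<circ> iv (g j)))"
    if g: "\<forall>i<m. g i \<in> G" for m and g :: "nat \<Rightarrow> nat \<Rightarrow> nat"
  proof -
    have "hermitian_psd m (\<lambda>i j. f (g i \<otimes>\<^bsub>sym_limit n\<^esub> inv\<^bsub>sym_limit n\<^esub> (g j)))"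
      using pd g by (simp add: positive_definite_def carrier_eq)
    then show ?thesis
      by (rule hermitian_psd_cong[rotated]) (use g in \<open>simp add: mult_eq inv_eq\<close>)
  qed
  show "pos_def G f"
    unfolding pos_def_def
  proof (intro conjI ballI allI impI)
    fix g assume g: "g \<in> G"
    have *: "\<forall>i<2::nat. (if i = 0 then g else id) \<in> G" using g G.id_mem by simp
    have "\<forall>i<2::nat. \<forall>j<2::nat. f ((if j = 0 then g else id) \<circ> iv (if i = 0 then g else id)) =
        cnj (f ((if i = 0 then g else id) \<circ> iv (if j = 0 then g else id)))"
      using herm[OF *] unfolding hermitian_psd_def by blast
    from this[rule_format, of 0 "Suc 0"] show "f (iv g) = cnj (f g)"
      by simp
  next
    fix m c and g :: "nat \<Rightarrow> nat \<Rightarrow> nat" assume g: "\<forall>i<m. g i \<in> G"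
    show "0 \<le> Re (qform f {..<m} g c)"
      using herm[OF g] unfolding hermitian_psd_def qform_def Let_def by blast
  qed
next
  assume f: "pos_def G f"
  show "positive_definite (sym_limit n) f"
    unfolding positive_definite_def
  proof (intro allI impI)
    fix m and g :: "nat \<Rightarrow> nat \<Rightarrow> nat" assume "\<forall>i<m. g i \<in> carrier (sym_limit n)"
    then have g: "g i \<in> G" if "i < m" for i using that by (simp add: carrier_eq)
    have herm: "f (g j \<circ> iv (g i)) = cnj (f (g i \<circ> iv (g j)))" if "i < m" "j < m" for i j
      using pos_def_inv[OF f, of "g i \<circ> iv (g j)"] g that by (simp add: G.group_simps)
    have "qform f {..<m} g c \<in> \<real> \<and> 0 \<le> Re (qform f {..<m} g c)" for c
    proof
      have "cnj (qform f {..<m} g c) = (\<Sum>i<m. \<Sum>j<m. cnj (c j) * f (g j \<circ> iv (g i)) * c i)"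
        unfolding qform_def cnj_sum
        by (intro sum.cong refl) (simp add: herm[symmetric])
      also have "\<dots> = qform f {..<m} g c"
        unfolding qform_def by (rule sum.swap)
      finally show "qform f {..<m} g c \<in> \<real>" by (simp add: Reals_cnj_iff)
      show "0 \<le> Re (qform f {..<m} g c)" by (rule pos_def_form[OF f]) (use g in auto)
    qed
    then have "hermitian_psd m (\<lambda>i j. f (g i \<circ> iv (g j)))"
      unfolding hermitian_psd_def qform_def Let_def using herm by blast
    then show "hermitian_psd m (\<lambda>i j. f (g i \<otimes>\<^bsub>sym_limit n\<^esub> inv\<^bsub>sym_limit n\<^esub> (g j)))"
      by (rule hermitian_psd_cong[rotated]) (use g in \<open>simp add: mult_eq inv_eq\<close>)
  qed
qed

end

section \<open>Fibre groups\<close>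

text \<open>If every exact prime power in \<open>Q\<close> were at most \<open>K\<close>, each would
  divide \<open>fact K\<close>, and so would \<open>Q\<close>, which is larger.\<close>

lemma exists_large_prime_power_dvd:
  assumes "Q > fact K"
  obtains p r :: nat where "prime p" "p ^ r dvd Q" "p ^ r > K"
proof -
  have "\<exists>p. prime p \<and> p ^ multiplicity p Q > K"
  proof (rule ccontr)
    assume "\<not> ?thesis"
    then have le: "p ^ multiplicity p Q \<le> K" if "prime p" for p :: nat
      using that by (meson not_le_imp_less)
    have "Q dvd fact K"
    proof (rule multiplicity_le_imp_dvd)
      show "Q \<noteq> 0" using assms by simp
      fix p :: nat assume p: "prime p"
      have "p ^ multiplicity p Q dvd fact K"
        using le[OF p] p by (intro dvd_fact) (auto simp: Suc_le_eq prime_gt_0_nat)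
      then show "multiplicity p Q \<le> multiplicity p (fact K)"
        using p by (intro multiplicity_geI) auto
    qed
    then show False using assms dvd_imp_le[of Q "fact K"] by simp
  qed
  then show ?thesis using that multiplicity_dvd by blast
qed

lemma funpow_fixpoint: "f x = x \<Longrightarrow> (f ^^ k) x = x"
  by (induction k) auto

lemma coprime_funpow_fixpoint:
  assumes "(f ^^ d) x = x" "(f ^^ p) x = x" "coprime d p" "d > 0"
  shows "f x = x"
proof -
  obtain a b where ab: "d * a = p * b + 1"
    using bezout_nat[of d p] assms(3,4) by (auto simp: coprime_iff_gcd_eq_1)
  have "x = (f ^^ (d * a)) x"
    using funpow_fixpoint[of "f ^^ d", OF assms(1)] by (simp add: funpow_mult)
  also have "\<dots> = f ((f ^^ (p * b)) x)" by (simp add: ab)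
  also have "\<dots> = f x"
    using funpow_fixpoint[of "f ^^ p", OF assms(2)] by (simp add: funpow_mult)
  finally show ?thesis by simp
qed

definition free_order :: "nat \<Rightarrow> (nat \<Rightarrow> nat) \<Rightarrow> bool"
  where "free_order p v \<longleftrightarrow> v ^^ p = id \<and> (\<forall>y. v y \<noteq> y)"

text \<open>The orbits of \<open>v\<close> have exactly \<open>p\<close> elements; \<open>R\<close> consists of their least elements.\<close>

lemma free_order_coordinates:
  assumes p: "prime p" and v: "v \<in> stage Q" "free_order p v"
  obtains R where "R \<subseteq> {..<Q}" "bij_betw (\<lambda>(x, i). (v ^^ i) x) (R \<times> {..<p}) {..<Q}"
proof -
  have vp: "(v ^^ p) x = x" and vx: "v x \<noteq> x" for x
    using v(2) by (auto simp: free_order_def)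
  have vpk: "(v ^^ (i + p * k)) x = (v ^^ i) x" for i k x
    using funpow_fixpoint[of "v ^^ p", OF vp, of k] by (simp add: funpow_add funpow_mult)
  have lt: "(v ^^ i) x < Q" if "x < Q" for i x
    by (induction i) (use that stage_less[OF v(1)] in auto)
  have inj: "inj (v ^^ i)" for i
    using stage_bij[OF v(1)] by (simp add: bij_is_inj)
  have fadd: "(v ^^ (i + j)) x = (v ^^ i) ((v ^^ j) x)" for i j x
    by (simp add: funpow_add)
  define orb where "orb x = range (\<lambda>i. (v ^^ i) x)" for x
  have orb_step: "orb ((v ^^ i) x) = orb x" for i x
  proof
    show "orb ((v ^^ i) x) \<subseteq> orb x"
      unfolding orb_def by (auto simp flip: fadd)
    show "orb x \<subseteq> orb ((v ^^ i) x)"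
      unfolding orb_def
    proof (rule image_subsetI)
      fix j
      \<comment> \<open>The power \<open>p * i - i\<close> of \<open>v\<close> acts as the inverse
        of \<open>v ^^ i\<close>, which avoids negative exponents.\<close>
      have "i \<le> p * i" using prime_gt_0_nat[OF p] by simp
      then have e: "j + (p * i - i) + i = j + p * i" by linarith
      have "(v ^^ j) x = (v ^^ (j + (p * i - i))) ((v ^^ i) x)"
        by (rule trans[OF sym[OF vpk[of j i x]] fadd[of "j + (p * i - i)" i x, unfolded e]])
      then show "(v ^^ j) x \<in> range (\<lambda>k. (v ^^ k) ((v ^^ i) x))" by simp
    qed
  qed
  define R where "R = {x. x < Q \<and> x = (LEAST y. y \<in> orb x)}"
  have self: "x \<in> orb x" for x unfolding orb_def by (rule image_eqI[of _ _ 0]) auto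
  have "bij_betw (\<lambda>(x, i). (v ^^ i) x) (R \<times> {..<p}) {..<Q}"
    unfolding bij_betw_def
  proof
    have *: "i = j" if "(v ^^ i) x = (v ^^ j) x" "i \<le> j" "j < p" for x i j
    proof (rule ccontr)
      assume "i \<noteq> j"
      then have d: "0 < j - i" "j - i < p" using that by auto
      have "(v ^^ i) ((v ^^ (j - i)) x) = (v ^^ i) x"
        using that fadd[of i "j - i" x] by simp
      then have "(v ^^ (j - i)) x = x" using inj by (simp add: inj_eq)
      moreover have "coprime (j - i) p"
        using d p by (metis coprime_commute dvd_imp_le not_le prime_imp_coprime_nat)
      ultimately show False using coprime_funpow_fixpoint[OF _ vp] d vx by blast
    qed
    show "inj_on (\<lambda>(x, i). (v ^^ i) x) (R \<times> {..<p})"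
    proof (rule inj_onI, clarify)
      fix x i y j assume x: "x \<in> R" and y: "y \<in> R" and ij: "i < p" "j < p"
        and eq: "(v ^^ i) x = (v ^^ j) y"
      have "orb x = orb y" using orb_step eq by metis
      moreover have "x = (LEAST z. z \<in> orb x)" "y = (LEAST z. z \<in> orb y)"
        using x y unfolding R_def by blast+
      ultimately have "x = y" by metis
      then show "x = y \<and> i = j" using *[of i x j] *[of j x i] eq ij by (metis nat_le_linear)
    qed
    show "(\<lambda>(x, i). (v ^^ i) x) ` (R \<times> {..<p}) = {..<Q}"
    proof
      show "(\<lambda>(x, i). (v ^^ i) x) ` (R \<times> {..<p}) \<subseteq> {..<Q}"
        using lt by (auto simp: R_def)
      show "{..<Q} \<subseteq> (\<lambda>(x, i). (v ^^ i) x) ` (R \<times> {..<p})"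
      proof
        fix x assume x: "x \<in> {..<Q}"
        define y where "y = (LEAST y. y \<in> orb x)"
        have "y \<in> orb x" unfolding y_def by (rule LeastI) (rule self)
        then obtain i where i: "y = (v ^^ i) x" unfolding orb_def by auto
        then have "orb y = orb x" using orb_step by simp
        moreover have "y < Q" using i lt x by simp
        ultimately have "y \<in> R" unfolding R_def using y_def by simp
        have "x \<in> orb y" using self \<open>orb y = orb x\<close> by simp
        then obtain j where "x = (v ^^ j) y" unfolding orb_def by auto
        then have "x = (v ^^ (j mod p)) y" using vpk[of "j mod p" "j div p" y] by simp
        moreover have "j mod p < p" using p by (simp add: prime_gt_0_nat)
        ultimately show "x \<in> (\<lambda>(x, i). (v ^^ i) x) ` (R \<times> {..<p})"
          using \<open>y \<in> R\<close> by (intro image_eqI[of _ _ "(y, j mod p)"]) auto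
      qed
    qed
  qed
  moreover have "R \<subseteq> {..<Q}" by (auto simp: R_def)
  ultimately show ?thesis using that by blast
qed

text \<open>Freeness and order \<open>p\<close> give both elements the same number
  \<open>Q / p\<close> of orbits, so a bijection between orbit representatives, continued along the
  orbits and then periodically, intertwines them.\<close>

lemma free_order_conj:
  assumes p: "prime p" and Q: "Q > 0"
    and v: "v \<in> stage Q" "free_order p v" and w: "w \<in> stage Q" "free_order p w"
  shows "\<exists>c\<in>stage Q. w = c \<circ> v \<circ> iv c"
proof -
  obtain R where R: "R \<subseteq> {..<Q}" and bv: "bij_betw (\<lambda>(x, i). (v ^^ i) x) (R \<times> {..<p}) {..<Q}"
    by (rule free_order_coordinates[OF p v])
  obtain S where S: "S \<subseteq> {..<Q}" and bw: "bij_betw (\<lambda>(x, i). (w ^^ i) x) (S \<times> {..<p}) {..<Q}"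
    by (rule free_order_coordinates[OF p w])
  let ?\<phi> = "\<lambda>(x, i). (v ^^ i) x" and ?\<psi> = "\<lambda>(x, i). (w ^^ i) x"
  have p0: "p > 0" using p by (simp add: prime_gt_0_nat)
  have "card R * p = card S * p"
    using bij_betw_same_card[OF bv] bij_betw_same_card[OF bw] by (simp add: card_cartesian_product)
  then have "card R = card S" using p0 by simp
  then obtain b where b: "bij_betw b R S"
    using finite_same_card_bij[of R S] R S finite_subset by blast
  have bb: "bij_betw (map_prod b id) (R \<times> {..<p}) (S \<times> {..<p})"
    by (rule bij_betw_map_prod[OF b]) simp
  define c0 where "c0 = ?\<psi> \<circ> map_prod b id \<circ> inv_into (R \<times> {..<p}) ?\<phi>"
  have c0: "bij_betw c0 {..<Q} {..<Q}"
    unfolding c0_def by (rule bij_betw_trans[OF bij_betw_inv_into[OF bv] bij_betw_trans[OF bb bw]])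
  have c0_val: "c0 ((v ^^ i) x) = (w ^^ i) (b x)" if "x \<in> R" "i < p" for x i
  proof -
    have "inv_into (R \<times> {..<p}) ?\<phi> (?\<phi> (x, i)) = (x, i)"
      by (rule inv_into_f_f) (use bv that in \<open>auto simp: bij_betw_def\<close>)
    then show ?thesis by (simp add: c0_def)
  qed
  have comm: "c0 (v y) = w (c0 y)" if "y < Q" for y
  proof -
    have "y \<in> ?\<phi> ` (R \<times> {..<p})" using bv that by (simp add: bij_betw_def)
    then obtain x i where xi: "x \<in> R" "i < p" "y = (v ^^ i) x" by auto
    show ?thesis
    proof (cases "Suc i < p")
      case True
      then show ?thesis using c0_val[of x "Suc i"] c0_val[of x i] xi by simp
    next
      \<comment> \<open>At the end of an orbit both maps return to the representative, because their
        \<open>p\<close>-th powers are the identity.\<close>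
      case False
      then have "Suc i = p" using xi by simp
      then have "v y = x" "w (c0 y) = b x"
        using v(2) w(2) xi c0_val[of x i]
        by (metis comp_apply free_order_def funpow.simps(2) id_apply)+
      then show ?thesis using c0_val[of x 0] xi p0 by simp
    qed
  qed
  define c where "c = (\<lambda>x. if x < Q then c0 x else x)"
  have cp: "c permutes {..<Q}"
  proof (rule bij_imp_permutes)
    show "bij_betw c {..<Q} {..<Q}"
      using c0 bij_betw_cong[of "{..<Q}" c c0] by (simp add: c_def)
  qed (simp add: c_def)
  have cb: "periodic Q c \<in> stage Q" by (rule periodic_stage[OF Q cp])
  interpret perm_group "stage Q" by (rule stage_group[OF Q])
  have "periodic Q c (v x) = w (periodic Q c x)" for x
  proof -
    have "c (v x mod Q) = w (c (x mod Q))"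
      using comm[of "x mod Q"] Q stage_mod[OF v(1), of x] stage_less[OF v(1), of "x mod Q"]
      by (simp add: c_def)
    moreover have "w (periodic Q c x) = w (c (x mod Q)) + Q * (x div Q)"
      using stage_apply[OF w(1), of "periodic Q c x"] permutes_less[OF cp, of "x mod Q"] Q
      by (simp add: periodic_def)
    ultimately show ?thesis by (simp add: periodic_def stage_div[OF v(1)])
  qed
  then have "periodic Q c \<circ> v = w \<circ> periodic Q c" by auto
  then have "periodic Q c \<circ> v \<circ> iv (periodic Q c) = w"
    using cb by (simp add: comp_assoc inv_right)
  then show ?thesis using cb by metis
qed

text \<open>Freeness lets fibrewise choices without trivial component move every point of the chosen
  fibres; conjugacy of all nontrivial elements gives such choices a common value of \<chi>.\<close>

definition fibre_group :: "nat \<Rightarrow> (nat \<Rightarrow> nat) set \<Rightarrow> bool"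
  where "fibre_group Q V \<longleftrightarrow> V \<subseteq> stage Q \<and> id \<in> V \<and>
    (\<forall>v\<in>V. \<forall>w\<in>V. v \<circ> w \<in> V) \<and> (\<forall>v\<in>V. iv v \<in> V) \<and> (\<forall>v\<in>V. v \<noteq> id \<longrightarrow> (\<forall>y. v y \<noteq> y)) \<and>
    (\<forall>v\<in>V. \<forall>w\<in>V. v \<noteq> id \<longrightarrow> w \<noteq> id \<longrightarrow> (\<exists>c\<in>stage Q. w = c \<circ> v \<circ> iv c))"

text \<open>Addition of \<open>a\<close> to the last base-\<open>p\<close> digit without carry,
  while \<open>v\<close> acts on the remaining digits. Iterated from the identity it yields the
  translations of finitely many digits, an elementary abelian group acting freely.\<close>

definition digit_shift :: "nat \<Rightarrow> nat \<Rightarrow> (nat \<Rightarrow> nat) \<Rightarrow> nat \<Rightarrow> nat"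
  where "digit_shift p a v y = (y mod p + a) mod p + p * v (y div p)"

lemma digit_shift_mod: "p > 0 \<Longrightarrow> digit_shift p a v y mod p = (y mod p + a) mod p"
  and digit_shift_div: "p > 0 \<Longrightarrow> digit_shift p a v y div p = v (y div p)"
  by (simp_all add: digit_shift_def)

lemma digit_shift_comp:
  "p > 0 \<Longrightarrow> digit_shift p a v \<circ> digit_shift p b w = digit_shift p ((a + b) mod p) (v \<circ> w)"
  by (simp add: digit_shift_def fun_eq_iff mod_simps) (simp add: add_ac)

lemma digit_shift_id: "digit_shift p 0 id = id"
  by (auto simp: digit_shift_def fun_eq_iff)

lemma digit_shift_inv:
  assumes "p > 0" "a < p" "bij v"
  shows "bij (digit_shift p a v)"
    "iv (digit_shift p a v) = digit_shift p ((p - a) mod p) (iv v)"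
proof -
  let ?s = "digit_shift p a v" and ?t = "digit_shift p ((p - a) mod p) (iv v)"
  have "(a + (p - a) mod p) mod p = 0" "((p - a) mod p + a) mod p = 0"
    using assms(2) by (simp_all add: mod_simps)
  then have 1: "?s \<circ> ?t = id" and 2: "?t \<circ> ?s = id"
    using assms by (simp_all add: digit_shift_comp bij_is_surj surj_iff[THEN iffD1] bij_is_inj
        digit_shift_id)
  show "bij ?s" using 1 2 by (rule o_bij[rotated])
  show "iv ?s = ?t" using 1 2 by (metis inv_unique_comp)
qed

lemma digit_shift_pow:
  "p > 0 \<Longrightarrow> digit_shift p a v ^^ k = digit_shift p (k * a mod p) (v ^^ k)"
  by (induction k) (simp_all add: digit_shift_id digit_shift_comp mod_simps)

definition free_exponent_group :: "nat \<Rightarrow> (nat \<Rightarrow> nat) set \<Rightarrow> bool"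
  where "free_exponent_group p V \<longleftrightarrow> id \<in> V \<and> (\<forall>v\<in>V. \<forall>w\<in>V. v \<circ> w \<in> V) \<and>
    (\<forall>v\<in>V. iv v \<in> V) \<and> (\<forall>v\<in>V. v ^^ p = id) \<and> (\<forall>v\<in>V. v \<noteq> id \<longrightarrow> (\<forall>y. v y \<noteq> y))"

text \<open>The induction adjoins one digit. A pair of a shift \<open>a\<close> and a nontrivial
  \<open>v\<close> already moves the higher digits; if \<open>v\<close> is trivial, then
  \<open>a\<close> is nonzero and the last digit moves. This keeps the action free.\<close>

lemma exists_free_exponent_group:
  assumes p: "prime p" and Q: "Q > 0"
  shows "\<exists>V. V \<subseteq> stage (p ^ r * Q) \<and> card V = p ^ r \<and> free_exponent_group p V"
proof (induction r)
  case 0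
  show ?case
    by (rule exI[of _ "{id}"]) (simp add: free_exponent_group_def perm_group.id_mem[OF stage_group[OF Q]] flip: id_def)
next
  case (Suc r)
  then obtain V where V1: "V \<subseteq> stage (p ^ r * Q)" "card V = p ^ r" and free: "free_exponent_group p V"
    by blast
  note V = V1 free[unfolded free_exponent_group_def, THEN conjunct1]
    free[unfolded free_exponent_group_def, THEN conjunct2, THEN conjunct1, rule_format]
    free[unfolded free_exponent_group_def, THEN conjunct2, THEN conjunct2, THEN conjunct1, rule_format]
    free[unfolded free_exponent_group_def, THEN conjunct2, THEN conjunct2, THEN conjunct2,
      THEN conjunct1, rule_format]
    free[unfolded free_exponent_group_def, THEN conjunct2, THEN conjunct2, THEN conjunct2,
      THEN conjunct2, rule_format]
  have p0: "p > 0" using p by (simp add: prime_gt_0_nat)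
  let ?s = "\<lambda>(a, v). digit_shift p a v"
  let ?W = "?s ` ({..<p} \<times> V)"
  have W: "\<exists>a v. s = digit_shift p a v \<and> a < p \<and> v \<in> V" if "s \<in> ?W" for s
    using that by force
  have WI: "digit_shift p a v \<in> ?W" if "a < p" "v \<in> V" for a v
    using that by force
  have "inj_on ?s ({..<p} \<times> V)"
  proof (rule inj_onI, clarify)
    fix a v b w assume "a < p" "b < p" and eq: "digit_shift p a v = digit_shift p b w"
    then have "a = b" using digit_shift_mod[OF p0, of a v 0] digit_shift_mod[OF p0, of b w 0] by simp
    moreover have "v y = w y" for y
      using digit_shift_div[OF p0, of a v "p * y"] digit_shift_div[OF p0, of b w "p * y"] eq p0 by simp
    ultimately show "a = b \<and> v = w" by auto
  qed
  then have w1: "card ?W = p ^ Suc r" by (simp add: card_image card_cartesian_product V(2))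
  have w2: "?W \<subseteq> stage (p ^ Suc r * Q)"
  proof
    fix s assume "s \<in> ?W"
    then obtain a v where s: "s = digit_shift p a v" and a: "a < p" and v: "v \<in> V"
      using W by blast
    have vb: "v \<in> stage (p ^ r * Q)" using v V(1) by blast
    have N: "p ^ Suc r * Q = p * (p ^ r * Q)" by simp
    have "digit_shift p a v x div (p * (p ^ r * Q)) = x div (p * (p ^ r * Q))" for x
      using p0 stage_div[OF vb] by (simp add: div_mult2_eq digit_shift_div)
    moreover have "digit_shift p a v x mod (p * (p ^ r * Q)) =
        digit_shift p a v (x mod (p * (p ^ r * Q)))" for x
    proof -
      let ?M = "p ^ r * Q"
      have "x mod (p * ?M) mod p = x mod p" "x mod (p * ?M) div p = x div p mod ?M"
        using p0 by (simp_all add: mod_mult2_eq)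
      moreover note digit_shift_mod[OF p0, of a v x] digit_shift_div[OF p0, of a v x]
      ultimately have "digit_shift p a v x mod (p * ?M) =
          p * (v (x div p) mod ?M) + (x mod p + a) mod p"
        and "digit_shift p a v (x mod (p * ?M)) = (x mod p + a) mod p + p * v (x div p mod ?M)"
        by (simp_all add: mod_mult2_eq[of "digit_shift p a v x"] digit_shift_def[of p a v "x mod (p * ?M)"])
      then show ?thesis by (simp add: stage_mod[OF vb])
    qed
    ultimately show "s \<in> stage (p ^ Suc r * Q)"
      unfolding N s using digit_shift_inv(1)[OF p0 _ stage_bij[OF vb]] a by (simp add: stage_def)
  qed
  have w3: "id \<in> ?W" using WI[OF p0 V(3)] by (simp only: digit_shift_id)
  have w4: "x \<circ> y \<in> ?W" if x: "x \<in> ?W" and y: "y \<in> ?W" for x y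
  proof -
    obtain a v where 1: "x = digit_shift p a v" "v \<in> V" using W[OF x] by blast
    obtain b w where 2: "y = digit_shift p b w" "w \<in> V" using W[OF y] by blast
    show ?thesis using WI[OF _ V(4)[OF 1(2) 2(2)], of "(a + b) mod p"] p0
      by (simp only: 1 2 digit_shift_comp) simp
  qed
  have w5: "iv x \<in> ?W" if x: "x \<in> ?W" for x
  proof -
    obtain a v where 1: "x = digit_shift p a v" "v \<in> V" "a < p" using W[OF x] by blast
    have "bij v" using 1 V(1) stage_bij by blast
    then show ?thesis using WI[OF _ V(5)[OF 1(2)], of "(p - a) mod p"] p0 1
      by (simp only: digit_shift_inv(2)) simp
  qed
  have w6: "x ^^ p = id" if x: "x \<in> ?W" for x
  proof -
    obtain a v where 1: "x = digit_shift p a v" "v \<in> V" "a < p" using W[OF x] by blast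
    then show ?thesis using p0 V(6)[OF 1(2)] by (simp add: digit_shift_pow digit_shift_id)
  qed
  have w7: "x y \<noteq> y" if xW: "x \<in> ?W" and xid: "x \<noteq> id" for x y
  proof -
    obtain a v where x: "x = digit_shift p a v" "v \<in> V" "a < p" using W[OF xW] by blast
    have div: "x y div p = v (y div p)" and mod: "x y mod p = (y mod p + a) mod p"
      using x(1) by (simp_all add: digit_shift_div[OF p0] digit_shift_mod[OF p0])
    show ?thesis
    proof (cases "v = id")
      case False
      then show ?thesis using V(7)[OF x(2) False, of "y div p"] div by metis
    next
      case True
      then have "a \<noteq> 0" using x xid digit_shift_id by metis
      have "(y mod p + a) mod p \<noteq> y mod p"
      proof (cases "y mod p + a < p")
        case True
        then show ?thesis using \<open>a \<noteq> 0\<close> by simp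
      next
        case False
        then have "(y mod p + a) mod p = (y mod p + a - p) mod p" by (simp add: le_mod_geq)
        also have "\<dots> = y mod p + a - p"
          using x(3) mod_less_divisor[OF p0, of y] by (intro mod_less) linarith
        finally show ?thesis using x(3) False by linarith
      qed
      then show ?thesis using mod by metis
    qed
  qed
  show ?case
    unfolding free_exponent_group_def
    by (intro exI[of _ ?W] conjI ballI impI allI) (assumption | rule w1 w2 w3 w4 w5 w6 w7)+
qed

lemma exists_fibre_group:
  assumes "Q > fact K"
  obtains V where "fibre_group Q V" "card V > K"
proof -
  obtain p r where pr: "prime p" "p ^ r dvd Q" "p ^ r > K"
    by (rule exists_large_prime_power_dvd[OF assms])
  have Q: "Q > 0" using assms by (simp add: less_le_trans)
  obtain M where M: "Q = p ^ r * M" using pr by auto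
  then have "M > 0" using Q by simp
  from exists_free_exponent_group[OF pr(1) this, of r] obtain V where
    V: "V \<subseteq> stage Q" "card V = p ^ r" "free_exponent_group p V"
    unfolding M by blast
  have "fibre_group Q V"
    unfolding fibre_group_def
  proof (intro conjI ballI impI)
    fix v w assume "v \<in> V" "w \<in> V" "v \<noteq> id" "w \<noteq> id"
    then show "\<exists>c\<in>stage Q. w = c \<circ> v \<circ> iv c"
      using V by (intro free_order_conj[OF pr(1) Q]) (auto simp: free_order_def free_exponent_group_def)
  qed (use V in \<open>auto simp: free_exponent_group_def\<close>)
  then show ?thesis using that V(2) pr(3) by metis
qed

section \<open>Averaging over fibrewise permutations\<close>

text \<open>Resampling the coordinate \<open>a\<close> does not change the excluded value
  \<open>\<phi> u\<close>. Hence \<open>u\<close> can be recovered from \<open>u(a := y)\<close> on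
  the bad set, and each bad \<open>u\<close> accounts for \<open>card V\<close> functions.\<close>

lemma card_PiE_determined:
  assumes A: "finite A" "a \<in> A" and V: "finite V"
    and \<phi>: "\<And>u y. \<phi> (u(a := y)) = \<phi> u"
  shows "card {u \<in> A \<rightarrow>\<^sub>E V. u a = \<phi> u} * card V \<le> card (A \<rightarrow>\<^sub>E V)"
proof -
  let ?B = "{u \<in> A \<rightarrow>\<^sub>E V. u a = \<phi> u}"
  have "inj_on (\<lambda>(u, y). u(a := y)) (?B \<times> V)"
  proof (rule inj_onI, clarify)
    fix u y u' y' assume u: "u a = \<phi> u" and u': "u' a = \<phi> u'" and eq: "u(a := y) = u'(a := y')"
    have "y = y'" using fun_cong[OF eq, of a] by simp
    moreover have "\<phi> u = \<phi> u'" using \<phi> eq by metis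
    then have "u x = u' x" for x using fun_cong[OF eq, of x] u u' by (cases "x = a") auto
    ultimately show "u = u' \<and> y = y'" by auto
  qed
  moreover have "(\<lambda>(u, y). u(a := y)) ` (?B \<times> V) \<subseteq> A \<rightarrow>\<^sub>E V"
    using A by (auto simp: PiE_iff extensional_def)
  moreover have "finite (A \<rightarrow>\<^sub>E V)" using A V by (intro finite_PiE) auto
  ultimately have "card (?B \<times> V) \<le> card (A \<rightarrow>\<^sub>E V)" by (rule card_inj_on_le)
  then show ?thesis by (simp add: card_cartesian_product)
qed

text \<open>A union bound: at each coordinate one value, determined by the other coordinates, is
  excluded, so a random \<open>u\<close> meets an excluded value with frequency at most
  \<open>card A / card V\<close>. The factor 2 bounds the distance of two numbers of modulus at most
  one.\<close>

lemma avg_PiE_near: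
  assumes A: "finite A" and V: "finite V" "V \<noteq> {}"
    and F: "\<And>u. u \<in> A \<rightarrow>\<^sub>E V \<Longrightarrow> cmod (F u) \<le> 1" and w: "cmod w \<le> 1"
    and \<phi>: "\<And>a u y. a \<in> A \<Longrightarrow> \<phi> a (u(a := y)) = \<phi> a u"
    and eq: "\<And>u. u \<in> A \<rightarrow>\<^sub>E V \<Longrightarrow> (\<And>a. a \<in> A \<Longrightarrow> u a \<noteq> \<phi> a u) \<Longrightarrow> F u = w"
  shows "cmod (avg (A \<rightarrow>\<^sub>E V) F - w) \<le> 2 * (real (card A) / real (card V))"
proof (rule avg_near[OF _ _ _ _ F _ w])
  let ?K = "A \<rightarrow>\<^sub>E V"
  let ?B = "\<Union>a\<in>A. {u \<in> ?K. u a = \<phi> a u}"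
  show fin: "finite ?K" using A V by (intro finite_PiE) auto
  show "?K \<noteq> {}" using V by (simp add: PiE_eq_empty_iff)
  show "?B \<subseteq> ?K" by auto
  have V0: "card V > 0" using V by (simp add: card_gt_0_iff)
  have "card ?B * card V \<le> (\<Sum>a\<in>A. card {u \<in> ?K. u a = \<phi> a u}) * card V"
    by (intro mult_right_mono card_UN_le A) simp
  also have "\<dots> \<le> (\<Sum>a\<in>A. card ?K)"
    unfolding sum_distrib_right by (intro sum_mono card_PiE_determined A V \<phi>)
  also have "\<dots> = card A * card ?K" by simp
  finally have "real (card ?B * card V) \<le> real (card A * card ?K)"
    by (simp only: of_nat_le_iff)
  then have "real (card ?B) * real (card V) \<le> real (card A) * real (card ?K)"
    by (simp only: of_nat_mult)
  then show "real (card ?B) \<le> real (card A) / real (card V) * real (card ?K)"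
    using V0 by (simp add: pos_le_divide_eq)
  show "F u = w" if "u \<in> ?K - ?B" for u
    by (rule eq) (use that in auto)
qed

lemma avg_near_const:
  assumes "finite I" "I \<noteq> {}" "\<And>i. i \<in> I \<Longrightarrow> cmod (F i - w) \<le> e"
  shows "cmod (avg I F - w) \<le> e"
proof -
  have "avg I F - w = avg I (\<lambda>i. F i - w)"
    using assms by (simp add: avg_def sum_subtractf diff_divide_distrib)
  then show ?thesis using avg_norm_le[OF assms] by simp
qed

definition twist :: "nat \<Rightarrow> nat set \<Rightarrow> (nat \<Rightarrow> nat \<Rightarrow> nat) \<Rightarrow> nat \<Rightarrow> nat"
  where "twist N A u = fibrewise N (\<lambda>a. if a \<in> A then u a else id)"

lemma twist_cong: "(\<And>a. a \<in> A \<Longrightarrow> u a = v a) \<Longrightarrow> twist N A u = twist N A v"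
  unfolding twist_def by (rule arg_cong[of _ _ "fibrewise N"]) auto

lemma twist_comp: "N > 0 \<Longrightarrow> twist N A u \<circ> twist N A v = twist N A (\<lambda>a. u a \<circ> v a)"
  unfolding twist_def by (simp add: fibrewise_comp) (rule arg_cong[of _ _ "fibrewise N"], auto)

lemma twist_inv:
  assumes "N > 0" "\<And>a. a \<in> A \<Longrightarrow> bij (u a)"
  shows "iv (twist N A u) = twist N A (\<lambda>a. iv (u a))"
proof -
  have "iv (twist N A u) = fibrewise N (\<lambda>a. iv (if a \<in> A then u a else id))"
    unfolding twist_def by (rule fibrewise_inv(2)) (use assms in auto)
  also have "\<dots> = twist N A (\<lambda>a. iv (u a))"
    unfolding twist_def by (rule arg_cong[of _ _ "fibrewise N"]) auto
  finally show ?thesis .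
qed

lemma twist_stage:
  assumes "N > 0" "Q > 0" "\<And>a. a \<in> A \<Longrightarrow> u a \<in> stage Q"
  shows "twist N A u \<in> stage (N * Q)"
  unfolding twist_def using assms perm_group.id_mem[OF stage_group] by (intro fibrewise_stage) auto

lemma twist_supp:
  assumes "N > 0" "\<And>a y. a \<in> A \<Longrightarrow> u a y \<noteq> y"
  shows "supp (twist N A u) = {x. x mod N \<in> A}"
proof -
  have "twist N A u x = x \<longleftrightarrow> x mod N \<notin> A" for x
  proof (cases "x mod N \<in> A")
    case True
    then have "twist N A u x div N \<noteq> x div N"
      using assms by (simp add: twist_def fibrewise_div)
    then show ?thesis using True by auto
  qed (simp add: twist_def fibrewise_def)
  then show ?thesis by (auto simp: supp_def)
qed

lemma twist_stage_conj:
  assumes N: "N > 0" and x: "x \<in> stage N"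
  shows "x \<circ> twist N A u \<circ> iv x = twist N (x ` A) (u \<circ> iv x)"
proof -
  interpret perm_group "stage N" by (rule stage_group[OF N])
  have "x \<circ> twist N A u \<circ> iv x = fibrewise N ((\<lambda>a. if a \<in> A then u a else id) \<circ> iv x)"
    using x by (simp add: twist_def stage_fibrewise_comm[OF N x] comp_assoc inv_right)
  also have "\<dots> = twist N (x ` A) (u \<circ> iv x)"
    unfolding twist_def
  proof (rule arg_cong[of _ _ "fibrewise N"], rule ext)
    fix a
    have "iv x a \<in> A \<longleftrightarrow> a \<in> x ` A"
      using bij_mem[OF x] by (metis bij_inv_eq_iff image_iff)
    then show "((\<lambda>a. if a \<in> A then u a else id) \<circ> iv x) a = (if a \<in> x ` A then (u \<circ> iv x) a else id)"
      by simp
  qed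
  finally show ?thesis .
qed

lemma twist_fibre_conj:
  assumes N: "N > 0" and Q: "Q > 0"
    and uv: "\<And>a. a \<in> A \<Longrightarrow> u a \<in> stage Q" "\<And>a. a \<in> A \<Longrightarrow> \<exists>c\<in>stage Q. v a = c \<circ> u a \<circ> iv c"
  shows "\<exists>c\<in>stage (N * Q). twist N A v = c \<circ> twist N A u \<circ> iv c"
proof -
  obtain c where c: "\<And>a. a \<in> A \<Longrightarrow> c a \<in> stage Q \<and> v a = c a \<circ> u a \<circ> iv (c a)"
    using uv(2) by metis
  have cb: "bij (c a)" if "a \<in> A" for a using c[OF that] stage_bij by blast
  have "twist N A c \<circ> twist N A u \<circ> iv (twist N A c) = twist N A v"
    using c cb by (subst twist_inv[OF N]) (auto simp: twist_comp[OF N] intro!: twist_cong)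
  moreover have "twist N A c \<in> stage (N * Q)" by (rule twist_stage[OF N Q]) (use c in auto)
  ultimately show ?thesis by metis
qed

text \<open>With \<open>b\<close> the sum of the \<open>e u\<close> times \<open>t u\<close> in the
  group algebra, this is \<open>f\<close> at the product of \<open>b\<close>, \<open>x\<close> and
  the adjoint of \<open>b\<close>. Its form on a family \<open>g\<close> is the form of
  \<open>f\<close> on all products \<open>t u \<circ> g i\<close>.\<close>

lemma (in perm_group) pos_def_compress:
  assumes f: "pos_def H f" and K: "finite K" and t: "\<And>u. u \<in> K \<Longrightarrow> t u \<in> H"
  shows "pos_def H (\<lambda>x. \<Sum>u\<in>K. \<Sum>v\<in>K. e u * cnj (e v) * f (t u \<circ> x \<circ> iv (t v)))"
    (is "pos_def H ?\<psi>")
  unfolding pos_def_def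
proof (intro conjI ballI allI impI)
  fix x assume x: "x \<in> H"
  have "cnj (?\<psi> x) = (\<Sum>u\<in>K. \<Sum>v\<in>K. e v * cnj (e u) * f (t v \<circ> iv x \<circ> iv (t u)))"
    unfolding cnj_sum
  proof (intro sum.cong refl)
    fix u v assume "u \<in> K" "v \<in> K"
    then show "cnj (e u * cnj (e v) * f (t u \<circ> x \<circ> iv (t v))) =
        e v * cnj (e u) * f (t v \<circ> iv x \<circ> iv (t u))"
      using pos_def_inv[OF f, of "t u \<circ> x \<circ> iv (t v)"] t x by (simp add: group_simps)
  qed
  also have "\<dots> = ?\<psi> (iv x)" by (rule sum.swap)
  finally show "?\<psi> (iv x) = cnj (?\<psi> x)" by simp
next
  fix m and g :: "nat \<Rightarrow> 'a \<Rightarrow> 'a" and c :: "nat \<Rightarrow> complex" assume g: "\<forall>i<m. g i \<in> H"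
  let ?g = "\<lambda>(i, u). t u \<circ> g i" and ?c = "\<lambda>(i, u). c i * cnj (e u)"
  have "qform ?\<psi> {..<m} g c = (\<Sum>i<m. \<Sum>j<m. \<Sum>u\<in>K. \<Sum>v\<in>K.
      cnj (c i * cnj (e u)) * f (t u \<circ> g i \<circ> iv (t v \<circ> g j)) * (c j * cnj (e v)))"
    unfolding qform_def
  proof (intro sum.cong refl)
    fix i j assume ij: "i \<in> {..<m}" "j \<in> {..<m}"
    have "?\<psi> (g i \<circ> iv (g j)) =
        (\<Sum>u\<in>K. \<Sum>v\<in>K. e u * cnj (e v) * f (t u \<circ> g i \<circ> iv (t v \<circ> g j)))"
      by (intro sum.cong refl) (use ij g t in \<open>simp add: group_simps\<close>)
    then show "cnj (c i) * ?\<psi> (g i \<circ> iv (g j)) * c j =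
        (\<Sum>u\<in>K. \<Sum>v\<in>K. cnj (c i * cnj (e u)) * f (t u \<circ> g i \<circ> iv (t v \<circ> g j)) * (c j * cnj (e v)))"
      by (simp add: sum_distrib_left sum_distrib_right mult_ac)
  qed
  also have "\<dots> = (\<Sum>i<m. \<Sum>u\<in>K. \<Sum>j<m. \<Sum>v\<in>K.
      cnj (c i * cnj (e u)) * f (t u \<circ> g i \<circ> iv (t v \<circ> g j)) * (c j * cnj (e v)))"
    by (intro sum.cong refl) (rule sum.swap)
  also have "\<dots> = qform f ({..<m} \<times> K) ?g ?c"
    unfolding qform_def sum.cartesian_product' by simp
  finally have "qform ?\<psi> {..<m} g c = qform f ({..<m} \<times> K) ?g ?c" .
  moreover have "0 \<le> Re (qform f ({..<m} \<times> K) ?g ?c)"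
    by (rule pos_def_form[OF f]) (use K t g comp_mem in auto)
  ultimately show "0 \<le> Re (qform ?\<psi> {..<m} g c)" by simp
qed

lemma (in perm_group) pos_def_average:
  assumes f: "pos_def H f" and K: "finite K" and t: "\<And>u. u \<in> K \<Longrightarrow> t u \<in> H"
  shows "pos_def H (\<lambda>x. avg K (\<lambda>u. avg K (\<lambda>v. f (t u \<circ> x \<circ> iv (t v)))))"
proof -
  let ?k = "1 / complex_of_nat (card K)"
  have "(\<Sum>u\<in>K. \<Sum>v\<in>K. ?k * cnj ?k * f (t u \<circ> x \<circ> iv (t v))) =
      avg K (\<lambda>u. avg K (\<lambda>v. f (t u \<circ> x \<circ> iv (t v))))" for x
    unfolding avg_def sum_divide_distrib by (intro sum.cong refl) simp
  then show ?thesis using pos_def_compress[OF f K, of t "\<lambda>_. ?k"] t by (simp only:)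
qed

lemma (in perm_group) pos_def_limit:
  assumes f: "\<And>k. pos_def H (f k)" and lim: "\<And>x. x \<in> H \<Longrightarrow> (\<lambda>k. f k x) \<longlonglongrightarrow> F x"
  shows "pos_def H F"
  unfolding pos_def_def
proof (intro conjI ballI allI impI)
  fix x assume x: "x \<in> H"
  have "(\<lambda>k. cnj (f k x)) \<longlonglongrightarrow> cnj (F x)" by (rule tendsto_cnj[OF lim[OF x]])
  moreover have "cnj (f k x) = f k (iv x)" for k using pos_def_inv[OF f x] by simp
  ultimately show "F (iv x) = cnj (F x)"
    using lim[OF inv_mem[OF x]] LIMSEQ_unique by auto
next
  fix m and g :: "nat \<Rightarrow> 'a \<Rightarrow> 'a" and c :: "nat \<Rightarrow> complex" assume g: "\<forall>i<m. g i \<in> H"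
  have "(\<lambda>k. Re (qform (f k) {..<m} g c)) \<longlonglongrightarrow> Re (qform F {..<m} g c)"
    unfolding qform_def
    by (intro tendsto_Re tendsto_sum tendsto_mult tendsto_const lim) (use g comp_mem inv_mem in auto)
  moreover have "0 \<le> Re (qform (f k) {..<m} g c)" for k
    by (rule pos_def_form[OF f]) (use g in auto)
  ultimately show "0 \<le> Re (qform F {..<m} g c)"
    by (meson LIMSEQ_le_const)
qed

section \<open>Characters of the limit group and their averages\<close>

locale limit_char = radix +
  fixes \<chi> :: "(nat \<Rightarrow> nat) \<Rightarrow> complex"
  assumes pd: "pos_def G \<chi>"
    and central: "g \<in> G \<Longrightarrow> h \<in> G \<Longrightarrow> \<chi> (g \<circ> h) = \<chi> (h \<circ> g)"
    and one: "\<chi> id = 1"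
begin

lemma conj_inv:
  assumes "c \<in> G" "g \<in> G"
  shows "\<chi> (c \<circ> g \<circ> iv c) = \<chi> g"
  using central[of "c \<circ> g" "iv c"] assms by (simp add: G.group_simps)

lemma norm_le: "g \<in> G \<Longrightarrow> cmod (\<chi> g) \<le> 1"
  using G.pos_def_norm_le[OF pd] one by simp

end

text \<open>Data for one averaging step: stage \<open>j\<close> splits each residue modulo
  \<open>level n i\<close> into \<open>Q\<close> fibre points, and \<open>A\<close> is the set of
  residues to be twisted. The bound 3 leaves an element besides the identity and the inverse of a
  given nontrivial element; \<open>free_even\<close> builds a free product of two free elements from
  it.\<close>

locale fibred = limit_char +
  fixes i j Q :: nat and V :: "(nat \<Rightarrow> nat) set" and A :: "nat set"
  assumes lev: "level n j = level n i * Q"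
    and Vg: "fibre_group Q V" and V3: "card V \<ge> 3"
    and A: "A \<subseteq> {..<level n i}"
begin

abbreviation "N \<equiv> level n i"
abbreviation "K \<equiv> A \<rightarrow>\<^sub>E V"
abbreviation "T \<equiv> twist N A"

lemma Npos: "N > 0" by (rule pos)

lemma Qpos: "Q > 0" using lev pos[of j] by (metis mult_0_right neq0_conv)

lemma finA: "finite A" using A finite_subset by blast

lemma VQ: "v \<in> V \<Longrightarrow> v \<in> stage Q"
  and Vid: "id \<in> V"
  and Vcomp: "v \<in> V \<Longrightarrow> w \<in> V \<Longrightarrow> v \<circ> w \<in> V"
  and Vinv: "v \<in> V \<Longrightarrow> iv v \<in> V"
  and Vfree: "v \<in> V \<Longrightarrow> v \<noteq> id \<Longrightarrow> v y \<noteq> y"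
  and Vconj: "v \<in> V \<Longrightarrow> w \<in> V \<Longrightarrow> v \<noteq> id \<Longrightarrow> w \<noteq> id \<Longrightarrow> \<exists>c\<in>stage Q. w = c \<circ> v \<circ> iv c"
  using Vg unfolding fibre_group_def by auto

sublocale V: perm_group V
  by standard (auto intro: Vid Vcomp Vinv stage_bij VQ)

lemma finV: "finite V" using V3 by (rule_tac card_ge_0_finite) simp

lemma Vne: "V \<noteq> {}" using Vid by auto

lemma finK: "finite K" using finA finV by (intro finite_PiE) auto

lemma Kne: "K \<noteq> {}" using Vne by (simp add: PiE_eq_empty_iff)

lemma KV: "u \<in> K \<Longrightarrow> a \<in> A \<Longrightarrow> u a \<in> V" by auto

lemma T_stage: "(\<And>a. a \<in> A \<Longrightarrow> u a \<in> V) \<Longrightarrow> T u \<in> stage (N * Q)"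
  by (rule twist_stage[OF Npos Qpos]) (auto intro: VQ)

lemma T_G: "(\<And>a. a \<in> A \<Longrightarrow> u a \<in> V) \<Longrightarrow> T u \<in> G"
  using T_stage lev stage_G by metis

lemma T_inv: "(\<And>a. a \<in> A \<Longrightarrow> u a \<in> V) \<Longrightarrow> iv (T u) = T (\<lambda>a. iv (u a))"
  by (rule twist_inv[OF Npos]) (auto intro: V.bij_mem)

definition v0 :: "nat \<Rightarrow> nat" where "v0 = (SOME v. v \<in> V \<and> v \<noteq> id)"

lemma v0: "v0 \<in> V" "v0 \<noteq> id"
proof -
  have "card (V - {id}) \<ge> 2" using V3 Vid finV by (simp add: card_Diff_singleton)
  then have "V - {id} \<noteq> {}" by (metis card.empty not_numeral_le_zero)
  then have "\<exists>v. v \<in> V \<and> v \<noteq> id" by auto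
  from someI_ex[OF this] show "v0 \<in> V" "v0 \<noteq> id" unfolding v0_def by auto
qed

definition free :: "(nat \<Rightarrow> nat \<Rightarrow> nat) \<Rightarrow> bool"
  where "free u \<longleftrightarrow> (\<forall>a\<in>A. u a \<in> V \<and> u a \<noteq> id)"

lemma free_conj: "free u \<Longrightarrow> \<exists>c\<in>G. T u = c \<circ> T (\<lambda>_. v0) \<circ> iv c"
  using twist_fibre_conj[OF Npos Qpos, of A "\<lambda>_. v0" u] Vconj[OF v0(1)] VQ[OF v0(1)] v0(2)
  unfolding free_def using stage_G lev by metis

lemma free_supp: "free u \<Longrightarrow> supp (T u) = {x. x mod N \<in> A}"
  by (rule twist_supp[OF Npos]) (auto simp: free_def Vfree)

definition w :: complex where "w = \<chi> (T (\<lambda>_. v0))"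

lemma free_value: "free u \<Longrightarrow> \<chi> (T u) = w"
  using free_conj[of u] conj_inv[OF _ T_G] v0(1) unfolding w_def by metis

lemma w_le: "cmod w \<le> 1"
  unfolding w_def by (intro norm_le T_G) (rule v0)

abbreviation "\<epsilon> \<equiv> real (card A) / real (card V)"

definition \<psi> :: "(nat \<Rightarrow> nat) \<Rightarrow> complex"
  where "\<psi> x = avg K (\<lambda>u. avg K (\<lambda>v. \<chi> (T u \<circ> x \<circ> iv (T v))))"

lemma \<psi>_pos_def: "pos_def G \<psi>"
  unfolding \<psi>_def by (rule G.pos_def_average[OF pd finK]) (rule T_G, auto)

text \<open>The product of \<open>T u\<close> and the inverse of \<open>T v\<close> is free as soon
  as \<open>u\<close> and \<open>v\<close> differ at every point of \<open>A\<close>, which fails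
  for a fraction of at most \<epsilon> of all \<open>v\<close>.\<close>

lemma \<psi>_id: "cmod (\<psi> id - w) \<le> 2 * \<epsilon>"
proof -
  have "cmod (avg K (\<lambda>v. \<chi> (T u \<circ> id \<circ> iv (T v))) - w) \<le> 2 * \<epsilon>" if u: "u \<in> K" for u
  proof (rule avg_PiE_near[OF finA finV Vne _ w_le])
    fix v assume v: "v \<in> K"
    show "cmod (\<chi> (T u \<circ> id \<circ> iv (T v))) \<le> 1"
      by (intro norm_le G.comp_mem G.inv_mem G.id_mem T_G) (use u v in auto)
    assume ne: "\<And>a. a \<in> A \<Longrightarrow> v a \<noteq> u a"
    have "T u \<circ> id \<circ> iv (T v) = T (\<lambda>a. u a \<circ> iv (v a))"
      by (subst T_inv) (use v in \<open>auto simp: twist_comp[OF Npos]\<close>)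
    moreover have "free (\<lambda>a. u a \<circ> iv (v a))"
      unfolding free_def
    proof (intro ballI conjI notI)
      fix a assume a: "a \<in> A"
      have V: "u a \<in> V" "v a \<in> V" using KV u v a by auto
      then show "u a \<circ> iv (v a) \<in> V" by (simp add: V.group_simps)
      assume "u a \<circ> iv (v a) = id"
      then have "u a \<circ> iv (v a) \<circ> v a = v a" by simp
      then show False using V ne[OF a] by (simp add: V.group_simps)
    qed
    ultimately show "\<chi> (T u \<circ> id \<circ> iv (T v)) = w" by (simp add: free_value)
  qed simp
  then show ?thesis unfolding \<psi>_def by (rule avg_near_const[OF finK Kne])
qed

text \<open>The twist \<open>iv (T v) \<circ> T v'\<close> stands between \<open>x\<close> and its
  inverse, and this conjugation only moves its components along \<open>A\<close>. The whole element
  is thus a single twist, and solving for a trivial component gives the excluded value of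
  \<open>v' b\<close>.\<close>

lemma quotient_value:
  assumes x: "x \<in> stage N" "x ` A = A" and K: "u \<in> K" "v \<in> K" "u' \<in> K" "v' \<in> K"
    and ne: "\<And>b. b \<in> A \<Longrightarrow> v' b \<noteq> v b \<circ> iv (u (x b)) \<circ> u' (x b)"
  shows "\<chi> (T u \<circ> x \<circ> iv (T v) \<circ> iv (T u' \<circ> x \<circ> iv (T v'))) = w"
proof -
  interpret B: perm_group "stage N" by (rule stage_group[OF Npos])
  have xG: "x \<in> G" by (rule stage_G[OF x(1)])
  have TG: "T u \<in> G" "T v \<in> G" "T u' \<in> G" "T v' \<in> G" by (rule T_G, use K in auto)+
  have ix: "iv x a \<in> A" "x (iv x a) = a" if "a \<in> A" for a
  proof -
    show "x (iv x a) = a" using B.bij_mem[OF x(1)] by (simp add: bij_is_surj surj_f_inv_f)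
    then show "iv x a \<in> A" using x(2) that B.bij_mem[OF x(1)] by (metis bij_is_inj image_iff inv_f_f)
  qed
  have "T u \<circ> x \<circ> iv (T v) \<circ> iv (T u' \<circ> x \<circ> iv (T v')) =
      T u \<circ> (x \<circ> (iv (T v) \<circ> T v') \<circ> iv x) \<circ> iv (T u')"
    using TG xG by (simp add: G.group_simps)
  also have "iv (T v) \<circ> T v' = T (\<lambda>a. iv (v a) \<circ> v' a)"
    by (subst T_inv) (use K in \<open>auto simp: twist_comp[OF Npos]\<close>)
  also have "x \<circ> T (\<lambda>a. iv (v a) \<circ> v' a) \<circ> iv x = T (\<lambda>a. iv (v (iv x a)) \<circ> v' (iv x a))"
    using twist_stage_conj[OF Npos x(1), of A "\<lambda>a. iv (v a) \<circ> v' a"] x(2) by (simp add: comp_def)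
  also have "T u \<circ> \<dots> \<circ> iv (T u') = T (\<lambda>a. u a \<circ> (iv (v (iv x a)) \<circ> v' (iv x a)) \<circ> iv (u' a))"
    by (subst T_inv) (use K in \<open>auto simp: twist_comp[OF Npos]\<close>)
  finally have eq: "T u \<circ> x \<circ> iv (T v) \<circ> iv (T u' \<circ> x \<circ> iv (T v')) = \<dots>" .
  have "free (\<lambda>a. u a \<circ> (iv (v (iv x a)) \<circ> v' (iv x a)) \<circ> iv (u' a))"
    unfolding free_def
  proof (intro ballI conjI notI)
    fix a assume a: "a \<in> A"
    let ?b = "iv x a"
    have V: "u a \<in> V" "u' a \<in> V" "v ?b \<in> V" "v' ?b \<in> V" using K KV a ix(1)[OF a] by auto
    then show "u a \<circ> (iv (v ?b) \<circ> v' ?b) \<circ> iv (u' a) \<in> V" by (simp add: V.group_simps)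
    assume eq: "u a \<circ> (iv (v ?b) \<circ> v' ?b) \<circ> iv (u' a) = id"
    have "v' ?b = v ?b \<circ> iv (u a) \<circ> (u a \<circ> (iv (v ?b) \<circ> v' ?b) \<circ> iv (u' a)) \<circ> u' a"
      using V by (simp add: V.group_simps)
    also have "\<dots> = v ?b \<circ> iv (u (x ?b)) \<circ> u' (x ?b)" unfolding eq using ix(2)[OF a] by simp
    finally show False using ne[OF ix(1)[OF a]] by simp
  qed
  then show ?thesis unfolding eq by (rule free_value)
qed

text \<open>Both \<open>\<psi> x\<close> and \<open>\<chi> x\<close> are averages of \<open>\<chi>\<close>, over the elements \<open>T u x (T v)\<inverse>\<close> and over the
  conjugates \<open>T u x (T u)\<inverse>\<close>. As \<open>x\<close> moves every point of \<open>A\<close>, all but a fraction \<open>\<epsilon>\<close> of the quotients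
  of these elements are free, where \<open>\<chi>\<close> is the constant \<open>w\<close>.\<close>

lemma \<psi>_near:
  assumes x: "x \<in> stage N" and s: "supp x = {y. y mod N \<in> A}"
  shows "(cmod (\<psi> x - \<chi> x))\<^sup>2 \<le> 8 * \<epsilon>"
proof -
  have xG: "x \<in> G" by (rule stage_G[OF x])
  have Asupp: "A = supp x \<inter> {..<N}" using A s by auto
  have xA: "x ` A = A"
  proof (rule endo_inj_surj[OF finA])
    show "x ` A \<subseteq> A"
      unfolding Asupp using supp_image[OF stage_bij[OF x]] stage_less[OF x] by auto
    show "inj_on x A" using stage_bij[OF x] by (meson bij_is_inj inj_on_subset subset_UNIV)
  qed
  have moved: "x b \<noteq> b" if "b \<in> A" for b using that Asupp by (auto simp: supp_def)
  define g where "g = (\<lambda>(u, v). T u \<circ> x \<circ> iv (T v))"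
  have gG: "g (u, v) \<in> G" if "u \<in> K" "v \<in> K" for u v
    unfolding g_def using that xG by (auto intro!: G.comp_mem G.inv_mem T_G)
  have le1: "cmod (\<chi> (g p \<circ> iv (g q))) \<le> 1" if "p \<in> K \<times> K" "q \<in> K \<times> K" for p q
    using that by (intro norm_le G.comp_mem G.inv_mem) (auto intro: gG)
  have val: "\<chi> (g (u, v) \<circ> iv (g (u', v'))) = w"
    if "u \<in> K" "v \<in> K" "u' \<in> K" "v' \<in> K"
      "\<And>b. b \<in> A \<Longrightarrow> v' b \<noteq> v b \<circ> iv (u (x b)) \<circ> u' (x b)" for u v u' v'
    using quotient_value[OF x xA that] by (simp add: g_def comp_assoc)
  have 1: "cmod (avg K (\<lambda>y. \<chi> (g (u, v) \<circ> iv (g (u', y)))) - w) \<le> 2 * \<epsilon>"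
    if K: "u \<in> K" "v \<in> K" "u' \<in> K" for u v u'
    by (rule avg_PiE_near[OF finA finV Vne _ w_le, where \<phi> = "\<lambda>b y. v b \<circ> iv (u (x b)) \<circ> u' (x b)"])
      (use K in \<open>auto intro!: le1 val\<close>)
  \<comment> \<open>Here the excluded value of \<open>y b\<close> involves \<open>y (x b)\<close>.
    It does not depend on \<open>y b\<close> because \<open>x\<close> moves
    \<open>b\<close>.\<close>
  have 2: "cmod (avg K (\<lambda>y. \<chi> (g (u, v) \<circ> iv (g (y, y)))) - w) \<le> 2 * \<epsilon>"
    if K: "u \<in> K" "v \<in> K" for u v
  proof (rule avg_PiE_near[OF finA finV Vne _ w_le, where \<phi> = "\<lambda>b y. v b \<circ> iv (u (x b)) \<circ> y (x b)"])
    show "v a \<circ> iv (u (x a)) \<circ> (z(a := y)) (x a) = v a \<circ> iv (u (x a)) \<circ> z (x a)"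
      if "a \<in> A" for a z y
      using moved[OF that] by simp
  qed (use K in \<open>auto intro!: le1 val\<close>)
  have II: "cmod (avg (K \<times> K) (\<lambda>p. avg (K \<times> K) (\<lambda>q. \<chi> (g p \<circ> iv (g q)))) - w) \<le> 2 * \<epsilon>"
  proof (rule avg_near_const)
    fix p assume p: "p \<in> K \<times> K"
    have "avg (K \<times> K) (\<lambda>q. \<chi> (g p \<circ> iv (g q))) =
        avg K (\<lambda>u'. avg K (\<lambda>y. \<chi> (g p \<circ> iv (g (u', y)))))"
      by (rule avg_Times)
    moreover obtain u v where "p = (u, v)" "u \<in> K" "v \<in> K" using p by auto
    ultimately show "cmod (avg (K \<times> K) (\<lambda>q. \<chi> (g p \<circ> iv (g q))) - w) \<le> 2 * \<epsilon>"
      using avg_near_const[OF finK Kne 1[of u v]] by simp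
  qed (use finK Kne in auto)
  have JJ: "cmod (avg K (\<lambda>u. avg K (\<lambda>y. \<chi> (g (u, u) \<circ> iv (g (y, y))))) - w) \<le> 2 * \<epsilon>"
    by (rule avg_near_const[OF finK Kne]) (rule 2)
  have IJ: "cmod (avg (K \<times> K) (\<lambda>p. avg K (\<lambda>y. \<chi> (g p \<circ> iv (g (y, y))))) - w) \<le> 2 * \<epsilon>"
    by (rule avg_near_const) (use finK Kne 2 in auto)
  have re: "Re z \<le> Re w + 2 * \<epsilon>" "Re z \<ge> Re w - 2 * \<epsilon>" if "cmod (z - w) \<le> 2 * \<epsilon>" for z
    using that abs_Re_le_cmod[of "z - w"] by auto
  have "avg (K \<times> K) (\<lambda>p. \<chi> (g p)) = \<psi> x"
    by (simp add: avg_Times \<psi>_def g_def)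
  moreover have "avg K (\<lambda>u. \<chi> (g (u, u))) = \<chi> x"
  proof -
    have "avg K (\<lambda>u. \<chi> (g (u, u))) = avg K (\<lambda>u. \<chi> x)"
      by (rule avg_cong) (use xG in \<open>auto simp: g_def intro!: conj_inv T_G\<close>)
    then show ?thesis using finK Kne by (simp add: avg_def)
  qed
  \<comment> \<open>The three means are within \<open>2 * \<epsilon>\<close> of \<open>w\<close> and
    enter with weights 1, 1 and -2, so \<open>w\<close> cancels and the errors add up to
    \<open>8 * \<epsilon>\<close>.\<close>
  moreover have "(cmod (avg (K \<times> K) (\<lambda>p. \<chi> (g p)) - avg K (\<lambda>u. \<chi> (g (u, u)))))\<^sup>2 \<le>
    Re (\<chi> id) * (Re (avg (K \<times> K) (\<lambda>p. avg (K \<times> K) (\<lambda>q. \<chi> (g p \<circ> iv (g q))))) +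
      Re (avg K (\<lambda>u. avg K (\<lambda>y. \<chi> (g (u, u) \<circ> iv (g (y, y)))))) -
      2 * Re (avg (K \<times> K) (\<lambda>p. avg K (\<lambda>y. \<chi> (g p \<circ> iv (g (y, y)))))))"
    by (rule G.pos_def_avg_diff[OF pd, of "K \<times> K" K g "\<lambda>u. g (u, u)"])
      (use finK Kne gG in auto)
  ultimately show ?thesis using re(1)[OF II] re(1)[OF JJ] re(2)[OF IJ] by (simp add: one)
qed

end

section \<open>Compression to a support\<close>

text \<open>Take \<open>T\<close> of maximal size among the sets disjoint from their image. No point
  can be added, so every point lies in \<open>T\<close>, in its image or in its preimage, each of
  size at most \<open>card T\<close>.\<close>

lemma exists_displaced_subset:
  assumes fin: "finite \<Omega>" and g: "inj_on g \<Omega>" "\<And>x. x \<in> \<Omega> \<Longrightarrow> g x \<noteq> x"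
  obtains T where "T \<subseteq> \<Omega>" "g ` T \<inter> T = {}" "card \<Omega> \<le> 3 * card T"
proof -
  let ?\<T> = "{T. T \<subseteq> \<Omega> \<and> g ` T \<inter> T = {}}"
  have fin': "finite (card ` ?\<T>)" using fin by simp
  have "{} \<in> ?\<T>" by simp
  then have "card ` ?\<T> \<noteq> {}" by blast
  from Max_in[OF fin' this] obtain T where T: "T \<in> ?\<T>" "card T = Max (card ` ?\<T>)" by auto
  then have max: "card U \<le> card T" if "U \<in> ?\<T>" for U
    using Max_ge[OF fin', of "card U"] that by simp
  have finT: "finite T" using T fin finite_subset by auto
  have cover: "x \<in> T \<or> x \<in> g ` T \<or> g x \<in> T" if x: "x \<in> \<Omega>" for x
  proof (rule ccontr)
    assume no: "\<not> ?thesis"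
    then have "insert x T \<in> ?\<T>" using T x g(2)[OF x] by auto
    from max[OF this] show False using no finT by simp
  qed
  let ?P = "{x \<in> \<Omega>. g x \<in> T}"
  have "\<Omega> \<subseteq> T \<union> g ` T \<union> ?P" using cover by auto
  then have "card \<Omega> \<le> card (T \<union> g ` T \<union> ?P)"
    using finT fin by (intro card_mono) auto
  also have "\<dots> \<le> card T + card (g ` T) + card ?P"
    using card_Un_le[of "T \<union> g ` T" ?P] card_Un_le[of T "g ` T"] by linarith
  also have "card (g ` T) \<le> card T" by (rule card_image_le[OF finT])
  also have "card ?P \<le> card T"
    by (rule card_inj_on_le[of g]) (use g(1) finT in \<open>auto intro: inj_on_subset\<close>)
  finally have "card \<Omega> \<le> 3 * card T" by simp
  then show ?thesis using that[of T] T(1) by blast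
qed

lemma permutes_extension:
  assumes fin: "finite \<Omega>" and XY: "X \<subseteq> \<Omega>" "Y \<subseteq> \<Omega>" and b: "bij_betw b X Y"
  obtains c where "c permutes \<Omega>" "\<And>x. x \<in> X \<Longrightarrow> c x = b x"
proof -
  have "card X = card Y" by (rule bij_betw_same_card[OF b])
  then have "card (\<Omega> - X) = card (\<Omega> - Y)"
    using XY fin by (metis card_Diff_subset finite_subset)
  then obtain b' where b': "bij_betw b' (\<Omega> - X) (\<Omega> - Y)"
    using finite_same_card_bij[of "\<Omega> - X" "\<Omega> - Y"] fin by auto
  define c where "c = (\<lambda>x. if x \<in> X then b x else if x \<in> \<Omega> then b' x else x)"
  have "bij_betw c X Y" using b by (rule bij_betw_cong[THEN iffD1, rotated]) (simp add: c_def)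
  moreover have "bij_betw c (\<Omega> - X) (\<Omega> - Y)"
    using b' by (rule bij_betw_cong[THEN iffD1, rotated]) (simp add: c_def)
  ultimately have "bij_betw c (X \<union> (\<Omega> - X)) (Y \<union> (\<Omega> - Y))"
    by (rule bij_betw_combine) auto
  then have "bij_betw c \<Omega> \<Omega>" using XY by (simp add: Un_absorb1)
  then have "c permutes \<Omega>" by (rule bij_imp_permutes) (use XY in \<open>auto simp: c_def\<close>)
  then show ?thesis using that by (simp add: c_def)
qed

text \<open>Choose a displaced set \<open>T\<close> of the size of \<open>S\<close>, map it onto
  \<open>S\<close> by any bijection \<open>b\<close>, and send \<open>g y\<close> to
  \<open>h (b y)\<close>. Displacement makes the two prescriptions compatible, disjointness of
  \<open>S\<close> and \<open>S'\<close> makes them jointly injective, and any extension to a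
  permutation serves as \<open>c\<close>.\<close>

lemma exists_conjugate_extending:
  assumes fin: "finite \<Omega>" and g: "inj_on g \<Omega>" "g ` \<Omega> \<subseteq> \<Omega>" "\<And>x. x \<in> \<Omega> \<Longrightarrow> g x \<noteq> x"
    and S: "S \<subseteq> \<Omega>" "S' \<subseteq> \<Omega>" "S \<inter> S' = {}" "3 * card S \<le> card \<Omega>" and h: "bij_betw h S S'"
  obtains c where "c permutes \<Omega>" "\<And>x. x \<in> S \<Longrightarrow> c (g (iv c x)) = h x"
proof -
  obtain T0 where T0: "T0 \<subseteq> \<Omega>" "g ` T0 \<inter> T0 = {}" "card \<Omega> \<le> 3 * card T0"
    using exists_displaced_subset[OF fin g(1,3)] by blast
  then have "card S \<le> card T0" using S(4) by linarith
  then obtain T where T: "T \<subseteq> T0" "card T = card S" "finite T"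
    by (rule obtain_subset_with_card_n)
  have TO: "T \<subseteq> \<Omega>" "g ` T \<inter> T = {}" using T T0 by auto
  have gT: "inj_on g T" using g(1) TO inj_on_subset by blast
  obtain b where b: "bij_betw b T S"
    using finite_same_card_bij[of T S] T S fin finite_subset by metis
  define d where "d = (\<lambda>y. if y \<in> T then b y else h (b (inv_into T g y)))"
  have "bij_betw d T S" using b by (rule bij_betw_cong[THEN iffD1, rotated]) (simp add: d_def)
  moreover have "bij_betw d (g ` T) S'"
  proof -
    have "bij_betw (h \<circ> (b \<circ> inv_into T g)) (g ` T) S'"
      by (rule bij_betw_trans[OF bij_betw_trans[OF bij_betw_inv_into b] h])
        (use gT in \<open>auto simp: bij_betw_def\<close>)
    then show ?thesis
      by (rule bij_betw_cong[THEN iffD1, rotated]) (use TO in \<open>auto simp: d_def\<close>)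
  qed
  ultimately have "bij_betw d (T \<union> g ` T) (S \<union> S')" by (rule bij_betw_combine) (rule S)
  then obtain c where c: "c permutes \<Omega>" "\<And>x. x \<in> T \<union> g ` T \<Longrightarrow> c x = d x"
    using permutes_extension[OF fin, of "T \<union> g ` T" "S \<union> S'" d] TO g(2) S by blast
  have "c (g (iv c x)) = h x" if x: "x \<in> S" for x
  proof -
    obtain y where y: "y \<in> T" "x = b y" using b x by (auto simp: bij_betw_def)
    then have "c y = x" using c(2)[of y] by (simp add: d_def)
    then have "iv c x = y" using permutes_inverses(2)[OF c(1)] by metis
    moreover have "c (g y) = d (g y)" using c(2) y by blast
    moreover have "d (g y) = h x"
      using y TO inv_into_f_f[OF gT y(1)] by (auto simp: d_def)
    ultimately show ?thesis by simp
  qed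
  then show ?thesis using that c(1) by blast
qed

text \<open>Two transpositions that share a point involve at most three points, so five points leave
  two fresh ones \<open>e\<close>, \<open>f\<close>; inserting the transposition of \<open>e\<close>
  and \<open>f\<close> twice splits the product into two disjoint pairs. The induction over
  transpositions carries odd \<open>s\<close> along, multiplied by an arbitrary
  transposition.\<close>

lemma evenperm_generated:
  assumes fin: "finite A" and A: "card A \<ge> 5"
    and P: "P id" "\<And>s t. s permutes A \<Longrightarrow> t permutes A \<Longrightarrow> P s \<Longrightarrow> P t \<Longrightarrow> P (s \<circ> t)"
    and D: "\<And>a b c d. {a, b, c, d} \<subseteq> A \<Longrightarrow> distinct [a, b, c, d] \<Longrightarrow>
      P (transpose a b \<circ> transpose c d)"
    and s: "s permutes A" "evenperm s"
  shows "P s"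
proof -
  have tr: "transpose a b permutes A" if "a \<in> A" "b \<in> A" for a b
    using that by (rule permutes_swap_id)
  have pairs: "P (transpose a b \<circ> transpose c d)"
    if mem: "a \<in> A" "b \<in> A" "c \<in> A" "d \<in> A" and ne: "a \<noteq> b" "c \<noteq> d" for a b c d
  proof (cases "distinct [a, b, c, d]")
    case True
    then show ?thesis using D mem by blast
  next
    case False
    let ?F = "{a, b, c, d}"
    have "card ?F \<le> 3" using False ne by (auto simp: card_insert_if)
    then have "card (A - ?F) \<ge> 2" using A diff_card_le_card_Diff[of ?F A] by simp
    then obtain F where F: "F \<subseteq> A - ?F" "card F = 2" by (meson obtain_subset_with_card_n)
    then obtain e f where "F = {e, f}" "e \<noteq> f" by (meson card_2_iff)
    with F have ef: "e \<in> A" "f \<in> A" "e \<noteq> f" "e \<notin> ?F" "f \<notin> ?F" by auto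
    have "P ((transpose a b \<circ> transpose e f) \<circ> (transpose e f \<circ> transpose c d))"
      using mem ne ef by (intro P(2) D permutes_compose tr) auto
    moreover have "(transpose a b \<circ> transpose e f) \<circ> (transpose e f \<circ> transpose c d) =
        transpose a b \<circ> transpose c d"
      by (simp add: fun_eq_iff)
    ultimately show ?thesis by metis
  qed
  have "(evenperm s \<longrightarrow> P s) \<and>
      (\<not> evenperm s \<longrightarrow> (\<forall>a\<in>A. \<forall>b\<in>A. a \<noteq> b \<longrightarrow> P (transpose a b \<circ> s)))"
    using s(1) fin
  proof (induction rule: permutes_induct)
    case id
    then show ?case using P(1) evenperm_id by (simp add: id_def)
  next
    case (swap c d p)
    have p: "permutation p" using swap.hyps fin by (auto simp: permutation_permutes)
    show ?case
    proof (cases "c = d")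
      case True
      then show ?thesis using swap.IH by simp
    next
      case False
      have ev: "evenperm (transpose c d \<circ> p) \<longleftrightarrow> \<not> evenperm p"
        using False p by (simp add: evenperm_comp permutation_swap_id evenperm_swap)
      have step: "P ((transpose a b \<circ> transpose c d) \<circ> p)"
        if "evenperm p" "a \<in> A" "b \<in> A" "a \<noteq> b" for a b
        by (rule P(2)) (use swap that False pairs in \<open>auto intro!: permutes_compose tr\<close>)
      show ?thesis
        using ev swap.IH swap.hyps False step[unfolded comp_assoc] by blast
    qed
  qed
  then show ?thesis using s(2) by blast
qed

lemma card_periodic:
  assumes "N > 0" "N dvd M" "B \<subseteq> {..<N}"
  shows "card {x \<in> {..<M}. x mod N \<in> B} = card B * (M div N)"
proof -
  obtain q where q: "M = N * q" using assms(2) by auto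
  have "bij_betw (\<lambda>x. (x mod N, x div N)) {x \<in> {..<M}. x mod N \<in> B} (B \<times> {..<q})"
  proof (rule bij_betw_byWitness[where f' = "\<lambda>(a, b). a + N * b"])
    have "a + N * b < M" if "a \<in> B" "b < q" for a b
    proof -
      have "a + N * b < N * Suc b" using that assms(3) by auto
      also have "\<dots> \<le> N * q" using that by (intro mult_le_mono2) simp
      finally show ?thesis using q by simp
    qed
    then show "(\<lambda>(a, b). a + N * b) ` (B \<times> {..<q}) \<subseteq> {x \<in> {..<M}. x mod N \<in> B}"
      using assms(1,3) by auto
    show "(\<lambda>x. (x mod N, x div N)) ` {x \<in> {..<M}. x mod N \<in> B} \<subseteq> B \<times> {..<q}"
      using q by (auto simp: less_mult_imp_div_less mult.commute)
  qed (use assms(3) in auto)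
  then show ?thesis using assms(1) q by (simp add: bij_betw_same_card card_cartesian_product)
qed

lemma restr_comp: "h \<in> stage N \<Longrightarrow> restr N (g \<circ> h) = restr N g \<circ> restr N h"
  using stage_less by (auto simp: restr_def fun_eq_iff)

lemma restr_permutes_supp:
  assumes "g \<in> stage N"
  shows "restr N g permutes (supp g \<inter> {..<N})"
  by (rule permutes_superset[OF restr_permutes[OF assms]]) (auto simp: restr_def supp_def)

lemma periodic_comp:
  assumes "N > 0" "t permutes {..<N}"
  shows "periodic N (s \<circ> t) = periodic N s \<circ> periodic N t"
  using permutes_less[OF assms(2)] assms(1) by (auto simp: periodic_def fun_eq_iff)

lemma periodic_id: "periodic N id = id"
  by (simp add: periodic_def fun_eq_iff)

lemma supp_mod: "g \<in> stage N \<Longrightarrow> supp g = {x. x mod N \<in> supp g \<inter> {..<N}}" if "N > 0"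
  using supp_stage[of g N] that by auto

section \<open>The sign on the limit group\<close>

context radix
begin

abbreviation sg :: "(nat \<Rightarrow> nat) \<Rightarrow> complex" where "sg \<equiv> sgn_infinity n"

lemma sgn_stage_restr:
  assumes g: "g \<in> stage (level n k)"
  shows "sgn_stage n k g = sign (restr (level n k) g)"
proof -
  have s: "restr (level n k) g \<in> carrier (Sym (level n k))"
    using restr_permutes[OF g] by (simp add: Sym_def)
  have "limit_embed n k (restr (level n k) g) = g"
    by (simp add: limit_embed_periodic periodic_restr[OF pos g])
  then have "inv_into (carrier (Sym (level n k))) (limit_embed n k) g = restr (level n k) g"
    using inv_into_f_f[OF limit_embed_inj[OF n] s] by simp
  then show ?thesis by (simp add: sgn_stage_def)
qed

lemma sg_obtain:
  assumes g: "g \<in> G"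
  obtains k where "k \<ge> 1"
    "\<And>j. j \<ge> k \<Longrightarrow> g \<in> stage (level n j) \<and> sg g = of_int (sign (restr (level n j) g))"
proof -
  obtain k where k: "k \<ge> 1" "\<And>j. j \<ge> k \<Longrightarrow> g \<in> stage (level n j)" using G_obtain[OF g] by blast
  obtain e where e: "\<forall>\<^sub>F k in sequentially. sgn_stage n k g = e" "sg g = of_int e"
    using sgn_stage_eventually_const[of n g, OF n] g by (auto simp: carrier_eq)
  then obtain l where l: "\<And>j. j \<ge> l \<Longrightarrow> sgn_stage n j g = e"
    unfolding eventually_sequentially by blast
  show ?thesis
  proof (rule that[of "max k l"])
    fix j assume "j \<ge> max k l"
    then show "g \<in> stage (level n j) \<and> sg g = of_int (sign (restr (level n j) g))"
      using k(2)[of j] l[of j] sgn_stage_restr[of g j] e(2) by simp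
  qed (use k in simp)
qed

lemma sg_cases: "g \<in> G \<Longrightarrow> sg g = 1 \<or> sg g = - 1"
  using sg_obtain[of g] by (metis of_int_1 of_int_minus order_refl sign_cases)

lemma sg_eventually:
  "g \<in> G \<Longrightarrow> \<exists>k. \<forall>j\<ge>k. g \<in> stage (level n j) \<and> sg g = of_int (sign (restr (level n j) g))"
  by (rule sg_obtain[of g]) auto

lemma sg_comp:
  assumes g: "g \<in> G" and h: "h \<in> G"
  shows "sg (g \<circ> h) = sg g * sg h"
proof -
  obtain k where k: "\<forall>j\<ge>k. g \<in> stage (level n j) \<and> sg g = of_int (sign (restr (level n j) g))"
    using sg_eventually[OF g] ..
  obtain l where l: "\<forall>j\<ge>l. h \<in> stage (level n j) \<and> sg h = of_int (sign (restr (level n j) h))"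
    using sg_eventually[OF h] ..
  obtain m where m: "\<forall>j\<ge>m. g \<circ> h \<in> stage (level n j) \<and>
      sg (g \<circ> h) = of_int (sign (restr (level n j) (g \<circ> h)))"
    using sg_eventually[OF G.comp_mem[OF g h]] ..
  let ?j = "max k (max l m)"
  let ?N = "level n ?j"
  note k = k[rule_format, of ?j] and l = l[rule_format, of ?j] and m = m[rule_format, of ?j]
  have gh: "g \<in> stage ?N" "h \<in> stage ?N" using k l by simp_all
  have "permutation (restr ?N g)" "permutation (restr ?N h)"
    using restr_permutes[OF gh(1)] restr_permutes[OF gh(2)]
    by (auto simp: permutation_permutes)
  then have "sign (restr ?N (g \<circ> h)) = sign (restr ?N g) * sign (restr ?N h)"
    by (simp add: restr_comp[OF gh(2)] sign_compose)
  then show ?thesis using k l m by simp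
qed

lemma sg_id: "sg id = 1"
  using sg_comp[OF G.id_mem G.id_mem] sg_cases[OF G.id_mem] by auto

lemma sg_inv: "g \<in> G \<Longrightarrow> sg (iv g) = sg g"
  using sg_comp[of g "iv g"] sg_cases[of g] sg_cases[of "iv g"] G.inv_mem[of g] sg_id
  by (auto simp: G.inv_right)

lemma sg_conj: "g \<in> G \<Longrightarrow> c \<in> G \<Longrightarrow> sg (c \<circ> g \<circ> iv c) = sg g"
  using sg_cases[of c] by (auto simp: sg_comp sg_inv G.comp_mem G.inv_mem)

lemma sg_square: "g \<in> G \<Longrightarrow> sg (g \<circ> g) = 1"
  using sg_cases[of g] by (auto simp: sg_comp)

end

section \<open>Extremal moduli and the limit of the compressions\<close>

context limit_char
begin

definition W :: "nat set \<Rightarrow> real"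
  where "W A = Sup ((\<lambda>g. cmod (\<chi> g)) ` {g \<in> G. supp g = A})"

lemma W_upper: "g \<in> G \<Longrightarrow> cmod (\<chi> g) \<le> W (supp g)"
  unfolding W_def by (rule cSup_upper) (auto intro!: bdd_aboveI[of _ 1] norm_le)

lemma exists_fibred:
  assumes A: "A \<subseteq> {..<level n i}"
  obtains j Q V where "fibred n \<chi> i j Q V A" "card V > K"
proof -
  obtain j where j: "level n j = level n i * (level n j div level n i)"
      "level n j div level n i \<ge> fact (max 3 K) + 1"
    using level_quotient_ge by blast
  then have "level n j div level n i > fact (max 3 K)" by simp
  then obtain V where V: "fibre_group (level n j div level n i) V" "card V > max 3 K"
    by (rule exists_fibre_group)
  show ?thesis
    by (rule that[of j _ V], unfold_locales) (use j(1) V A in auto)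
qed

text \<open>The compressions at stage \<open>k0 + m\<close> have errors controlled by
  \<open>1 / Suc m\<close>, and by countability of the group a subsequence converges everywhere. At
  the identity the limit is at most \<open>W A\<close>, since each \<open>F.w\<close> is a value of
  \<chi> on an element of support \<open>A\<close>, and at least \<open>W A\<close>, since it
  dominates the moduli of \<psi>.\<close>

lemma exists_compression:
  assumes g0: "g0 \<in> G"
  obtains \<psi> where "pos_def G \<psi>" "\<And>g. g \<in> G \<Longrightarrow> supp g = supp g0 \<Longrightarrow> \<psi> g = \<chi> g"
    "\<psi> id = of_real (W (supp g0))"
proof -
  define A where "A = supp g0"
  obtain k0 where k0: "\<And>j. j \<ge> k0 \<Longrightarrow> g0 \<in> stage (level n j)" using G_obtain[OF g0] by blast
  have "\<exists>f. pos_def G f \<and> Re (f id) \<le> W A + 2 / Suc m \<and>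
      (\<forall>x\<in>stage (level n (k0 + m)). supp x = A \<longrightarrow> (cmod (f x - \<chi> x))\<^sup>2 \<le> 8 / Suc m)" for m
  proof -
    let ?N = "level n (k0 + m)"
    let ?A = "A \<inter> {..<?N}"
    have A: "A = {x. x mod ?N \<in> ?A}"
      unfolding A_def by (rule supp_mod[OF pos]) (use k0 in auto)
    \<comment> \<open>The level bounds \<open>card ?A\<close>, so this lower bound on
      \<open>card V\<close> makes the averaging error \<epsilon> at most
      \<open>1 / Suc m\<close>.\<close>
    obtain j Q V where "fibred n \<chi> (k0 + m) j Q V ?A" and V: "card V > Suc m * ?N"
      using exists_fibred[of ?A "k0 + m" "Suc m * ?N"] by blast
    then interpret F: fibred n \<chi> "k0 + m" j Q V ?A by simp
    have "card ?A \<le> ?N" using card_mono[of "{..<?N}" ?A] by simp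
    then have "Suc m * card ?A \<le> Suc m * ?N" by (rule mult_le_mono2)
    then have "card ?A * Suc m \<le> card V" using V by (simp only: mult.commute[of "card ?A"])
    then have "real (card ?A) * real (Suc m) \<le> real (card V)"
      by (simp only: of_nat_mult[symmetric] of_nat_le_iff)
    then have "real (card ?A) \<le> real (card V) / Suc m" by (subst pos_le_divide_eq) simp_all
    then have "real (card ?A) / real (card V) \<le> real (card V) / Suc m / real (card V)"
      by (rule divide_right_mono) simp
    then have eps: "real (card ?A) / real (card V) \<le> 1 / Suc m" using V by simp
    have "cmod F.w \<le> W A"
    proof -
      have fr: "F.free (\<lambda>_. F.v0)" using F.v0 by (simp add: F.free_def)
      have "supp (F.T (\<lambda>_. F.v0)) = A"
        using F.free_supp[OF fr] A by simp
      moreover have "F.T (\<lambda>_. F.v0) \<in> G" by (rule F.T_G) (rule F.v0)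
      ultimately show ?thesis using W_upper unfolding F.w_def by metis
    qed
    then have "Re (F.\<psi> id) \<le> W A + 2 * (real (card ?A) / real (card V))"
      using F.\<psi>_id abs_Re_le_cmod[of "F.\<psi> id - F.w"] complex_Re_le_cmod[of F.w] by simp
    then have "Re (F.\<psi> id) \<le> W A + 2 / Suc m" using eps by simp
    moreover have "(cmod (F.\<psi> x - \<chi> x))\<^sup>2 \<le> 8 / Suc m" if "x \<in> stage ?N" "supp x = A" for x
      using F.\<psi>_near[OF that(1)] A that(2) eps by auto
    ultimately show ?thesis using F.\<psi>_pos_def by (intro exI[of _ F.\<psi>]) blast
  qed
  then obtain f where f: "\<And>m. pos_def G (f m)" "\<And>m. Re (f m id) \<le> W A + 2 / Suc m"
    "\<And>m x. x \<in> stage (level n (k0 + m)) \<Longrightarrow> supp x = A \<Longrightarrow> (cmod (f m x - \<chi> x))\<^sup>2 \<le> 8 / Suc m"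
    by metis
  have "cmod (f m x) \<le> W A + 2" if "x \<in> G" for m x
  proof -
    have "2 / real (Suc m) \<le> 2" by (simp add: divide_simps)
    then show ?thesis using G.pos_def_norm_le[OF f(1)[of m] that] f(2)[of m] by linarith
  qed
  then obtain r where r: "strict_mono (r :: nat \<Rightarrow> nat)"
      "\<And>x. x \<in> G \<Longrightarrow> \<exists>l. (\<lambda>m. f (r m) x) \<longlonglongrightarrow> l"
    using function_convergent_subsequence[OF countable_G, of f] by blast
  define \<psi> where "\<psi> x = lim (\<lambda>m. f (r m) x)" for x
  have lim: "(\<lambda>m. f (r m) x) \<longlonglongrightarrow> \<psi> x" if "x \<in> G" for x
    unfolding \<psi>_def using r(2)[OF that] limI by metis
  have pd': "pos_def G \<psi>" by (rule G.pos_def_limit[OF f(1) lim])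
  have inv0: "(\<lambda>m. c / real (Suc (r m))) \<longlonglongrightarrow> 0" for c :: real
  proof -
    have "(\<lambda>m. c / real (Suc m)) \<longlonglongrightarrow> 0"
      using LIMSEQ_Suc[OF lim_const_over_n[of c]] by simp
    from LIMSEQ_subseq_LIMSEQ[OF this r(1)] show ?thesis by (simp add: o_def)
  qed
  have eq: "\<psi> g = \<chi> g" if g: "g \<in> G" "supp g = A" for g
  proof -
    obtain k where k: "\<And>j. j \<ge> k \<Longrightarrow> g \<in> stage (level n j)" using G_obtain[OF g(1)] by blast
    have "(\<lambda>m. (cmod (f (r m) g - \<chi> g))\<^sup>2) \<longlonglongrightarrow> 0"
    proof (rule Lim_null_comparison[OF _ inv0[of 8]])
      have "norm ((cmod (f (r m) g - \<chi> g))\<^sup>2) \<le> 8 / real (Suc (r m))" if "m \<ge> k" for m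
        using f(3)[OF k g(2), of "r m"] that seq_suble[OF r(1), of m] by simp
      then show "\<forall>\<^sub>F m in sequentially. norm ((cmod (f (r m) g - \<chi> g))\<^sup>2) \<le> 8 / real (Suc (r m))"
        unfolding eventually_sequentially by blast
    qed
    then have "(\<lambda>m. sqrt ((cmod (f (r m) g - \<chi> g))\<^sup>2)) \<longlonglongrightarrow> sqrt 0"
      by (rule tendsto_real_sqrt)
    then have "(\<lambda>m. f (r m) g - \<chi> g) \<longlonglongrightarrow> 0" by (simp add: tendsto_norm_zero_iff)
    then have "(\<lambda>m. f (r m) g) \<longlonglongrightarrow> \<chi> g" by (simp add: LIM_zero_iff)
    then show ?thesis using lim[OF g(1)] LIMSEQ_unique by blast
  qed
  have "Re (\<psi> id) \<le> W A"
  proof (rule LIMSEQ_le[OF tendsto_Re[OF lim[OF G.id_mem]]])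
    show "(\<lambda>m. W A + 2 / real (Suc (r m))) \<longlonglongrightarrow> W A"
      using tendsto_add[OF tendsto_const[of "W A"] inv0[of 2]] by simp
  qed (use f(2) in auto)
  moreover have "W A \<le> Re (\<psi> id)"
    unfolding W_def
  proof (rule cSup_least)
    show "(\<lambda>g. cmod (\<chi> g)) ` {g \<in> G. supp g = A} \<noteq> {}" using g0 by (auto simp: A_def)
    fix x assume "x \<in> (\<lambda>g. cmod (\<chi> g)) ` {g \<in> G. supp g = A}"
    then obtain g where g: "g \<in> G" "supp g = A" "x = cmod (\<chi> g)" by blast
    then show "x \<le> Re (\<psi> id)" using G.pos_def_norm_le[OF pd' g(1)] eq[OF g(1,2)] by simp
  qed
  ultimately have "\<psi> id = of_real (W A)" using G.pos_def_id_nonneg[OF pd'] by simp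
  then show ?thesis using that pd' eq unfolding A_def by blast
qed

end

section \<open>Values on even elements\<close>

lemma periodic_less: "x < N \<Longrightarrow> periodic N s x = s x"
  by (simp add: periodic_def)

lemma stage_eqI:
  assumes "N dvd M" "f \<in> stage M" "g \<in> stage M" "\<And>x. x < M \<Longrightarrow> x mod N \<in> B \<Longrightarrow> f x = g x"
    and "M > 0" "x mod N \<in> B"
  shows "f x = g x"
  using assms(4)[of "x mod M"] assms(1,5,6) stage_apply[OF assms(2), of x] stage_apply[OF assms(3), of x]
  by (simp add: mod_mod_cancel)

lemma twist_sandwich:
  assumes "N > 0" "B \<inter> D = {}"
  shows "twist N B u \<circ> twist N D x \<circ> twist N B v = twist N (B \<union> D) (\<lambda>a. if a \<in> B then u a \<circ> v a else x a)"
  unfolding twist_def fibrewise_comp[OF assms(1)]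
  by (rule arg_cong[of _ _ "fibrewise N"], rule ext) (use assms(2) in auto)

context limit_char
begin

text \<open>With \<open>s = (a b)\<close> and a conjugate \<open>\<alpha>\<close> of \<open>g1\<close> that carries \<open>s\<close> to \<open>(c d)\<close>, the product
  \<open>(c d) (a b)\<close> is the quotient of \<open>\<alpha>\<close> and \<open>s \<alpha> s\<close>, and \<open>\<psi>\<close> takes the value \<open>\<chi> g1\<close> at both.\<close>

lemma double_transposition_bound:
  assumes \<psi>: "pos_def G \<psi>" "\<And>g. g \<in> G \<Longrightarrow> supp g = A \<Longrightarrow> \<psi> g = \<chi> g"
    and g1: "g1 \<in> G" "supp g1 = A"
    and per: "\<And>x. x \<in> A \<longleftrightarrow> x mod level n k \<in> A"
    and ge6: "card (A \<inter> {..<level n k}) \<ge> 6"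
    and mem: "{a, b, c, d} \<subseteq> A \<inter> {..<level n k}" and dist: "distinct [a, b, c, d]"
  shows "Re (\<psi> (periodic (level n k) (transpose c d \<circ> transpose a b))) \<ge> 4 * cmod (\<chi> g1) - 3 * Re (\<psi> id)"
proof -
  let ?N = "level n k"
  have N: "?N > 0" by (rule pos)
  obtain l where l: "\<And>j. j \<ge> l \<Longrightarrow> g1 \<in> stage (level n j)" using G_obtain[OF g1(1)] by blast
  \<comment> \<open>The element \<open>g1\<close> need not lie in stage \<open>k\<close>. The
    conjugation is built at a common stage, where each of the residues \<open>a\<close>,
    \<open>b\<close>, \<open>c\<close>, \<open>d\<close> stands for \<open>M div ?N\<close>
    points.\<close>
  define i where "i = max k l"
  define M where "M = level n i"
  have M: "M > 0" unfolding M_def by (rule pos)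
  have g1M: "g1 \<in> stage M" unfolding M_def using l i_def by simp
  have dvdM: "?N dvd M" unfolding M_def i_def by (rule dvd) simp
  interpret B: perm_group "stage M" by (rule stage_group[OF M])
  have blkM: "x \<in> stage M" if "x \<in> stage ?N" for x using stage_mono[OF dvdM] that by blast
  have perm: "transpose x y permutes {..<?N}" if "x \<in> {a, b, c, d}" "y \<in> {a, b, c, d}" for x y
    by (rule permutes_swap_id) (use that mem in auto)
  define \<tau> where "\<tau> = transpose a c \<circ> transpose b d"
  have \<tau>p: "\<tau> permutes {..<?N}" unfolding \<tau>_def by (intro permutes_compose perm) auto
  have \<tau>ab: "\<tau> a = c" "\<tau> b = d"
    using dist by (auto simp: \<tau>_def)
  define s where "s = periodic ?N (transpose a b)"
  define s' where "s' = periodic ?N (transpose c d)"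
  define h where "h = periodic ?N \<tau>"
  have sN: "s \<in> stage ?N" "s' \<in> stage ?N" "h \<in> stage ?N"
    unfolding s_def s'_def h_def using periodic_stage[OF N] perm \<tau>p by simp_all
  have hs: "h \<circ> s = s' \<circ> h"
  proof -
    have "\<tau> \<circ> transpose a b = transpose c d \<circ> \<tau>"
      using transpose_comp_eq[OF permutes_bij[OF \<tau>p], of c d]
        permutes_inverses(2)[OF \<tau>p, of a] permutes_inverses(2)[OF \<tau>p, of b]
      unfolding \<tau>ab by simp
    then show ?thesis
      unfolding h_def s_def s'_def using periodic_comp[OF N perm[of a b], of \<tau>]
        periodic_comp[OF N \<tau>p, of "transpose c d"] by simp
  qed
  have ss: "s \<circ> s = id"
    unfolding s_def using periodic_comp[OF N perm[of a b], of "transpose a b"] by (simp add: periodic_id)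
  have hmod: "h x mod ?N = \<tau> (x mod ?N)" for x
    using stage_mod[OF sN(3), of x] N by (simp add: h_def periodic_less)
  define \<Omega> where "\<Omega> = A \<inter> {..<M}"
  define S where "S = {x \<in> {..<M}. x mod ?N \<in> {a, b}}"
  define S' where "S' = {x \<in> {..<M}. x mod ?N \<in> {c, d}}"
  have \<Omega>: "\<Omega> = {x \<in> {..<M}. x mod ?N \<in> A \<inter> {..<?N}}"
    unfolding \<Omega>_def using per N by auto
  have fin: "finite \<Omega>" "finite S" "finite S'" by (simp_all add: \<Omega>_def S_def S'_def)
  \<comment> \<open>Two residues against at least six: this is the inequality
    \<open>3 * card S \<le> card \<Omega>\<close> demanded by
    \<open>exists_conjugate_extending\<close>.\<close>
  have cards: "card S = 2 * (M div ?N)" "card S' = 2 * (M div ?N)" "card \<Omega> \<ge> 6 * (M div ?N)"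
  proof -
    show "card S = 2 * (M div ?N)" "card S' = 2 * (M div ?N)"
      unfolding S_def S'_def using card_periodic[OF N dvdM, of "{a, b}"]
        card_periodic[OF N dvdM, of "{c, d}"] mem dist by auto
    show "card \<Omega> \<ge> 6 * (M div ?N)"
      unfolding \<Omega> using card_periodic[OF N dvdM, of "A \<inter> {..<?N}"] ge6 by simp
  qed
  have sub: "S \<subseteq> \<Omega>" "S' \<subseteq> \<Omega>" "S \<inter> S' = {}"
    unfolding \<Omega> S_def S'_def using mem dist by auto
  have hS: "bij_betw h S S'"
  proof -
    have "h ` S \<subseteq> S'"
    proof (rule image_subsetI)
      fix x assume x: "x \<in> S"
      then have "\<tau> (x mod ?N) \<in> {c, d}" by (cases "x mod ?N = a") (simp_all add: S_def \<tau>ab)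
      then show "h x \<in> S'"
        using x stage_less[OF blkM[OF sN(3)], of x] hmod[of x] by (simp add: S_def S'_def)
    qed
    moreover have inj: "inj_on h S"
      using stage_bij[OF sN(3)] by (meson bij_is_inj inj_on_subset subset_UNIV)
    ultimately have "h ` S = S'"
      using card_subset_eq[OF fin(3)] cards by (metis card_image)
    then show ?thesis using inj by (simp add: bij_betw_def)
  qed
  obtain c0 where c0: "c0 permutes \<Omega>" "\<And>x. x \<in> S \<Longrightarrow> c0 (g1 (iv c0 x)) = h x"
  proof (rule exists_conjugate_extending[OF fin(1) _ _ _ sub _ hS])
    show "inj_on g1 \<Omega>" using stage_bij[OF g1M] by (meson bij_is_inj inj_on_subset subset_UNIV)
    show "g1 ` \<Omega> \<subseteq> \<Omega>"
      unfolding \<Omega>_def g1(2)[symmetric] using supp_image[OF stage_bij[OF g1M]] stage_less[OF g1M] by auto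
    show "g1 x \<noteq> x" if "x \<in> \<Omega>" for x using that g1(2) by (auto simp: \<Omega>_def supp_def)
    show "3 * card S \<le> card \<Omega>" using cards by simp
  qed blast
  have c0M: "c0 permutes {..<M}" by (rule permutes_subset[OF c0(1)]) (auto simp: \<Omega>_def)
  define C where "C = periodic M c0"
  have C: "C \<in> stage M" unfolding C_def by (rule periodic_stage[OF M c0M])
  define \<alpha> where "\<alpha> = C \<circ> g1 \<circ> iv C"
  have \<alpha>M: "\<alpha> \<in> stage M" unfolding \<alpha>_def using C g1M by (simp add: B.group_simps)
  have \<alpha>h: "\<alpha> x = h x" if "x mod ?N \<in> {a, b}" for x
  proof (rule stage_eqI[OF dvdM \<alpha>M blkM[OF sN(3)] _ M that])
    fix x assume x: "x < M" "x mod ?N \<in> {a, b}"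
    have lt: "iv c0 x < M" using permutes_less[OF permutes_inv[OF c0M]] x by simp
    have "C (iv c0 x) = x" unfolding C_def using lt permutes_inverses(1)[OF c0M] by (simp add: periodic_less)
    then have "iv C x = iv c0 x" using stage_bij[OF C] by (metis bij_is_inj inv_f_f)
    then show "\<alpha> x = h x"
      using c0(2)[of x] x stage_less[OF g1M lt] by (simp add: \<alpha>_def C_def periodic_less S_def)
  qed
  have s_fix: "s y = y" if "y mod ?N \<notin> {a, b}" for y
    using stage_apply[OF sN(1), of y] that N by (simp add: s_def periodic_less Transposition.transpose_def)
  have s'_fix: "s' y = y" if "y mod ?N \<notin> {c, d}" for y
    using stage_apply[OF sN(2), of y] that N by (simp add: s'_def periodic_less Transposition.transpose_def)
  have s_mod: "s y mod ?N \<in> {a, b}" if "y mod ?N \<in> {a, b}" for y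
    using stage_mod[OF sN(1), of y] that N by (auto simp: s_def periodic_less Transposition.transpose_def)
  \<comment> \<open>On the residues \<open>a\<close>, \<open>b\<close> the map \<alpha> is
    \<open>h\<close>, which intertwines \<open>s\<close> and \<open>s'\<close>. Elsewhere
    \<open>s\<close> is trivial, and so is \<open>s'\<close> at \<open>\<alpha> y\<close>, because
    the residues \<open>c\<close>, \<open>d\<close> are already filled by the images of the residues
    \<open>a\<close>, \<open>b\<close>.\<close>
  have \<alpha>s: "\<alpha> \<circ> s = s' \<circ> \<alpha>"
  proof
    fix y
    show "(\<alpha> \<circ> s) y = (s' \<circ> \<alpha>) y"
    proof (cases "y mod ?N \<in> {a, b}")
      case True
      then show ?thesis using \<alpha>h[OF True] \<alpha>h[OF s_mod[OF True]] fun_cong[OF hs, of y] by simp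
    next
      case False
      have "\<alpha> y mod ?N \<notin> {c, d}"
      proof
        assume z: "\<alpha> y mod ?N \<in> {c, d}"
        define y' where "y' = iv h (\<alpha> y)"
        have hy: "h y' = \<alpha> y" unfolding y'_def
          using stage_bij[OF sN(3)] by (simp add: bij_is_surj surj_f_inv_f)
        have "\<tau> (y' mod ?N) \<in> {c, d}" using hmod[of y'] hy z by simp
        then have "y' mod ?N \<in> {a, b}"
          using dist by (auto simp: \<tau>_def Transposition.transpose_def split: if_splits)
        from \<alpha>h[OF this] have "\<alpha> y' = \<alpha> y" using hy by simp
        then have "y' = y" using stage_bij[OF \<alpha>M] by (simp add: bij_is_inj inj_eq)
        then show False using \<open>y' mod ?N \<in> {a, b}\<close> False by simp
      qed
      then show ?thesis using s_fix[OF False] s'_fix by simp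
    qed
  qed
  have inG: "\<alpha> \<in> G" "s \<in> G" "C \<in> G" "g1 \<in> G" "s' \<in> G"
    using \<alpha>M C sN g1 stage_G M_def by blast+
  define \<beta> where "\<beta> = s \<circ> \<alpha> \<circ> iv s"
  have \<beta>: "\<beta> \<in> G" unfolding \<beta>_def using inG by (simp add: G.group_simps)
  have CA: "C ` A = A"
  proof -
    have CAsub: "C x \<in> A" if "x \<in> A" for x
    proof -
      have "x mod M \<in> \<Omega>" using that supp_stage[OF g1M] g1(2) M by (auto simp: \<Omega>_def)
      then have "c0 (x mod M) \<in> \<Omega>" using permutes_in_image[OF c0(1)] by blast
      moreover have "C x mod M = c0 (x mod M)"
        using stage_mod[OF C, of x] M by (simp add: C_def periodic_less)
      ultimately show ?thesis using supp_stage[OF g1M, of "C x"] g1(2) by (auto simp: \<Omega>_def)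
    qed
    have "x \<in> C ` A" if "x \<in> A" for x
    proof -
      have "x mod M \<in> \<Omega>" using that supp_stage[OF g1M] g1(2) M by (auto simp: \<Omega>_def)
      then have *: "iv c0 (x mod M) \<in> \<Omega>"
        using permutes_in_image[OF permutes_inv[OF c0(1)]] by blast
      let ?y = "iv C x"
      have Cy: "C ?y = x" using stage_bij[OF C] by (simp add: bij_is_surj surj_f_inv_f)
      have "c0 (?y mod M) = x mod M" using stage_mod[OF C, of ?y] M Cy by (simp add: C_def periodic_less)
      then have "?y mod M = iv c0 (x mod M)" using permutes_inverses(2)[OF c0(1)] by metis
      then have "?y \<in> A" using * supp_stage[OF g1M, of ?y] g1(2) by (auto simp: \<Omega>_def)
      then show ?thesis using Cy by (metis imageI)
    qed
    then show ?thesis using CAsub by blast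
  qed
  have \<alpha>A: "supp \<alpha> = A" unfolding \<alpha>_def using supp_conj[OF stage_bij[OF C]] g1(2) CA by simp
  have sA: "s ` A = A"
  proof -
    have "s x \<in> A" if "x \<in> A" for x
    proof (cases "x mod ?N \<in> {a, b}")
      case True
      then show ?thesis using s_mod[OF True] per[of "s x"] mem by auto
    qed (use s_fix that in simp)
    moreover have "x = s (s x)" for x using fun_cong[OF ss, of x] by simp
    ultimately show ?thesis by (metis (no_types, lifting) image_subsetI image_eqI subsetI subset_antisym)
  qed
  have \<beta>A: "supp \<beta> = A" unfolding \<beta>_def using supp_conj[OF stage_bij[OF sN(1)]] \<alpha>A sA by simp
  have "\<chi> \<alpha> = \<chi> g1" unfolding \<alpha>_def by (rule conj_inv) (use inG in auto)
  moreover have "\<chi> \<beta> = \<chi> \<alpha>" unfolding \<beta>_def by (rule conj_inv) (use inG in auto)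
  ultimately have \<psi>\<alpha>: "\<psi> \<alpha> = \<chi> g1" "\<psi> \<alpha> = \<psi> \<beta>"
    using \<psi>(2) inG \<beta> \<alpha>A \<beta>A by simp_all
  have ivs: "iv s = s" using ss by (metis inv_unique_comp)
  \<comment> \<open>The quotient is the commutator of \<alpha> and \<open>s\<close>; since \<alpha>
    carries \<open>s\<close> to \<open>s'\<close>, it is \<open>s' \<circ> s\<close>.\<close>
  have "\<alpha> \<circ> iv \<beta> = (\<alpha> \<circ> s) \<circ> iv \<alpha> \<circ> iv s"
    unfolding \<beta>_def using inG by (simp add: G.group_simps)
  also have "\<dots> = s' \<circ> s" unfolding \<alpha>s ivs using inG by (simp add: G.group_simps)
  also have "\<dots> = periodic ?N (transpose c d \<circ> transpose a b)"
    unfolding s_def s'_def using periodic_comp[OF N perm[of a b]] by simp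
  finally have q: "\<alpha> \<circ> iv \<beta> = \<dots>" .
  show ?thesis
    using G.pos_def_quotient_ge[OF \<psi>(1) inG(1) \<beta> \<psi>\<alpha>(2)] unfolding q \<psi>\<alpha>(1) .
qed

lemma W_empty: "W {} = 1"
proof -
  have "{g \<in> G. supp g = {}} = {id}" using supp_empty G.id_mem by auto
  then show ?thesis unfolding W_def by (simp add: one)
qed

theorem even_value:
  assumes g: "g \<in> G" "sg g = 1"
  shows "\<chi> g = of_real (W (supp g))"
proof (cases "supp g = {}")
  case True
  then show ?thesis using supp_empty[OF True] W_empty one by simp
next
  case False
  define A where "A = supp g"
  obtain \<psi> where \<psi>: "pos_def G \<psi>" "\<And>h. h \<in> G \<Longrightarrow> supp h = A \<Longrightarrow> \<psi> h = \<chi> h" "\<psi> id = of_real (W A)"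
    using exists_compression[OF g(1)] unfolding A_def by metis
  obtain k0 where k0: "\<forall>j\<ge>k0. g \<in> stage (level n j) \<and> sg g = of_int (sign (restr (level n j) g))"
    using sg_eventually[OF g(1)] ..
  \<comment> \<open>One moved residue at stage \<open>k0\<close> becomes at least six at stage
    \<open>k\<close>, enough for the conjugation argument and for generating the even permutations
    from disjoint pairs.\<close>
  obtain k where k: "k \<ge> k0" "level n k = level n k0 * (level n k div level n k0)"
      "level n k div level n k0 \<ge> 6"
    using level_quotient_ge by blast
  let ?N = "level n k" and ?L = "level n k0"
  have gk: "g \<in> stage ?N" and "complex_of_int (sign (restr ?N g)) = 1"
    using k0[rule_format, OF k(1)] g(2) by simp_all
  then have sgk: "sign (restr ?N g) = 1" by (simp only: of_int_eq_1_iff)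
  have per: "x \<in> A \<longleftrightarrow> x mod ?N \<in> A" for x unfolding A_def by (rule supp_stage[OF gk])
  let ?A0 = "A \<inter> {..<?N}"
  have ge6: "card ?A0 \<ge> 6"
  proof -
    have g0: "g \<in> stage ?L" using k0 by simp
    have dv: "?L dvd ?N" by (rule dvd[OF k(1)])
    obtain x where x: "x \<in> A" using False by (auto simp: A_def)
    then have "x mod ?L \<in> A \<inter> {..<?L}" using supp_stage[OF g0, of x] pos[of k0] by (simp add: A_def)
    then have "card (A \<inter> {..<?L}) \<ge> 1" by (metis One_nat_def Suc_leI card_gt_0_iff empty_iff finite_Int finite_lessThan)
    moreover have "?A0 = {x \<in> {..<?N}. x mod ?L \<in> A \<inter> {..<?L}}"
      using supp_stage[OF g0] pos[of k0] by (auto simp: A_def)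
    then have "card ?A0 = card (A \<inter> {..<?L}) * (?N div ?L)"
      using card_periodic[OF pos dv, of "A \<inter> {..<?L}"] by simp
    ultimately show ?thesis using k(3) mult_le_mono[of 1 "card (A \<inter> {..<?L})" 6 "?N div ?L"] by simp
  qed
  define P where "P s \<longleftrightarrow> \<psi> (periodic ?N s) = \<psi> id" for s
  have sub: "s permutes {..<?N}" if "s permutes ?A0" for s
    by (rule permutes_subset[OF that]) auto
  have extG: "periodic ?N s \<in> G" if "s permutes ?A0" for s
    by (rule stage_G, rule periodic_stage[OF pos sub[OF that]])
  have "P (restr ?N g)"
  proof (rule evenperm_generated[of ?A0 P])
    show "P id" by (simp add: P_def periodic_id)
    show "P (s \<circ> t)" if "s permutes ?A0" "t permutes ?A0" "P s" "P t" for s t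
      using that G.pos_def_kernel[OF \<psi>(1) extG extG, of s t]
      by (simp add: P_def periodic_comp[OF pos sub])
    show "P (transpose a b \<circ> transpose c d)"
      if m: "{a, b, c, d} \<subseteq> ?A0" and dist: "distinct [a, b, c, d]" for a b c d
    proof -
      let ?D = "periodic ?N (transpose a b \<circ> transpose c d)"
      have DG: "?D \<in> G" by (rule extG, intro permutes_compose permutes_swap_id) (use m in auto)
      \<comment> \<open>Passing to the supremum over \<open>g1\<close> turns the bound into
        \<open>Re (\<psi> ?D) \<ge> W A\<close>. That is the largest modulus \<psi> can have, so
        \<open>?D\<close> lies in its kernel.\<close>
      have "W A \<le> (Re (\<psi> ?D) + 3 * W A) / 4"
        unfolding W_def
      proof (rule cSup_least)
        show "(\<lambda>g. cmod (\<chi> g)) ` {g \<in> G. supp g = A} \<noteq> {}" using g(1) by (auto simp: A_def)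
        fix x assume "x \<in> (\<lambda>g. cmod (\<chi> g)) ` {g \<in> G. supp g = A}"
        then obtain g1 where g1: "g1 \<in> G" "supp g1 = A" "x = cmod (\<chi> g1)" by blast
        have "Re (\<psi> ?D) \<ge> 4 * cmod (\<chi> g1) - 3 * Re (\<psi> id)"
          by (rule double_transposition_bound[OF \<psi>(1,2) g1(1,2) per ge6]) (use m dist in auto)
        then show "x \<le> (Re (\<psi> ?D) + 3 * Sup ((\<lambda>g. cmod (\<chi> g)) ` {g \<in> G. supp g = A})) / 4"
          using g1(3) \<psi>(3) by (simp add: W_def)
      qed
      then have ge: "Re (\<psi> ?D) \<ge> Re (\<psi> id)" using \<psi>(3) by simp
      have le: "cmod (\<psi> ?D) \<le> Re (\<psi> id)" by (rule G.pos_def_norm_le[OF \<psi>(1) DG])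
      then have "Re (\<psi> ?D) = Re (\<psi> id)" using ge complex_Re_le_cmod[of "\<psi> ?D"] by linarith
      moreover have "Im (\<psi> ?D) = 0"
      proof -
        have "cmod (\<psi> ?D) = Re (\<psi> ?D)"
          using ge le complex_Re_le_cmod[of "\<psi> ?D"] by linarith
        then show ?thesis using cmod_power2[of "\<psi> ?D"] by simp
      qed
      ultimately show ?thesis using \<psi>(3) by (simp add: P_def complex_eq_iff)
    qed
    show "restr ?N g permutes ?A0" unfolding A_def by (rule restr_permutes_supp[OF gk])
    show "evenperm (restr ?N g)" using sgk by (simp add: sign_def split: if_splits)
  qed (use ge6 in auto)
  then have "\<psi> g = \<psi> id" by (simp add: P_def periodic_restr[OF pos gk])
  then show ?thesis using \<psi>(2)[OF g(1)] \<psi>(3) by (simp add: A_def)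
qed

end

context fibred
begin

text \<open>All free elements are conjugate and the product of two of them can be free, so the common
  sign is its own square.\<close>

lemma free_even:
  assumes u: "free u"
  shows "sg (T u) = 1"
proof -
  have same: "sg (T u) = sg (T (\<lambda>_. v0))" if "free u" for u
  proof -
    have "T (\<lambda>_. v0) \<in> G" by (rule T_G) (rule v0)
    then show ?thesis using free_conj[OF that] sg_conj by metis
  qed
  have "card {id, iv v0} \<le> 2" by (simp add: card_insert_if)
  then have "card (V - {id, iv v0}) \<ge> 1"
    using V3 diff_card_le_card_Diff[of "{id, iv v0}" V] by simp
  then have "V - {id, iv v0} \<noteq> {}" by (metis card.empty not_one_le_zero)
  then obtain v where v: "v \<in> V" "v \<noteq> id" "v \<noteq> iv v0" by blast
  have "v0 \<circ> v \<noteq> id"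
  proof
    assume "v0 \<circ> v = id"
    then have "iv v0 \<circ> (v0 \<circ> v) = iv v0" by simp
    then show False using v v0(1) by (simp add: V.group_simps)
  qed
  then have fr: "free (\<lambda>_. v0)" "free (\<lambda>_. v)" "free (\<lambda>_. v0 \<circ> v)"
    using v v0 Vcomp by (auto simp: free_def)
  have "T (\<lambda>_. v0) \<in> G" "T (\<lambda>_. v) \<in> G" by (rule T_G, use v v0 in auto)+
  then have "sg (T (\<lambda>_. v0 \<circ> v)) = sg (T (\<lambda>_. v0)) * sg (T (\<lambda>_. v))"
    using sg_comp by (simp flip: twist_comp[OF Npos])
  then have "sg (T (\<lambda>_. v0)) = 1"
    using same[OF fr(2)] same[OF fr(3)] sg_cases[OF \<open>T (\<lambda>_. v0) \<in> G\<close>] by auto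
  then show ?thesis using same[OF u] by simp
qed

lemma free_W: "free u \<Longrightarrow> \<chi> (T u) = of_real (W {x. x mod N \<in> A})"
  using even_value[OF T_G free_even] free_supp by (simp add: free_def)

end

context limit_char
begin

text \<open>Apply the compression belonging to \<open>B\<close> to an element twisting only
  \<open>D\<close>. The averaged products are mostly free over \<open>B \<union> D\<close>, so the
  result is near the value for \<open>B \<union> D\<close>; positivity bounds it by the value at the
  identity, which is near the value for \<open>B\<close>. Each comparison costs
  \<open>2 * \<epsilon>\<close>.\<close>

lemma W_antimono:
  assumes BD: "B \<inter> D = {}" "B \<union> D \<subseteq> {..<level n i}"
  shows "W {x. x mod level n i \<in> B \<union> D} \<le> W {x. x mod level n i \<in> B}"
proof (rule field_le_epsilon)
  fix e :: real assume e: "e > 0"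
  obtain K :: nat where K: "real K > 4 * real (card B) / e" using reals_Archimedean2 by blast
  have "B \<union> D \<subseteq> {..<level n i}" by (rule BD(2))
  then obtain j Q V where FA: "fibred n \<chi> i j Q V (B \<union> D)" and V: "card V > K"
    by (rule exists_fibred)
  interpret A: fibred n \<chi> i j Q V "B \<union> D" by (rule FA)
  interpret B: fibred n \<chi> i j Q V B
    by unfold_locales (use A.lev A.Vg A.V3 BD in auto)
  let ?WA = "complex_of_real (W {x. x mod level n i \<in> B \<union> D})"
  let ?WB = "complex_of_real (W {x. x mod level n i \<in> B})"
  let ?x = "twist (level n i) D (\<lambda>_. A.v0)"
  have "twist (level n i) D (\<lambda>_. A.v0) \<in> stage (level n i * Q)"
    by (rule twist_stage[OF A.Npos A.Qpos]) (rule A.VQ[OF A.v0(1)])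
  then have xG: "?x \<in> G" using A.lev stage_G by metis
  have frA: "A.free (\<lambda>_. A.v0)" and frB: "B.free (\<lambda>_. B.v0)"
    using A.v0 B.v0 by (simp_all add: A.free_def B.free_def)
  have WA1: "cmod ?WA \<le> 1"
    using norm_le[OF A.T_G, of "\<lambda>_. A.v0"] A.free_W[OF frA] A.v0 by simp
  have "cmod (avg B.K (\<lambda>v. \<chi> (B.T u \<circ> ?x \<circ> iv (B.T v))) - ?WA) \<le> 2 * B.\<epsilon>" if u: "u \<in> B.K" for u
  proof (rule avg_PiE_near[OF B.finA B.finV B.Vne _ WA1])
    fix v assume v: "v \<in> B.K"
    show "cmod (\<chi> (B.T u \<circ> ?x \<circ> iv (B.T v))) \<le> 1"
      by (intro norm_le G.comp_mem G.inv_mem B.T_G xG) (use u v in auto)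
    assume ne: "\<And>a. a \<in> B \<Longrightarrow> v a \<noteq> u a"
    have "iv (B.T v) = B.T (\<lambda>a. iv (v a))" by (rule B.T_inv) (use v in auto)
    then have "B.T u \<circ> ?x \<circ> iv (B.T v) = A.T (\<lambda>a. if a \<in> B then u a \<circ> iv (v a) else A.v0)"
      using twist_sandwich[OF A.Npos BD(1)] by simp
    moreover have "A.free (\<lambda>a. if a \<in> B then u a \<circ> iv (v a) else A.v0)"
    proof -
      have "u a \<circ> iv (v a) \<in> V \<and> u a \<circ> iv (v a) \<noteq> id" if a: "a \<in> B" for a
      proof
        have V: "u a \<in> V" "v a \<in> V" using B.KV u v a by auto
        then show "u a \<circ> iv (v a) \<in> V" by (simp add: A.V.group_simps)
        show "u a \<circ> iv (v a) \<noteq> id"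
        proof
          assume "u a \<circ> iv (v a) = id"
          then have "u a \<circ> iv (v a) \<circ> v a = v a" by simp
          then show False using V ne[OF a] by (simp add: A.V.group_simps)
        qed
      qed
      then show ?thesis using A.v0 by (simp add: A.free_def)
    qed
    ultimately show "\<chi> (B.T u \<circ> ?x \<circ> iv (B.T v)) = ?WA" using A.free_W by simp
  qed simp
  then have "cmod (B.\<psi> ?x - ?WA) \<le> 2 * B.\<epsilon>"
    unfolding B.\<psi>_def by (rule avg_near_const[OF B.finK B.Kne])
  moreover have "cmod (B.\<psi> ?x) \<le> Re (B.\<psi> id)" by (rule G.pos_def_norm_le[OF B.\<psi>_pos_def xG])
  moreover have "cmod (B.\<psi> id - ?WB) \<le> 2 * B.\<epsilon>"
    using B.\<psi>_id B.free_W[OF frB] by (simp add: B.w_def)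
  ultimately have "Re ?WA \<le> Re ?WB + 4 * B.\<epsilon>"
    using abs_Re_le_cmod[of "B.\<psi> ?x - ?WA"] abs_Re_le_cmod[of "B.\<psi> id - ?WB"]
      complex_Re_le_cmod[of "B.\<psi> ?x"] by simp
  moreover have "4 * B.\<epsilon> \<le> e"
  proof -
    have "real (card V) > 4 * real (card B) / e" using K V by (smt (verit) of_nat_less_iff)
    then have "4 * real (card B) < e * real (card V)"
      using e by (simp add: pos_divide_less_eq mult.commute)
    then show ?thesis using V by (simp add: divide_le_eq)
  qed
  ultimately show "W {x. x mod level n i \<in> B \<union> D} \<le> W {x. x mod level n i \<in> B} + e" by simp
qed

text \<open>Within the stage, \<open>h\<close> can be conjugated so that its support lies inside
  that of \<open>g\<close>. As \<chi> depends only on the support of an even element,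
  \<open>W_antimono\<close> compares the two.\<close>

lemma even_mono:
  assumes gh: "g \<in> stage (level n i)" "h \<in> stage (level n i)" "sg g = 1" "sg h = 1"
    and le: "card (supp h \<inter> {..<level n i}) \<le> card (supp g \<inter> {..<level n i})"
  shows "Re (\<chi> g) \<le> Re (\<chi> h)"
proof -
  let ?N = "level n i"
  let ?a = "supp g \<inter> {..<?N}" and ?b = "supp h \<inter> {..<?N}"
  obtain b' where b': "b' \<subseteq> ?a" "card b' = card ?b"
    using obtain_subset_with_card_n[OF le] by metis
  then have "finite b'" using finite_subset by blast
  then obtain f where f: "bij_betw f ?b b'"
    using finite_same_card_bij[of ?b b'] b'(2) by auto
  obtain c where c: "c permutes {..<?N}" "\<And>x. x \<in> ?b \<Longrightarrow> c x = f x"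
    using permutes_extension[of "{..<?N}" ?b b' f] b'(1) f by auto
  define C where "C = periodic ?N c"
  have C: "C \<in> stage ?N" unfolding C_def by (rule periodic_stage[OF pos c(1)])
  have hG: "h \<in> G" "C \<in> G" "g \<in> G" using gh C stage_G by blast+
  let ?h = "C \<circ> h \<circ> iv C"
  have cb: "c ` ?b = b'" using c(2) f by (simp add: bij_betw_def)
  have supp: "supp ?h = {x. x mod ?N \<in> b'}"
  proof -
    have hb: "?h \<in> stage ?N"
      using gh C by (simp add: perm_group.group_simps[OF stage_group[OF pos]])
    have "supp ?h \<inter> {..<?N} = b'"
    proof -
      have "supp ?h = C ` supp h" by (rule supp_conj[OF stage_bij[OF C]])
      moreover have "C ` supp h \<inter> {..<?N} = c ` ?b"
      proof
        show "C ` supp h \<inter> {..<?N} \<subseteq> c ` ?b"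
        proof
          fix y assume y: "y \<in> C ` supp h \<inter> {..<?N}"
          then obtain x where x: "x \<in> supp h" "y = C x" by blast
          have "x < ?N" using stage_div[OF C, of x] x y pos[of i] by (simp add: div_eq_0_iff)
          then show "y \<in> c ` ?b" using x by (simp add: C_def periodic_less)
        qed
        show "c ` ?b \<subseteq> C ` supp h \<inter> {..<?N}"
          using permutes_less[OF c(1)] by (auto simp: C_def periodic_less image_iff) (metis periodic_less)
      qed
      ultimately show ?thesis using cb by simp
    qed
    then show ?thesis using supp_mod[OF pos hb] by simp
  qed
  have "\<chi> ?h = \<chi> h" by (rule conj_inv) (use hG in auto)
  moreover have "\<chi> ?h = of_real (W {x. x mod ?N \<in> b'})"
    using even_value[of ?h] supp sg_conj[OF hG(1,2)] gh(4) hG by (simp add: G.group_simps)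
  ultimately have 1: "Re (\<chi> h) = W {x. x mod ?N \<in> b'}" by (metis Re_complex_of_real)
  have "supp g = {x. x mod ?N \<in> b' \<union> (?a - b')}"
    using supp_mod[OF pos gh(1)] b'(1) by (metis Un_Diff_cancel sup.absorb2)
  then have 2: "Re (\<chi> g) = W {x. x mod ?N \<in> b' \<union> (?a - b')}"
    using even_value[OF hG(3) gh(3)] by simp
  show ?thesis unfolding 1 2 by (rule W_antimono) (use b' in auto)
qed

end

section \<open>Asymptotic multiplicativity\<close>

text \<open>Indecomposability in the form in which it is applied: \<chi> spans an extreme ray of the
  cone of central positive-definite functions.\<close>

locale extremal_char = limit_char +
  assumes extremal: "\<And>f1 f2. pos_def G f1 \<Longrightarrow> pos_def G f2 \<Longrightarrow>
    (\<And>g h. g \<in> G \<Longrightarrow> h \<in> G \<Longrightarrow> f1 (g \<circ> h) = f1 (h \<circ> g)) \<Longrightarrow>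
    (\<And>g h. g \<in> G \<Longrightarrow> h \<in> G \<Longrightarrow> f2 (g \<circ> h) = f2 (h \<circ> g)) \<Longrightarrow>
    (\<And>g. g \<in> G \<Longrightarrow> \<chi> g = f1 g + f2 g) \<Longrightarrow> \<exists>c. \<forall>g\<in>G. f1 g = c * \<chi> g"
begin

text \<open>The limit \<open>\<phi> t\<close> of the compressions of \<open>\<chi>\<close> by \<open>(1 + t h k) / 2\<close> is central, and
  \<open>\<phi> t + \<phi> (- t) = \<chi>\<close>; hence each \<open>\<phi> t\<close> is proportional to \<open>\<chi>\<close>, and \<open>\<omega>\<close> is a combination of
  \<open>\<phi> 1\<close> and \<open>\<phi> \<i>\<close>.\<close>

lemma asymptotically_central_limit:
  assumes h: "\<And>k. h k \<in> G"
    and comm: "\<And>g. g \<in> G \<Longrightarrow> (\<lambda>k. \<chi> (g \<circ> h k \<circ> iv g \<circ> iv (h k))) \<longlonglongrightarrow> 1"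
    and lim: "\<And>g. g \<in> G \<Longrightarrow> (\<lambda>k. \<chi> (g \<circ> h k)) \<longlonglongrightarrow> \<omega> g"
    and g: "g \<in> G"
  shows "\<omega> g = \<omega> id * \<chi> g"
proof -
  have \<omega>_central: "\<omega> (a \<circ> b) = \<omega> (b \<circ> a)" if ab: "a \<in> G" "b \<in> G" for a b
  proof -
    have "(\<lambda>k. (cmod (\<chi> (a \<circ> b \<circ> h k) - \<chi> (b \<circ> a \<circ> h k)))\<^sup>2) \<longlonglongrightarrow> 0"
    proof (rule Lim_null_comparison)
      show "\<forall>\<^sub>F k in sequentially. norm ((cmod (\<chi> (a \<circ> b \<circ> h k) - \<chi> (b \<circ> a \<circ> h k)))\<^sup>2) \<le>
          2 * (1 - Re (\<chi> (b \<circ> h k \<circ> iv b \<circ> iv (h k))))"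
      proof (rule always_eventually, rule allI)
        fix k
        \<comment> \<open>Centrality rewrites the second argument so that the quotient of the two is
          a conjugate of the commutator of \<open>b\<close> and \<open>h k\<close>; then Krein's
          inequality applies.\<close>
        have 1: "\<chi> (b \<circ> a \<circ> h k) = \<chi> (a \<circ> h k \<circ> b)"
          using central[of b "a \<circ> h k"] ab h by (simp add: G.group_simps)
        have "a \<circ> b \<circ> h k \<circ> iv (a \<circ> h k \<circ> b) = a \<circ> (b \<circ> h k \<circ> iv b \<circ> iv (h k)) \<circ> iv a"
          using ab h by (simp add: G.group_simps)
        then have 2: "\<chi> (a \<circ> b \<circ> h k \<circ> iv (a \<circ> h k \<circ> b)) = \<chi> (b \<circ> h k \<circ> iv b \<circ> iv (h k))"
          using conj_inv[OF ab(1), of "b \<circ> h k \<circ> iv b \<circ> iv (h k)"] ab h by (simp add: G.group_simps)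
        have "a \<circ> b \<circ> h k \<in> G" "a \<circ> h k \<circ> b \<in> G" using ab h by (simp_all add: G.comp_mem)
        from G.pos_def_diff_le[OF pd this] show "norm ((cmod (\<chi> (a \<circ> b \<circ> h k) - \<chi> (b \<circ> a \<circ> h k)))\<^sup>2) \<le>
            2 * (1 - Re (\<chi> (b \<circ> h k \<circ> iv b \<circ> iv (h k))))"
          unfolding 1 2 one by simp
      qed
      have "(\<lambda>k. 2 * (1 - Re (\<chi> (b \<circ> h k \<circ> iv b \<circ> iv (h k))))) \<longlonglongrightarrow> 2 * (1 - Re 1)"
        by (intro tendsto_intros comm ab)
      then show "(\<lambda>k. 2 * (1 - Re (\<chi> (b \<circ> h k \<circ> iv b \<circ> iv (h k))))) \<longlonglongrightarrow> 0" by simp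
    qed
    moreover have "(\<lambda>k. (cmod (\<chi> (a \<circ> b \<circ> h k) - \<chi> (b \<circ> a \<circ> h k)))\<^sup>2) \<longlonglongrightarrow>
        (cmod (\<omega> (a \<circ> b) - \<omega> (b \<circ> a)))\<^sup>2"
      by (intro tendsto_intros lim G.comp_mem ab)
    ultimately have "(cmod (\<omega> (a \<circ> b) - \<omega> (b \<circ> a)))\<^sup>2 = 0" by (rule LIMSEQ_unique[rotated])
    then show ?thesis by simp
  qed
  define \<phi> where "\<phi> t x = (2 * \<chi> x + t * \<omega> x + cnj t * cnj (\<omega> (iv x))) / 4" for t x
  have \<phi>_pos_def: "pos_def G (\<phi> t)" if t: "cmod t = 1" for t
  proof (rule G.pos_def_limit)
    let ?e = "\<lambda>u. if u then t / 2 else 1 / 2"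
    let ?f = "\<lambda>k x. \<Sum>u\<in>UNIV. \<Sum>v\<in>UNIV. ?e u * cnj (?e v) *
        \<chi> ((if u then h k else id) \<circ> x \<circ> iv (if v then h k else id))"
    show "pos_def G (?f k)" for k
      by (rule G.pos_def_compress[OF pd]) (use h G.id_mem in auto)
    fix x assume x: "x \<in> G"
    have feq: "?f k x = (2 * \<chi> x + t * \<chi> (x \<circ> h k) + cnj t * cnj (\<chi> (iv x \<circ> h k))) / 4" for k
    proof -
      have tt: "t * cnj t = 1" using complex_norm_square[of t] t by simp
      have 1: "\<chi> (h k \<circ> x) = \<chi> (x \<circ> h k)" by (rule central[OF h x])
      have 2: "\<chi> (h k \<circ> x \<circ> iv (h k)) = \<chi> x" by (rule conj_inv[OF h x])
      have "\<chi> (iv x \<circ> h k) = \<chi> (h k \<circ> iv x)" by (rule central[OF G.inv_mem[OF x] h])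
      then have 3: "\<chi> (x \<circ> iv (h k)) = cnj (\<chi> (iv x \<circ> h k))"
        using pos_def_inv[OF pd, of "h k \<circ> iv x"] h[of k] x by (simp add: G.group_simps)
      have "?f k x = (\<chi> x + cnj t * \<chi> (x \<circ> iv (h k)) + t * \<chi> (h k \<circ> x) +
          t * cnj t * \<chi> (h k \<circ> x \<circ> iv (h k))) / 4"
        by (simp add: UNIV_bool field_simps)
      then show ?thesis unfolding 1 2 3 tt by simp
    qed
    have "(\<lambda>k. (2 * \<chi> x + t * \<chi> (x \<circ> h k) + cnj t * cnj (\<chi> (iv x \<circ> h k))) / 4)
        \<longlonglongrightarrow> \<phi> t x"
      unfolding \<phi>_def by (intro tendsto_intros lim x G.inv_mem) auto
    then show "(\<lambda>k. ?f k x) \<longlonglongrightarrow> \<phi> t x" by (simp only: feq)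
  qed
  have \<phi>_central: "\<phi> t (a \<circ> b) = \<phi> t (b \<circ> a)" if "a \<in> G" "b \<in> G" for t a b
    using that \<omega>_central[OF that] \<omega>_central[of "iv b" "iv a"] central[OF that]
    by (simp add: \<phi>_def G.group_simps)
  have \<phi>_prop: "\<exists>c. \<forall>g\<in>G. \<phi> t g = c * \<chi> g" if t: "cmod t = 1" for t
  proof (rule extremal)
    show "pos_def G (\<phi> t)" "pos_def G (\<phi> (- t))" using t by (simp_all add: \<phi>_pos_def)
    show "\<chi> g = \<phi> t g + \<phi> (- t) g" for g by (simp add: \<phi>_def field_simps)
  qed (rule \<phi>_central, assumption+)+
  obtain c where c: "\<forall>g\<in>G. \<phi> 1 g = c * \<chi> g" using \<phi>_prop[of 1] by auto
  obtain d where d: "\<forall>g\<in>G. \<phi> \<i> g = d * \<chi> g" using \<phi>_prop[of \<i>] by auto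
  have "\<omega> x = ((2 * c - 1) - \<i> * (2 * d - 1)) * \<chi> x" if x: "x \<in> G" for x
  proof -
    have "\<omega> x = 2 * \<phi> 1 x - 2 * \<i> * \<phi> \<i> x - \<chi> x + \<i> * \<chi> x"
      by (simp add: \<phi>_def field_simps)
    then show ?thesis using c d x by (simp add: algebra_simps)
  qed
  from this[OF g] this[OF G.id_mem] show ?thesis by (simp add: one)
qed

text \<open>In a factor, weak limits of asymptotically central sequences are scalars; this is the
  corresponding statement for \<chi>. A subsequence violating the claim is refined until the limits
  \<omega> exist on the whole group, and \<open>asymptotically_central_limit\<close> contradicts the
  violation.\<close>

theorem asymptotic_multiplicativity:
  assumes h: "\<And>k. h k \<in> G"
    and comm: "\<And>g. g \<in> G \<Longrightarrow> (\<lambda>k. \<chi> (g \<circ> h k \<circ> iv g \<circ> iv (h k))) \<longlonglongrightarrow> 1"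
    and g: "g \<in> G"
  shows "(\<lambda>k. \<chi> (g \<circ> h k) - \<chi> g * \<chi> (h k)) \<longlonglongrightarrow> 0"
proof (rule ccontr)
  let ?X = "\<lambda>k. \<chi> (g \<circ> h k) - \<chi> g * \<chi> (h k)"
  assume "\<not> ?X \<longlonglongrightarrow> 0"
  then obtain e where e: "e > 0" "\<And>m. \<exists>k\<ge>m. cmod (?X k) \<ge> e"
    unfolding LIMSEQ_def by (auto simp: not_less)
  have "infinite {k. cmod (?X k) \<ge> e}"
    unfolding infinite_nat_iff_unbounded_le using e(2) by blast
  then obtain r :: "nat \<Rightarrow> nat" where r: "strict_mono r" "\<And>k. cmod (?X (r k)) \<ge> e"
    using infinite_enumerate by blast
  have "cmod (\<chi> (x \<circ> h (r k))) \<le> 1" if "x \<in> G" for x k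
    using that h by (intro norm_le G.comp_mem)
  then obtain q :: "nat \<Rightarrow> nat" where q: "strict_mono q"
      "\<And>x. x \<in> G \<Longrightarrow> \<exists>l. (\<lambda>k. \<chi> (x \<circ> h (r (q k)))) \<longlonglongrightarrow> l"
    using function_convergent_subsequence[OF countable_G, of "\<lambda>k x. \<chi> (x \<circ> h (r k))"] by blast
  define \<omega> where "\<omega> x = lim (\<lambda>k. \<chi> (x \<circ> h (r (q k))))" for x
  have lim: "(\<lambda>k. \<chi> (x \<circ> h (r (q k)))) \<longlonglongrightarrow> \<omega> x" if "x \<in> G" for x
    unfolding \<omega>_def using q(2)[OF that] limI by metis
  have rq: "strict_mono (r \<circ> q)" using r(1) q(1) by (rule strict_mono_o)
  have "\<omega> g = \<omega> id * \<chi> g"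
  proof (rule asymptotically_central_limit[where h = "\<lambda>k. h (r (q k))", OF h _ lim g])
    fix x assume "x \<in> G"
    from LIMSEQ_subseq_LIMSEQ[OF comm[OF this] rq]
    show "(\<lambda>k. \<chi> (x \<circ> h (r (q k)) \<circ> iv x \<circ> iv (h (r (q k))))) \<longlonglongrightarrow> 1" by (simp add: o_def)
  qed
  moreover have "(\<lambda>k. ?X (r (q k))) \<longlonglongrightarrow> \<omega> g - \<chi> g * \<omega> id"
    using lim[OF G.id_mem] by (intro tendsto_intros lim g) simp
  ultimately have "(\<lambda>k. ?X (r (q k))) \<longlonglongrightarrow> 0" by (simp add: mult.commute)
  then obtain k where "cmod (?X (r (q k))) < e"
    using e(1) unfolding LIMSEQ_def by (auto simp: dist_norm)
  then show False using r(2)[of "q k"] by simp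
qed

end

section \<open>Powers and their differences\<close>

text \<open>Cauchy's equation in logarithmic coordinates:
  \<open>L t = - ln (\<Phi> (exp (- t)))\<close> is additive and monotone on the nonnegative reals,
  hence linear.\<close>

lemma monotone_multiplicative_powr:
  fixes \<Phi> :: "real \<Rightarrow> real"
  assumes mono: "\<And>x y. 0 < x \<Longrightarrow> x \<le> y \<Longrightarrow> y \<le> 1 \<Longrightarrow> \<Phi> x \<le> \<Phi> y"
    and mult: "\<And>x y. 0 < x \<Longrightarrow> x \<le> 1 \<Longrightarrow> 0 < y \<Longrightarrow> y \<le> 1 \<Longrightarrow> \<Phi> (x * y) = \<Phi> x * \<Phi> y"
    and pos: "\<And>x. 0 < x \<Longrightarrow> x \<le> 1 \<Longrightarrow> 0 < \<Phi> x"
  shows "\<exists>s\<ge>0. \<forall>x. 0 < x \<longrightarrow> x \<le> 1 \<longrightarrow> \<Phi> x = x powr s"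
proof -
  define L where "L t = - ln (\<Phi> (exp (- t)))" for t
  have e: "0 < exp (- t)" "exp (- t) \<le> 1" if "t \<ge> 0" for t :: real using that by simp_all
  have add: "L (a + b) = L a + L b" if "a \<ge> 0" "b \<ge> 0" for a b
  proof -
    have "\<Phi> (exp (- (a + b))) = \<Phi> (exp (- a)) * \<Phi> (exp (- b))"
      using mult[OF e[OF that(1)] e[OF that(2)]] by (simp add: exp_add[symmetric])
    then show ?thesis
      using pos[OF e[OF that(1)]] pos[OF e[OF that(2)]] by (simp add: L_def ln_mult)
  qed
  have Lmono: "L a \<le> L b" if "0 \<le> a" "a \<le> b" for a b
  proof -
    have "\<Phi> (exp (- b)) \<le> \<Phi> (exp (- a))" using that by (intro mono) simp_all
    then show ?thesis using pos[OF e, of b] pos[OF e, of a] that by (simp add: L_def)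
  qed
  have L0: "L 0 = 0" using add[of 0 0] by simp
  have mul: "L (real k * a) = real k * L a" if "a \<ge> 0" for k a
  proof (induction k)
    case (Suc k)
    then show ?case using add[of a "real k * a"] that by (simp add: algebra_simps)
  qed (simp add: L0)
  define s where "s = L 1"
  have s0: "s \<ge> 0" using Lmono[of 0 1] L0 by (simp add: s_def)
  have lin: "L t = t * s" if t: "t \<ge> 0" for t
  proof (rule ccontr)
    assume "L t \<noteq> t * s"
    then have d: "\<bar>L t - t * s\<bar> > 0" by simp
    \<comment> \<open>A deviation from linearity grows by the factor \<open>k\<close>. But
      \<open>real k * t\<close> lies between consecutive integers, and there \<open>L\<close> and
      the linear function differ by at most \<open>s\<close>.\<close>
    obtain k :: nat where k: "real k > (s + 1) / \<bar>L t - t * s\<bar>" using reals_Archimedean2 by blast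
    have "(s + 1) / \<bar>L t - t * s\<bar> > 0" using d s0 by simp
    then have k0: "real k > 0" using k by linarith
    define m where "m = nat \<lfloor>real k * t\<rfloor>"
    have m: "real m \<le> real k * t" "real k * t \<le> real (Suc m)"
      using t by (simp_all add: m_def of_nat_nat) linarith+
    have "real m * s \<le> real k * L t"
      using Lmono[of "real m" "real k * t"] m mul[of 1 m] mul[OF t, of k] by (simp add: s_def)
    moreover have "real k * L t \<le> real (Suc m) * s"
      using Lmono[of "real k * t" "real (Suc m)"] m mul[of 1 "Suc m"] mul[OF t, of k] t
      by (simp add: s_def)
    moreover have "real m * s \<le> real k * t * s" "real k * t * s \<le> real (Suc m) * s"
      using m s0 by (intro mult_right_mono; simp)+
    moreover have "real (Suc m) * s = real m * s + s" by (simp add: algebra_simps)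
    ultimately have "\<bar>real k * L t - real k * t * s\<bar> \<le> s" by linarith
    moreover have "real k * L t - real k * t * s = real k * (L t - t * s)" by (simp add: algebra_simps)
    ultimately have "real k * \<bar>L t - t * s\<bar> \<le> s" using k0 by (simp add: abs_mult)
    moreover have "s + 1 < real k * \<bar>L t - t * s\<bar>" using k d by (simp add: divide_less_eq)
    ultimately show False by linarith
  qed
  have "\<Phi> x = x powr s" if x: "0 < x" "x \<le> 1" for x
  proof -
    have "L (- ln x) = - ln x * s" using x by (intro lin) simp
    then have "ln (\<Phi> x) = s * ln x" using x by (simp add: L_def mult.commute)
    then show ?thesis using pos[OF x] x by (metis exp_ln powr_def less_irrefl)
  qed
  then show ?thesis using s0 by blast
qed

primrec backward_diff :: "real \<Rightarrow> nat \<Rightarrow> (real \<Rightarrow> real) \<Rightarrow> real \<Rightarrow> real"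
  where "backward_diff d 0 f x = f x"
  | "backward_diff d (Suc r) f x = backward_diff d r f x - backward_diff d r f (x - d)"

lemma backward_diff_powr_derivative:
  assumes "d \<ge> 0" "x > real r * d"
  shows "(backward_diff d r (\<lambda>x. x powr s) has_real_derivative s * backward_diff d r (\<lambda>x. x powr (s - 1)) x) (at x)"
  using assms(2)
proof (induction r arbitrary: x)
  case 0
  then have "((\<lambda>x. x powr s) has_real_derivative s * x powr (s - 1)) (at x)"
    by (intro has_real_derivative_powr) simp
  moreover have "backward_diff d 0 (\<lambda>x. x powr s) = (\<lambda>x. x powr s)" by auto
  ultimately show ?case by simp
next
  case (Suc r)
  have "x > real r * d" "x - d > real r * d" using Suc.prems assms(1) by (simp_all add: algebra_simps)
  note IH = Suc.IH[OF this(1)] Suc.IH[OF this(2)]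
  have "((\<lambda>x. backward_diff d r (\<lambda>x. x powr s) (x - d)) has_real_derivative
      s * backward_diff d r (\<lambda>x. x powr (s - 1)) (x - d)) (at x)"
    using DERIV_shift[of "backward_diff d r (\<lambda>x. x powr s)" _ x "- d"] IH(2) by simp
  from DERIV_diff[OF IH(1) this]
  have "((\<lambda>x. backward_diff d (Suc r) (\<lambda>x. x powr s) x) has_real_derivative
      s * backward_diff d (Suc r) (\<lambda>x. x powr (s - 1)) x) (at x)"
    by (simp add: algebra_simps)
  then show ?case by simp
qed

text \<open>One mean value step per order: differentiation lowers the exponent by one and
  contributes the factor \<open>s\<close>, and the induction continues with \<open>s - 1\<close> at
  the intermediate point.\<close>

lemma backward_diff_powr_eq:
  assumes "d > 0" "x > real r * d"
  shows "\<exists>\<xi>>0. backward_diff d r (\<lambda>x. x powr s) x = d ^ r * (\<Prod>i<r. s - real i) * \<xi> powr (s - real r)"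
  using assms(2)
proof (induction r arbitrary: x s)
  case 0
  then show ?case by auto
next
  case (Suc r)
  let ?f = "backward_diff d r (\<lambda>x. x powr s)"
  have "\<exists>z. x - d < z \<and> z < x \<and> ?f x - ?f (x - d) = (x - (x - d)) * (s * backward_diff d r (\<lambda>x. x powr (s - 1)) z)"
  proof (rule MVT2)
    show "x - d < x" using assms(1) by simp
    fix z assume "x - d \<le> z" "z \<le> x"
    then have "z > real r * d" using Suc.prems by (simp add: algebra_simps)
    then show "(?f has_real_derivative s * backward_diff d r (\<lambda>x. x powr (s - 1)) z) (at z)"
      using assms(1) by (intro backward_diff_powr_derivative) simp_all
  qed
  then obtain z where z: "x - d < z"
      "?f x - ?f (x - d) = d * (s * backward_diff d r (\<lambda>x. x powr (s - 1)) z)" by auto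
  have "z > real r * d" using Suc.prems z(1) by (simp add: algebra_simps)
  from Suc.IH[OF this, of "s - 1"] obtain \<xi> where \<xi>: "\<xi> > 0"
    "backward_diff d r (\<lambda>x. x powr (s - 1)) z = d ^ r * (\<Prod>i<r. s - 1 - real i) * \<xi> powr (s - 1 - real r)"
    by blast
  have "(\<Prod>i<Suc r. s - real i) = s * (\<Prod>i<r. s - 1 - real i)"
    by (simp only: prod.lessThan_Suc_shift) (simp add: algebra_simps)
  then have "backward_diff d (Suc r) (\<lambda>x. x powr s) x = d ^ Suc r * (\<Prod>i<Suc r. s - real i) * \<xi> powr (s - real (Suc r))"
    using z(2) \<xi>(2) by (simp del: prod.lessThan_Suc add: mult_ac diff_diff_eq)
  then show ?case using \<xi>(1) by blast
qed

text \<open>If \<open>s\<close> lies strictly between \<open>m\<close> and \<open>m + 1\<close>,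
  exactly one of the factors \<open>s - i\<close> with \<open>i < m + 2\<close> is negative, so the
  difference of order \<open>m + 2\<close> is negative.\<close>

lemma nonneg_differences_imp_nat:
  assumes s: "s \<ge> 0" and ge: "\<And>r. \<exists>d>0. real r * d < 1 \<and> backward_diff d r (\<lambda>x. x powr s) 1 \<ge> 0"
  shows "\<exists>m :: nat. s = real m"
proof (rule ccontr)
  assume nt: "\<not> ?thesis"
  define m where "m = nat \<lfloor>s\<rfloor>"
  have "real m \<le> s" using s by (simp add: m_def)
  moreover have "real m \<noteq> s" using nt by metis
  moreover have "s < real m + 1" using s by (simp add: m_def)
  ultimately have m: "real m < s" "s < real m + 1" by auto
  obtain d where d: "d > 0" "real (Suc (Suc m)) * d < 1" "backward_diff d (Suc (Suc m)) (\<lambda>x. x powr s) 1 \<ge> 0"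
    using ge by blast
  obtain \<xi> where \<xi>: "\<xi> > 0" "backward_diff d (Suc (Suc m)) (\<lambda>x. x powr s) 1 =
      d ^ Suc (Suc m) * (\<Prod>i<Suc (Suc m). s - real i) * \<xi> powr (s - real (Suc (Suc m)))"
    using backward_diff_powr_eq[OF d(1), of "Suc (Suc m)" 1 s] d(2) by auto
  have "(\<Prod>i<Suc m. s - real i) > 0" using m by (intro prod_pos) auto
  moreover have "s - real (Suc m) < 0" using m by simp
  ultimately have "(\<Prod>i<Suc (Suc m). s - real i) < 0"
    by (simp only: prod.lessThan_Suc[of _ "Suc m"]) (rule mult_pos_neg)
  moreover have "d ^ Suc (Suc m) > 0" "\<xi> powr (s - real (Suc (Suc m))) > 0" using d(1) \<xi>(1) by simp_all
  ultimately have "d ^ Suc (Suc m) * (\<Prod>i<Suc (Suc m). s - real i) * \<xi> powr (s - real (Suc (Suc m))) < 0"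
    by (intro mult_neg_pos mult_pos_neg)
  then show False using d(3) \<xi>(2) by linarith
qed

lemma sum_Pow_backward_diff: "(\<Sum>S\<in>Pow {..<r}. (- 1) ^ card S * f (x - real (card S) * d)) = backward_diff d r f x"
proof (induction r arbitrary: x)
  case 0
  then show ?case by (simp add: Pow_def)
next
  case (Suc r)
  let ?F = "\<lambda>x S. (- 1) ^ card S * f (x - real (card S) * d)"
  have P: "Pow {..<Suc r} = Pow {..<r} \<union> insert r ` Pow {..<r}"
    by (simp add: lessThan_Suc Pow_insert)
  have disj: "Pow {..<r} \<inter> insert r ` Pow {..<r} = {}" by auto
  have inj: "inj_on (insert r) (Pow {..<r})"
  proof (rule inj_onI)
    fix S T assume "S \<in> Pow {..<r}" "T \<in> Pow {..<r}" "insert r S = insert r T"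
    then show "S = T" by (metis Pow_iff insert_ident lessThan_iff less_irrefl subsetD)
  qed
  have "(\<Sum>S\<in>Pow {..<Suc r}. ?F x S) = (\<Sum>S\<in>Pow {..<r}. ?F x S) + (\<Sum>S\<in>Pow {..<r}. ?F x (insert r S))"
    unfolding P by (subst sum.union_disjoint[OF _ _ disj]) (simp_all add: sum.reindex[OF inj])
  also have "(\<Sum>S\<in>Pow {..<r}. ?F x (insert r S)) = (\<Sum>S\<in>Pow {..<r}. - ?F (x - d) S)"
  proof (intro sum.cong refl)
    fix S assume S: "S \<in> Pow {..<r}"
    then have "r \<notin> S" "finite S" using finite_subset by auto
    then show "?F x (insert r S) = - ?F (x - d) S" by (simp add: algebra_simps)
  qed
  finally show ?case by (simp add: Suc.IH sum_negf)
qed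

section \<open>The density of fixed points\<close>

lemma card_digits:
  fixes N Q :: nat
  assumes "N > 0"
  shows "card {x \<in> {..<N * Q}. P (x mod N) \<and> R (x div N)} =
    card {a \<in> {..<N}. P a} * card {y \<in> {..<Q}. R y}"
proof -
  have "bij_betw (\<lambda>x. (x mod N, x div N)) {x \<in> {..<N * Q}. P (x mod N) \<and> R (x div N)}
      ({a \<in> {..<N}. P a} \<times> {y \<in> {..<Q}. R y})"
  proof (rule bij_betw_byWitness[where f' = "\<lambda>(a, b). a + N * b"])
    have "a + N * b < N * Q" if "a < N" "b < Q" for a b
    proof -
      have "a + N * b < N * Suc b" using that by auto
      also have "\<dots> \<le> N * Q" using that by (intro mult_le_mono2) simp
      finally show ?thesis .
    qed
    then show "(\<lambda>(a, b). a + N * b) ` ({a \<in> {..<N}. P a} \<times> {y \<in> {..<Q}. R y}) \<subseteq>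
        {x \<in> {..<N * Q}. P (x mod N) \<and> R (x div N)}"
      using assms by auto
    show "(\<lambda>x. (x mod N, x div N)) ` {x \<in> {..<N * Q}. P (x mod N) \<and> R (x div N)} \<subseteq>
        {a \<in> {..<N}. P a} \<times> {y \<in> {..<Q}. R y}"
      using assms by (auto simp: less_mult_imp_div_less mult.commute)
  qed auto
  then show ?thesis by (simp add: bij_betw_same_card card_cartesian_product)
qed

context radix
begin

definition fix_ratio :: "(nat \<Rightarrow> nat) \<Rightarrow> real"
  where "fix_ratio g = Re (chi_nat n g)"

lemma chi_nat_stage:
  assumes "g \<in> stage (level n k)" "k \<ge> 1"
  shows "chi_nat n g = of_real (real (card {x \<in> {..<level n k}. g x = x}) / real (level n k))"
proof -
  let ?N = "level n k"
  let ?F = "{x \<in> {..<?N}. g x = x}" and ?M = "{x \<in> {..<?N}. g x \<noteq> x}"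
  have s: "restr ?N g \<in> carrier (Sym ?N)" using restr_permutes[OF assms(1)] by (simp add: Sym_def)
  have "limit_embed n k (restr ?N g) = g" by (simp add: limit_embed_periodic periodic_restr[OF pos assms(1)])
  moreover have "{x \<in> {..<?N}. restr ?N g x \<noteq> x} = ?M" by (auto simp: restr_def)
  ultimately have chi: "chi_nat n g = 1 - of_nat (card ?M) / of_nat ?N"
    using chi_nat_eq[of n k "restr ?N g", OF n assms(2) s] by simp
  have eq: "card ?F + card ?M = ?N"
  proof -
    have "card (?F \<union> ?M) = card ?F + card ?M" by (rule card_Un_disjoint) auto
    moreover have "?F \<union> ?M = {..<?N}" by auto
    ultimately show ?thesis by simp
  qed
  have "complex_of_nat ?N = of_nat (card ?F) + of_nat (card ?M)"
    unfolding of_nat_add[symmetric] eq ..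
  then have "complex_of_nat (card ?F) = of_nat ?N - of_nat (card ?M)" by (simp only: add_diff_cancel)
  then show ?thesis using pos[of k] unfolding chi by (simp add: diff_divide_distrib)
qed

lemma fix_ratio_stage:
  assumes "g \<in> stage (level n k)" "k \<ge> 1"
  shows "fix_ratio g = real (card {x \<in> {..<level n k}. g x = x}) / real (level n k)"
  by (simp add: fix_ratio_def chi_nat_stage[OF assms])

lemma fix_ratio_stage_supp:
  assumes "g \<in> stage (level n k)" "k \<ge> 1"
  shows "real (card (supp g \<inter> {..<level n k})) = (1 - fix_ratio g) * real (level n k)"
proof -
  let ?N = "level n k"
  let ?F = "{x \<in> {..<?N}. g x = x}"
  have "card (?F \<union> (supp g \<inter> {..<?N})) = card ?F + card (supp g \<inter> {..<?N})"
    by (rule card_Un_disjoint) (auto simp: supp_def)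
  moreover have "?F \<union> (supp g \<inter> {..<?N}) = {..<?N}" by (auto simp: supp_def)
  ultimately have eq: "card ?F + card (supp g \<inter> {..<?N}) = ?N" by simp
  have "real ?N = real (card ?F) + real (card (supp g \<inter> {..<?N}))"
    unfolding of_nat_add[symmetric] eq ..
  then show ?thesis using pos[of k] by (simp add: fix_ratio_stage[OF assms] field_simps)
qed

lemma G_level: "g \<in> G \<Longrightarrow> \<exists>k\<ge>1. g \<in> stage (level n k)"
  by (auto simp: lim_grp_def)

lemma chi_nat_fix_ratio:
  assumes "g \<in> G"
  shows "chi_nat n g = of_real (fix_ratio g)"
proof -
  obtain k where "k \<ge> 1" "g \<in> stage (level n k)" using G_level[OF assms] by blast
  then show ?thesis by (simp add: fix_ratio_stage chi_nat_stage)
qed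

lemma fix_ratio_nonneg:
  assumes "g \<in> G"
  shows "fix_ratio g \<ge> 0"
proof -
  obtain k where "k \<ge> 1" "g \<in> stage (level n k)" using G_level[OF assms] by blast
  then show ?thesis by (simp add: fix_ratio_stage)
qed

lemma fix_ratio_le_1: "g \<in> G \<Longrightarrow> fix_ratio g \<le> 1"
proof -
  assume "g \<in> G"
  then obtain k where k: "k \<ge> 1" "g \<in> stage (level n k)" using G_level by blast
  have "real (card (supp g \<inter> {..<level n k})) \<ge> 0" by simp
  then have "(1 - fix_ratio g) * real (level n k) \<ge> 0" unfolding fix_ratio_stage_supp[OF k(2,1)] .
  then show ?thesis using pos[of k] by (simp add: zero_le_mult_iff)
qed

lemma fix_ratio_less_1:
  assumes "g \<in> G" "g \<noteq> id"
  shows "fix_ratio g < 1"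
proof (rule ccontr)
  assume "\<not> ?thesis"
  then have 1: "fix_ratio g = 1" using fix_ratio_le_1[OF assms(1)] by simp
  obtain k where k: "k \<ge> 1" "g \<in> stage (level n k)" using G_level[OF assms(1)] by blast
  have "supp g \<inter> {..<level n k} = {}" using fix_ratio_stage_supp[OF k(2,1)] 1 by simp
  then have "supp g = {}" using supp_mod[OF pos k(2)] by auto
  then show False using supp_empty assms(2) by blast
qed

lemma fix_ratio_id: "fix_ratio id = 1"
  using fix_ratio_stage[of id 1] perm_group.id_mem[OF stage_group[OF pos], of 1] pos[of 1] by simp

lemma fibre_commute:
  assumes "a \<in> stage N" "N > 0"
  shows "a \<circ> fibrewise N (\<lambda>_. v) = fibrewise N (\<lambda>_. v) \<circ> a"
  using stage_fibrewise_comm[OF assms(2,1), of "\<lambda>_. v"] by (simp add: comp_def)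

text \<open>The first factor acts on residues and the second on quotients, so the fixed points form
  a product set.\<close>

lemma fix_ratio_fibre_product:
  assumes a: "a \<in> stage (level n k)" and k: "k \<ge> 1" and lev: "level n j = level n k * Q" "k \<le> j"
    and v: "v \<in> stage Q"
  shows "fix_ratio (a \<circ> fibrewise (level n k) (\<lambda>_. v)) = fix_ratio a * (real (card {y \<in> {..<Q}. v y = y}) / real Q)"
proof -
  let ?N = "level n k"
  let ?g = "a \<circ> fibrewise ?N (\<lambda>_. v)"
  have N: "?N > 0" by (rule pos)
  have Q: "Q > 0" using lev pos[of j] by (metis mult_0_right neq0_conv)
  have fb: "fibrewise ?N (\<lambda>_. v) \<in> stage (level n j)" unfolding lev by (rule fibrewise_stage[OF N Q v])
  have "a \<in> stage (level n j)" using a stage_subset[OF lev(2)] by blast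
  then have g: "?g \<in> stage (level n j)" using fb perm_group.comp_mem[OF stage_group[OF pos]] by blast
  have "?g x = x \<longleftrightarrow> a (x mod ?N) = x mod ?N \<and> v (x div ?N) = x div ?N" for x
  proof -
    have "?g x = a (x mod ?N) + ?N * v (x div ?N)"
      using stage_apply[OF a, of "fibrewise ?N (\<lambda>_. v) x"] N by (simp add: fibrewise_mod fibrewise_div)
    moreover have "a (x mod ?N) < ?N" using stage_less[OF a] N by simp
    ultimately have "?g x mod ?N = a (x mod ?N)" "?g x div ?N = v (x div ?N)" by simp_all
    then show ?thesis by (metis mod_mult_div_eq)
  qed
  then have "card {x \<in> {..<level n j}. ?g x = x} =
      card {b \<in> {..<?N}. a b = b} * card {y \<in> {..<Q}. v y = y}"
    unfolding lev using card_digits[OF N, of Q "\<lambda>b. a b = b" "\<lambda>y. v y = y"] by simp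
  then show ?thesis
    using fix_ratio_stage[OF g] fix_ratio_stage[OF a k] k lev by simp
qed

end

lemma rotation_permutes:
  assumes "c \<le> Q"
  shows "(\<lambda>y. if y < c then (y + 1) mod c else y) permutes {..<Q :: nat}"
proof (rule permutes_subset)
  let ?\<rho> = "\<lambda>y. if y < c then (y + 1) mod c else y"
  show "?\<rho> permutes {..<c}"
  proof (rule inj_imp_permutes)
    show "inj_on ?\<rho> {..<c}"
      by (rule inj_onI) (auto simp: mod_Suc split: if_splits)
  qed auto
qed (use assms in auto)

context radix
begin

text \<open>Using the same permutation on every fibre makes an element commute with the whole stage.
  It is taken to be a square, which is even whatever the sequence is; the square of a cycle of
  length at least three still moves every point of the cycle.\<close>

lemma exists_central_element:
  assumes k: "k \<ge> 1" and v: "0 < v" "v \<le> 1" and e: "e > 0"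
  shows "\<exists>h\<in>G. sg h = 1 \<and> fix_ratio h < v \<and> v - e < fix_ratio h \<and>
    (\<forall>a\<in>stage (level n k). a \<circ> h = h \<circ> a \<and> fix_ratio (a \<circ> h) = fix_ratio a * fix_ratio h)"
proof -
  let ?N = "level n k"
  obtain K :: nat where K: "real K > 3 / v + 3 / e" using reals_Archimedean2 by blast
  obtain j where j: "k \<le> j" "level n j = ?N * (level n j div ?N)" "level n j div ?N \<ge> K"
    using level_quotient_ge by blast
  define Q where "Q = level n j div ?N"
  have "real Q \<ge> real K" using j(3) by (simp add: Q_def)
  then have QK: "real Q > 3 / v + 3 / e" using K by linarith
  have "3 / v > 0" "3 / e > 0" using v e by simp_all
  then have Qv: "real Q > 3 / v" and Qe: "real Q > 3 / e" and "real Q > 0" using QK by linarith+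
  then have Q: "Q > 0" by simp
  have lev: "level n j = ?N * Q" using j(2) by (simp add: Q_def)
  \<comment> \<open>Rounding down and adding 3 keeps the cycle length at least three and puts the
    density \<open>1 - c / Q\<close> below \<open>v\<close> by at most \<open>3 / Q\<close>. The two
    terms in the choice of \<open>K\<close> give \<open>c < Q\<close> and
    \<open>3 / Q < e\<close>.\<close>
  define c where "c = nat \<lfloor>(1 - v) * real Q\<rfloor> + 3"
  have "(1 - v) * real Q \<ge> 0" using v by simp
  then have c1: "(1 - v) * real Q < real c" "real c \<le> (1 - v) * real Q + 3"
    by (simp_all add: c_def of_nat_nat) linarith+
  have "v * real Q > 3" using Qv v by (simp add: divide_less_eq mult.commute)
  then have cQ: "c < Q" using c1(2) by (simp add: algebra_simps)
  have c3: "c \<ge> 3" by (simp add: c_def)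
  define \<rho> where "\<rho> = (\<lambda>y. if y < c then (y + 1) mod c else y)"
  have \<rho>: "\<rho> permutes {..<Q}" unfolding \<rho>_def using cQ by (intro rotation_permutes) simp
  define w where "w = periodic Q \<rho>"
  have w: "w \<in> stage Q" unfolding w_def by (rule periodic_stage[OF Q \<rho>])
  have ww: "w \<circ> w \<in> stage Q" using w perm_group.comp_mem[OF stage_group[OF Q]] by blast
  define h where "h = fibrewise ?N (\<lambda>_. w \<circ> w)"
  have "fibrewise ?N (\<lambda>_. w) \<in> stage (level n j)" unfolding lev by (rule fibrewise_stage[OF pos Q w])
  then have fG: "fibrewise ?N (\<lambda>_. w) \<in> G" by (rule stage_G)
  have hsq: "h = fibrewise ?N (\<lambda>_. w) \<circ> fibrewise ?N (\<lambda>_. w)" unfolding h_def by (simp add: fibrewise_comp pos)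
  have hG: "h \<in> G" unfolding hsq by (rule G.comp_mem[OF fG fG])
  have "{y \<in> {..<Q}. (w \<circ> w) y = y} = {c..<Q}"
  proof -
    have val: "(w \<circ> w) y = \<rho> (\<rho> y)" if "y < Q" for y
      using that permutes_less[OF \<rho> that] by (simp add: w_def periodic_less)
    have "\<rho> (\<rho> y) \<noteq> y" if "y < c" for y
      using that c3 by (auto simp: \<rho>_def mod_Suc)
    moreover have "\<rho> (\<rho> y) = y" if "\<not> y < c" for y using that by (simp add: \<rho>_def)
    ultimately show ?thesis using val by (auto simp: not_less) (metis not_less)
  qed
  then have cnt: "card {y \<in> {..<Q}. (w \<circ> w) y = y} = Q - c" by simp
  have prod: "fix_ratio (a \<circ> h) = fix_ratio a * (real (Q - c) / real Q)" if "a \<in> stage ?N" for a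
    using fix_ratio_fibre_product[OF that k lev j(1) ww] unfolding cnt h_def .
  have "id \<in> stage ?N" using perm_group.id_mem[OF stage_group[OF pos]] .
  from prod[OF this] have fh: "fix_ratio h = real (Q - c) / real Q" by (simp add: fix_ratio_id)
  also have "\<dots> = 1 - real c / real Q" using cQ Q by (simp add: of_nat_diff field_simps)
  finally have fh': "fix_ratio h = 1 - real c / real Q" .
  have "1 - v < real c / real Q" using c1(1) Q by (simp add: less_divide_eq)
  moreover have "real c / real Q \<le> 1 - v + 3 / real Q" using c1(2) Q by (simp add: divide_simps)
  moreover have "3 / real Q < e" using Qe e Q by (simp add: divide_less_eq mult.commute)
  ultimately have b: "fix_ratio h < v" "v - e < fix_ratio h" unfolding fh' by linarith+
  have comm: "a \<circ> h = h \<circ> a" if "a \<in> stage ?N" for a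
    unfolding h_def by (rule fibre_commute[OF that pos])
  have mult: "fix_ratio (a \<circ> h) = fix_ratio a * fix_ratio h" if "a \<in> stage ?N" for a using prod[OF that] fh by simp
  have "sg h = 1" unfolding hsq by (rule sg_square[OF fG])
  then show ?thesis using hG b comm mult by blast
qed

end

section \<open>The exponent\<close>

text \<open>The square of a four-cycle is an involution moving exactly four points; being a square,
  it will lead to even elements.\<close>

lemma periodic_involution_fixed:
  assumes "4 \<le> Q"
  defines "z \<equiv> periodic Q (\<lambda>y. if y < 4 then (y + 1) mod 4 else y)"
  shows "z \<in> stage Q" "(z \<circ> z) \<circ> (z \<circ> z) = id" "card {y \<in> {..<Q}. (z \<circ> z) y \<noteq> y} = 4"
proof -
  let ?\<rho> = "\<lambda>y :: nat. if y < 4 then (y + 1) mod 4 else y"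
  have Q: "Q > 0" using assms(1) by simp
  have \<rho>: "?\<rho> permutes {..<Q}" by (rule rotation_permutes[OF assms(1)])
  show "z \<in> stage Q" unfolding z_def by (rule periodic_stage[OF Q \<rho>])
  have \<rho>2: "?\<rho> (?\<rho> y) = (if y < 4 then (y + 2) mod 4 else y)" for y
    by (auto simp: mod_simps)
  have "?\<rho> (?\<rho> (?\<rho> (?\<rho> y))) = y" for y
    unfolding \<rho>2 by (auto simp: mod_simps)
  then have "?\<rho> \<circ> ?\<rho> \<circ> (?\<rho> \<circ> ?\<rho>) = id" by (simp only: fun_eq_iff comp_apply id_apply) simp
  then show "(z \<circ> z) \<circ> (z \<circ> z) = id"
    unfolding z_def by (simp only: periodic_comp[OF Q \<rho>, symmetric] periodic_comp[OF Q permutes_compose[OF \<rho> \<rho>], symmetric] periodic_id)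
  have val: "(z \<circ> z) y = ?\<rho> (?\<rho> y)" if "y < Q" for y
    using that permutes_less[OF \<rho> that] by (simp add: z_def periodic_less)
  have moved: "(z \<circ> z) y \<noteq> y \<longleftrightarrow> y < 4" if "y < Q" for y
    unfolding val[OF that] \<rho>2 by (auto simp: mod_if)
  have "{y \<in> {..<Q}. (z \<circ> z) y \<noteq> y} = {..<4}"
  proof (rule Set.set_eqI)
    fix y show "y \<in> {y \<in> {..<Q}. (z \<circ> z) y \<noteq> y} \<longleftrightarrow> y \<in> {..<4}"
      using moved[of y] assms(1) by (cases "y < Q") simp_all
  qed
  then show "card {y \<in> {..<Q}. (z \<circ> z) y \<noteq> y} = 4" by simp
qed

lemma card_sym_diff_parity:
  assumes "finite S" "finite T"
  shows "(- 1 :: real) ^ card S * (- 1) ^ card T = (- 1) ^ card (sym_diff S T)"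
proof -
  have 1: "card S = card (S - T) + card (S \<inter> T)"
    using assms by (metis card_Diff_subset_Int card_mono add.commute finite_Int inf_le1 le_add_diff_inverse)
  have 2: "card T = card (T - S) + card (S \<inter> T)"
    using assms by (metis card_Diff_subset_Int card_mono add.commute finite_Int inf_commute inf_le1 le_add_diff_inverse)
  have 3: "card (sym_diff S T) = card (S - T) + card (T - S)"
    by (rule card_Un_disjoint) (use assms in auto)
  have "(- 1 :: real) ^ (card (S \<inter> T) + card (S \<inter> T)) = 1" by simp
  then show ?thesis unfolding 1 2 3 power_add by simp
qed

context radix
begin

lemma common_level:
  assumes "g \<in> G" "h \<in> G"
  obtains k where "k \<ge> 1" "g \<in> stage (level n k)" "h \<in> stage (level n k)"
proof -
  obtain k where k: "k \<ge> 1" "g \<in> stage (level n k)" using G_level[OF assms(1)] by blast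
  obtain l where l: "l \<ge> 1" "h \<in> stage (level n l)" using G_level[OF assms(2)] by blast
  have "g \<in> stage (level n (max k l))" "h \<in> stage (level n (max k l))"
    using k(2) l(2) stage_subset[of k "max k l"] stage_subset[of l "max k l"] by auto
  then show ?thesis using that[of "max k l"] k(1) by simp
qed

lemma fix_ratio_comp: 
  assumes "g \<in> G" "h \<in> G"
  shows "fix_ratio (g \<circ> h) \<ge> fix_ratio g + fix_ratio h - 1"
proof -
  obtain k where k: "k \<ge> 1" "g \<in> stage (level n k)" "h \<in> stage (level n k)"
    by (rule common_level[OF assms])
  let ?N = "level n k"
  have gh: "g \<circ> h \<in> stage ?N" using k perm_group.comp_mem[OF stage_group[OF pos]] by blast
  have "supp (g \<circ> h) \<inter> {..<?N} \<subseteq> (supp g \<inter> {..<?N}) \<union> (supp h \<inter> {..<?N})"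
    by (auto simp: supp_def)
  then have "card (supp (g \<circ> h) \<inter> {..<?N}) \<le> card ((supp g \<inter> {..<?N}) \<union> (supp h \<inter> {..<?N}))"
    by (intro card_mono) auto
  also have "\<dots> \<le> card (supp g \<inter> {..<?N}) + card (supp h \<inter> {..<?N})" by (rule card_Un_le)
  finally have "real (card (supp (g \<circ> h) \<inter> {..<?N})) \<le>
      real (card (supp g \<inter> {..<?N})) + real (card (supp h \<inter> {..<?N}))"
    by (simp only: of_nat_add[symmetric] of_nat_le_iff)
  then have "(1 - fix_ratio (g \<circ> h)) * real ?N \<le> (1 - fix_ratio g + (1 - fix_ratio h)) * real ?N"
    unfolding fix_ratio_stage_supp[OF gh k(1)] fix_ratio_stage_supp[OF k(2,1)] fix_ratio_stage_supp[OF k(3,1)]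
    by (simp only: distrib_right)
  then have "1 - fix_ratio (g \<circ> h) \<le> 1 - fix_ratio g + (1 - fix_ratio h)"
    using pos[of k] by (simp only: mult_le_cancel_right_pos of_nat_0_less_iff)
  then show ?thesis by simp
qed

lemma fix_ratio_inv:
  assumes "g \<in> G"
  shows "fix_ratio (iv g) = fix_ratio g"
proof -
  obtain k where k: "k \<ge> 1" "g \<in> stage (level n k)" using G_level[OF assms] by blast
  have "iv g \<in> stage (level n k)" using k perm_group.inv_mem[OF stage_group[OF pos]] by blast
  moreover have "iv g x = x \<longleftrightarrow> g x = x" for x
    using stage_bij[OF k(2)] by (metis bij_inv_eq_iff)
  ultimately show ?thesis using k by (simp add: fix_ratio_stage)
qed

lemma fix_ratio_conj:
  assumes "g \<in> G" "c \<in> G"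
  shows "fix_ratio (c \<circ> g \<circ> iv c) = fix_ratio g"
proof -
  obtain k where k: "k \<ge> 1" "g \<in> stage (level n k)" "c \<in> stage (level n k)"
    by (rule common_level[OF assms])
  let ?N = "level n k"
  interpret B: perm_group "stage ?N" by (rule stage_group[OF pos])
  have cc: "c \<circ> g \<circ> iv c \<in> stage ?N" using k by (simp add: B.group_simps)
  have "bij_betw c {x \<in> {..<?N}. g x = x} {x \<in> {..<?N}. (c \<circ> g \<circ> iv c) x = x}"
  proof (rule bij_betw_byWitness[where f' = "iv c"])
    have l: "c (iv c x) = x" "iv c (c x) = x" for x
      using stage_bij[OF k(3)] by (simp_all add: bij_is_surj surj_f_inv_f bij_is_inj)
    then show "\<forall>a\<in>{x \<in> {..<?N}. g x = x}. iv c (c a) = a"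
      "\<forall>a'\<in>{x \<in> {..<?N}. (c \<circ> g \<circ> iv c) x = x}. c (iv c a') = a'"
      "c ` {x \<in> {..<?N}. g x = x} \<subseteq> {x \<in> {..<?N}. (c \<circ> g \<circ> iv c) x = x}"
      using stage_less[OF k(3)] by auto
    show "iv c ` {x \<in> {..<?N}. (c \<circ> g \<circ> iv c) x = x} \<subseteq> {x \<in> {..<?N}. g x = x}"
      using stage_less[OF B.inv_mem[OF k(3)]] l by (auto) metis
  qed
  then show ?thesis using fix_ratio_stage[OF cc k(1)] fix_ratio_stage[OF k(2,1)] by (simp only: bij_betw_same_card)
qed

lemma fix_ratio_pos:
  assumes "g \<in> stage (level n k)" "k \<ge> 1" "x < level n k" "g x = x"
  shows "fix_ratio g > 0"
proof -
  have "x \<in> {x \<in> {..<level n k}. g x = x}" using assms by simp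
  then have "card {x \<in> {..<level n k}. g x = x} > 0" by (subst card_gt_0_iff) auto
  then show ?thesis using pos[of k] by (simp add: fix_ratio_stage[OF assms(1,2)])
qed

text \<open>Transpositions generate the stage and the limit sign is multiplicative, so an odd
  element of the stage forces an odd periodic transposition there.\<close>

lemma exists_odd_transposition:
  assumes g: "g \<in> stage (level n k)" "sg g = - 1" and k: "k \<ge> 1"
  obtains t where "t \<in> G" "sg t = - 1" "fix_ratio t = 1 - 2 / real (level n k)"
proof -
  let ?N = "level n k"
  have "\<exists>a b. a < ?N \<and> b < ?N \<and> sg (periodic ?N (transpose a b)) \<noteq> 1"
  proof (rule ccontr)
    assume no: "\<not> ?thesis"
    have "sg (periodic ?N s) = 1" if "s permutes {..<?N}" for s
      using that finite_lessThan
    proof (induction rule: permutes_induct)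
      case id
      show ?case unfolding periodic_id by (rule sg_id)
    next
      case (swap a b p)
      have tp: "transpose a b permutes {..<?N}" using swap.hyps by (intro permutes_swap_id) auto
      have pp: "p permutes {..<?N}" using swap.hyps by blast
      have "sg (periodic ?N (transpose a b)) = 1" using no swap.hyps by auto
      moreover have "periodic ?N (transpose a b) \<in> G" "periodic ?N p \<in> G"
        using periodic_stage[OF pos tp] periodic_stage[OF pos pp] stage_G by blast+
      ultimately show ?case unfolding periodic_comp[OF pos pp] using swap.IH by (simp only: sg_comp mult_1)
    qed
    from this[OF restr_permutes[OF g(1)]] show False using g(2) by (simp add: periodic_restr[OF pos g(1)])
  qed
  then obtain a b where ab: "a < ?N" "b < ?N" "sg (periodic ?N (transpose a b)) \<noteq> 1" by blast
  let ?t = "periodic ?N (transpose a b)"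
  have "transpose a b permutes {..<?N}" using ab by (intro permutes_swap_id) auto
  then have t: "?t \<in> stage ?N" by (rule periodic_stage[OF pos])
  have "a \<noteq> b" using ab(3) sg_id by (auto simp: periodic_id transpose_same)
  have "supp ?t \<inter> {..<?N} = {a, b}"
    using ab(1,2) \<open>a \<noteq> b\<close> by (auto simp: supp_def periodic_less transpose_eq_iff)
  then have "2 = (1 - fix_ratio ?t) * real ?N"
    using fix_ratio_stage_supp[OF t k] \<open>a \<noteq> b\<close> by simp
  then have "fix_ratio ?t = 1 - 2 / real ?N" using pos[of k] by (simp add: field_simps)
  moreover have "sg ?t = - 1" using sg_cases[OF stage_G[OF t]] ab(3) by blast
  ultimately show ?thesis using that stage_G[OF t] by blast
qed

end

context extremal_char
begin

definition val :: "(nat \<Rightarrow> nat) \<Rightarrow> real" where "val g = Re (\<chi> g)"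

lemma even_val: "g \<in> G \<Longrightarrow> sg g = 1 \<Longrightarrow> \<chi> g = of_real (val g)"
  by (simp add: val_def even_value)

lemma val_nonneg: "g \<in> G \<Longrightarrow> sg g = 1 \<Longrightarrow> val g \<ge> 0"
  using W_upper[of g] by (simp add: val_def even_value)

lemma val_le_1: "g \<in> G \<Longrightarrow> val g \<le> 1"
  using norm_le[of g] complex_Re_le_cmod[of "\<chi> g"] unfolding val_def by linarith

lemma val_mono:
  assumes "g \<in> G" "sg g = 1" "h \<in> G" "sg h = 1" "fix_ratio g \<le> fix_ratio h"
  shows "val g \<le> val h"
proof -
  obtain k where k: "k \<ge> 1" "g \<in> stage (level n k)" "h \<in> stage (level n k)"
    by (rule common_level[OF assms(1,3)])
  have "(1 - fix_ratio h) * real (level n k) \<le> (1 - fix_ratio g) * real (level n k)"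
    using assms(5) by (intro mult_right_mono) auto
  then have "real (card (supp h \<inter> {..<level n k})) \<le> real (card (supp g \<inter> {..<level n k}))"
    unfolding fix_ratio_stage_supp[OF k(2,1)] fix_ratio_stage_supp[OF k(3,1)] .
  then show ?thesis unfolding val_def using even_mono[OF k(2,3) assms(2,4)] by simp
qed

text \<open>Densities of elements take only countably many values. The supremum over strictly
  smaller densities is defined at every point of the interval from 0 to 1 except 0, and it is
  left-continuous, in accordance with central sequences whose densities approach a number from
  below.\<close>

definition \<Phi> :: "real \<Rightarrow> real"
  where "\<Phi> x = Sup (val ` {g \<in> G. sg g = 1 \<and> fix_ratio g < x})"

lemma \<Phi>_bdd: "bdd_above (val ` {g \<in> G. sg g = 1 \<and> fix_ratio g < x})"
  by (rule bdd_aboveI[of _ 1]) (use val_le_1 in auto)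

lemma \<Phi>_upper: "g \<in> G \<Longrightarrow> sg g = 1 \<Longrightarrow> fix_ratio g < x \<Longrightarrow> val g \<le> \<Phi> x"
  unfolding \<Phi>_def by (rule cSup_upper) (use \<Phi>_bdd in auto)

lemma even_below_nonempty:
  assumes "0 < x" "x \<le> 1"
  shows "val ` {g \<in> G. sg g = 1 \<and> fix_ratio g < x} \<noteq> {}"
proof -
  obtain h where "h \<in> G" "sg h = 1" "fix_ratio h < x"
    using exists_central_element[of 1 x 1] assms by force
  then show ?thesis by auto
qed

lemma \<Phi>_lower:
  assumes "0 < x" "x \<le> 1" "y < \<Phi> x"
  obtains g where "g \<in> G" "sg g = 1" "fix_ratio g < x" "y < val g"
  using less_cSupE[OF assms(3)[unfolded \<Phi>_def] even_below_nonempty[OF assms(1,2)]] by blast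

lemma \<Phi>_mono:
  assumes "0 < x" "x \<le> y" "y \<le> 1"
  shows "\<Phi> x \<le> \<Phi> y"
  unfolding \<Phi>_def
  by (rule cSup_subset_mono) (use even_below_nonempty[of x] \<Phi>_bdd assms in auto)

lemma \<Phi>_nonneg:
  assumes "0 < x" "x \<le> 1"
  shows "\<Phi> x \<ge> 0"
proof -
  obtain g where g: "g \<in> G" "sg g = 1" "fix_ratio g < x" using even_below_nonempty[OF assms] by auto
  then show ?thesis using \<Phi>_upper[OF g] val_nonneg[OF g(1,2)] by linarith
qed

lemma \<Phi>_left_limit:
  assumes x: "0 < x" "x \<le> 1" and u: "\<And>k. 0 < u k" "\<And>k. u k < x" "u \<longlonglongrightarrow> x"
  shows "(\<lambda>k. \<Phi> (u k)) \<longlonglongrightarrow> \<Phi> x"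
proof (rule order_tendstoI)
  fix y assume "y < \<Phi> x"
  then obtain g where g: "g \<in> G" "sg g = 1" "fix_ratio g < x" "y < val g" by (rule \<Phi>_lower[OF x])
  have "eventually (\<lambda>k. fix_ratio g < u k) sequentially" by (rule order_tendstoD(1)[OF u(3) g(3)])
  then show "eventually (\<lambda>k. y < \<Phi> (u k)) sequentially"
    by eventually_elim (use \<Phi>_upper[OF g(1,2)] g(4) less_le_trans in blast)
next
  fix y assume y: "\<Phi> x < y"
  have "\<Phi> (u k) < y" for k
    using \<Phi>_mono[of "u k" x] u(1,2)[of k] x(2) y by simp
  then show "eventually (\<lambda>k. \<Phi> (u k) < y) sequentially" by simp
qed

lemma val_left_limit:
  assumes x: "0 < x" "x \<le> 1" and g: "\<And>k. h k \<in> G" "\<And>k. sg (h k) = 1"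
    and u: "\<And>k. fix_ratio (h k) < x" "(\<lambda>k. fix_ratio (h k)) \<longlonglongrightarrow> x"
  shows "(\<lambda>k. val (h k)) \<longlonglongrightarrow> \<Phi> x"
proof (rule order_tendstoI)
  fix y assume "y < \<Phi> x"
  then obtain g' where g': "g' \<in> G" "sg g' = 1" "fix_ratio g' < x" "y < val g'" by (rule \<Phi>_lower[OF x])
  have "eventually (\<lambda>k. fix_ratio g' < fix_ratio (h k)) sequentially" by (rule order_tendstoD(1)[OF u(2) g'(3)])
  then show "eventually (\<lambda>k. y < val (h k)) sequentially"
  proof eventually_elim
    case (elim k)
    then show ?case using val_mono[OF g'(1,2) g, of k] g'(4) by simp
  qed
next
  fix y assume y: "\<Phi> x < y"
  have "val (h k) < y" for k using \<Phi>_upper[OF g u(1), of k] y by simp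
  then show "eventually (\<lambda>k. val (h k) < y) sequentially" by simp
qed

lemma exists_central_sequence:
  assumes x: "0 < x" "x \<le> 1"
  shows "\<exists>h. (\<forall>k. h k \<in> G \<and> sg (h k) = 1 \<and> 0 < fix_ratio (h k) \<and> fix_ratio (h k) < x) \<and>
    (\<lambda>k. fix_ratio (h k)) \<longlonglongrightarrow> x \<and>
    (\<forall>g\<in>G. eventually (\<lambda>k. g \<circ> h k = h k \<circ> g \<and> fix_ratio (g \<circ> h k) = fix_ratio g * fix_ratio (h k)) sequentially)"
proof -
  have "\<exists>h. h \<in> G \<and> sg h = 1 \<and> fix_ratio h < x \<and> x - x / real (Suc k) < fix_ratio h \<and>
      (\<forall>a\<in>stage (level n (Suc k)). a \<circ> h = h \<circ> a \<and> fix_ratio (a \<circ> h) = fix_ratio a * fix_ratio h)" for k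
    using exists_central_element[of "Suc k" x "x / real (Suc k)"] x by (simp add: Bex_def)
  then obtain h where h: "\<And>k. h k \<in> G" "\<And>k. sg (h k) = 1" "\<And>k. fix_ratio (h k) < x"
    "\<And>k. x - x / real (Suc k) < fix_ratio (h k)"
    "\<And>k a. a \<in> stage (level n (Suc k)) \<Longrightarrow> a \<circ> h k = h k \<circ> a \<and> fix_ratio (a \<circ> h k) = fix_ratio a * fix_ratio (h k)"
    by metis
  have gt0: "fix_ratio (h k) > 0" for k
  proof -
    have "x / real (Suc k) \<le> x" using x by (simp add: divide_le_eq mult_le_cancel_left1)
    then show ?thesis using h(4)[of k] by linarith
  qed
  have lim: "(\<lambda>k. fix_ratio (h k)) \<longlonglongrightarrow> x"
  proof (rule real_tendsto_sandwich[of "\<lambda>k. x - x / real (Suc k)" _ _ "\<lambda>_. x"])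
    have "(\<lambda>k. x / real (Suc k)) \<longlonglongrightarrow> 0" using LIMSEQ_Suc[OF lim_const_over_n[of x]] by simp
    from tendsto_diff[OF tendsto_const this] show "(\<lambda>k. x - x / real (Suc k)) \<longlonglongrightarrow> x" by simp
  qed (use h in \<open>auto intro!: always_eventually less_imp_le\<close>)
  have ev: "eventually (\<lambda>k. g \<circ> h k = h k \<circ> g \<and> fix_ratio (g \<circ> h k) = fix_ratio g * fix_ratio (h k)) sequentially"
    if g: "g \<in> G" for g
  proof -
    obtain k0 where k0: "k0 \<ge> 1" "g \<in> stage (level n k0)" using G_level[OF g] by blast
    show ?thesis
      unfolding eventually_sequentially
    proof (intro exI allI impI)
      fix k assume "k0 \<le> k"
      then have "g \<in> stage (level n (Suc k))" using stage_subset[of k0 "Suc k"] k0(2) by auto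
      then show "g \<circ> h k = h k \<circ> g \<and> fix_ratio (g \<circ> h k) = fix_ratio g * fix_ratio (h k)" by (rule h(5))
    qed
  qed
  show ?thesis using h(1-3) gt0 lim ev by blast
qed

text \<open>Multiply \<open>g\<close> by eventually commuting elements \<open>h k\<close> whose
  densities rise to \<open>x\<close>. The densities eventually multiply exactly, the values multiply
  asymptotically, and left limits identify both sides.\<close>

lemma \<Phi>_mult_val:
  assumes x: "0 < x" "x \<le> 1" and g: "g \<in> G" "sg g = 1" "fix_ratio g > 0"
  shows "\<Phi> (fix_ratio g * x) = val g * \<Phi> x"
proof -
  obtain h where h0: "\<forall>k. h k \<in> G \<and> sg (h k) = 1 \<and> 0 < fix_ratio (h k) \<and> fix_ratio (h k) < x"
    and lim: "(\<lambda>k. fix_ratio (h k)) \<longlonglongrightarrow> x"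
    and ev: "\<forall>g\<in>G. eventually (\<lambda>k. g \<circ> h k = h k \<circ> g \<and> fix_ratio (g \<circ> h k) = fix_ratio g * fix_ratio (h k)) sequentially"
    using exists_central_sequence[OF x] by (elim exE conjE)
  note ev = ev[rule_format]
  have h: "h k \<in> G" "sg (h k) = 1" "fix_ratio (h k) < x" "fix_ratio (h k) > 0" for k using h0 by simp_all
  note h = h lim
  have gh: "g \<circ> h k \<in> G" "sg (g \<circ> h k) = 1" for k
    using g h by (simp_all add: G.comp_mem sg_comp)
  have am: "(\<lambda>k. \<chi> (g \<circ> h k) - \<chi> g * \<chi> (h k)) \<longlonglongrightarrow> 0"
  proof (rule asymptotic_multiplicativity[OF h(1) _ g(1)])
    fix a assume a: "a \<in> G"
    have "eventually (\<lambda>k. \<chi> (a \<circ> h k \<circ> iv a \<circ> iv (h k)) = 1) sequentially"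
      using ev[OF a]
    proof eventually_elim
      case (elim k)
      then have "a \<circ> h k \<circ> iv a \<circ> iv (h k) = h k \<circ> a \<circ> iv a \<circ> iv (h k)" by simp
      also have "\<dots> = id" using a h(1)[of k] by (simp add: G.group_simps)
      finally show ?case by (simp add: one)
    qed
    then show "(\<lambda>k. \<chi> (a \<circ> h k \<circ> iv a \<circ> iv (h k))) \<longlonglongrightarrow> 1" by (rule tendsto_eventually)
  qed
  have "\<chi> (g \<circ> h k) - \<chi> g * \<chi> (h k) = of_real (val (g \<circ> h k) - val g * val (h k))" for k
    by (simp add: even_val[OF gh] even_val[OF g(1,2)] even_val[OF h(1,2)])
  then have "(\<lambda>k. complex_of_real (val (g \<circ> h k) - val g * val (h k))) \<longlonglongrightarrow> of_real 0"
    using am by simp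
  then have diff: "(\<lambda>k. val (g \<circ> h k) - val g * val (h k)) \<longlonglongrightarrow> 0"
    by (simp only: tendsto_of_real_iff)
  have hl: "(\<lambda>k. val (h k)) \<longlonglongrightarrow> \<Phi> x" by (rule val_left_limit[OF x h(1-3,5)])
  have eqf: "eventually (\<lambda>k. fix_ratio (g \<circ> h k) = fix_ratio g * fix_ratio (h k)) sequentially"
    using ev[OF g(1)] by eventually_elim blast
  have gx: "0 < fix_ratio g * x" "fix_ratio g * x \<le> 1"
    using x g(3) fix_ratio_le_1[OF g(1)] by (simp_all add: mult_le_one)
  have "(\<lambda>k. val (g \<circ> h k)) \<longlonglongrightarrow> \<Phi> (fix_ratio g * x)"
  proof -
    obtain k0 where k0: "\<And>k. k \<ge> k0 \<Longrightarrow> fix_ratio (g \<circ> h k) = fix_ratio g * fix_ratio (h k)"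
      using eqf unfolding eventually_sequentially by blast
    have "(\<lambda>k. val (g \<circ> h (k + k0))) \<longlonglongrightarrow> \<Phi> (fix_ratio g * x)"
    proof (rule val_left_limit[OF gx gh])
      show "fix_ratio (g \<circ> h (k + k0)) < fix_ratio g * x" for k using k0[of "k + k0"] h(3) g(3) by simp
      have "(\<lambda>k. fix_ratio g * fix_ratio (h (k + k0))) \<longlonglongrightarrow> fix_ratio g * x"
        by (intro tendsto_intros LIMSEQ_ignore_initial_segment h(5))
      then show "(\<lambda>k. fix_ratio (g \<circ> h (k + k0))) \<longlonglongrightarrow> fix_ratio g * x" using k0 by simp
    qed
    then show ?thesis by (rule LIMSEQ_offset)
  qed
  moreover have "(\<lambda>k. val (g \<circ> h k)) \<longlonglongrightarrow> 0 + val g * \<Phi> x"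
  proof -
    have "(\<lambda>k. (val (g \<circ> h k) - val g * val (h k)) + val g * val (h k)) \<longlonglongrightarrow> 0 + val g * \<Phi> x"
      by (intro tendsto_intros diff hl)
    then show ?thesis by simp
  qed
  ultimately show ?thesis using LIMSEQ_unique by fastforce
qed

text \<open>The rule \<open>\<Phi>_mult_val\<close> at \<open>x = 1\<close>, along densities rising
  to 1, makes \<open>\<Phi> 1\<close> idempotent. The value 0 annihilates every nontrivial even
  element; the value 1 makes \<open>val\<close> agree with \<Phi> at all positive densities.\<close>

lemma even_powr_or_regular:
  "(\<forall>g\<in>G. sg g = 1 \<longrightarrow> g \<noteq> id \<longrightarrow> \<chi> g = 0) \<or>
   (\<exists>s\<ge>0. (\<forall>x. 0 < x \<longrightarrow> x \<le> 1 \<longrightarrow> \<Phi> x = x powr s) \<and>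
     (\<forall>g\<in>G. sg g = 1 \<longrightarrow> fix_ratio g > 0 \<longrightarrow> val g = fix_ratio g powr s))"
proof (cases "\<Phi> 1 = 0")
  case True
  have "\<chi> g = 0" if g: "g \<in> G" "sg g = 1" "g \<noteq> id" for g
  proof -
    have "val g \<le> 0" using \<Phi>_upper[OF g(1,2) fix_ratio_less_1[OF g(1,3)]] True by simp
    then show ?thesis using val_nonneg[OF g(1,2)] even_val[OF g(1,2)] by simp
  qed
  then show ?thesis by blast
next
  case False
  have \<Phi>1: "\<Phi> 1 = 1"
  proof -
    obtain h where h0: "\<forall>k. h k \<in> G \<and> sg (h k) = 1 \<and> 0 < fix_ratio (h k) \<and> fix_ratio (h k) < 1"
      and lim: "(\<lambda>k. fix_ratio (h k)) \<longlonglongrightarrow> 1"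
      using exists_central_sequence[OF zero_less_one order_refl] by (elim exE conjE)
    have h: "h k \<in> G" "sg (h k) = 1" "fix_ratio (h k) < 1" "fix_ratio (h k) > 0" for k using h0 by simp_all
    note h = h lim
    have "\<Phi> (fix_ratio (h k)) = val (h k) * \<Phi> 1" for k
      using \<Phi>_mult_val[of 1, OF _ _ h(1,2,4), of k] by simp
    moreover have "(\<lambda>k. \<Phi> (fix_ratio (h k))) \<longlonglongrightarrow> \<Phi> 1" by (rule \<Phi>_left_limit[OF _ _ h(4,3,5)]) simp_all
    moreover have "(\<lambda>k. val (h k)) \<longlonglongrightarrow> \<Phi> 1" by (rule val_left_limit[OF _ _ h(1-3,5)]) simp_all
    then have "(\<lambda>k. val (h k) * \<Phi> 1) \<longlonglongrightarrow> \<Phi> 1 * \<Phi> 1" by (intro tendsto_intros)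
    ultimately have "\<Phi> 1 * \<Phi> 1 = \<Phi> 1" using LIMSEQ_unique by fastforce
    then show ?thesis using False by simp
  qed
  have val_\<Phi>: "val g = \<Phi> (fix_ratio g)" if "g \<in> G" "sg g = 1" "fix_ratio g > 0" for g
    using \<Phi>_mult_val[of 1 g] that \<Phi>1 by simp
  have mult: "\<Phi> (x * y) = \<Phi> x * \<Phi> y" if x: "0 < x" "x \<le> 1" and y: "0 < y" "y \<le> 1" for x y
  proof -
    obtain h where h0: "\<forall>k. h k \<in> G \<and> sg (h k) = 1 \<and> 0 < fix_ratio (h k) \<and> fix_ratio (h k) < x"
      and lim: "(\<lambda>k. fix_ratio (h k)) \<longlonglongrightarrow> x"
      using exists_central_sequence[OF x] by (elim exE conjE)
    have h: "h k \<in> G" "sg (h k) = 1" "fix_ratio (h k) < x" "fix_ratio (h k) > 0" for k using h0 by simp_all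
    note h = h lim
    have "\<Phi> (fix_ratio (h k) * y) = val (h k) * \<Phi> y" for k by (rule \<Phi>_mult_val[OF y h(1,2,4)])
    moreover have "(\<lambda>k. val (h k) * \<Phi> y) \<longlonglongrightarrow> \<Phi> x * \<Phi> y"
      by (intro tendsto_intros val_left_limit[OF x h(1-3,5)])
    moreover have "(\<lambda>k. \<Phi> (fix_ratio (h k) * y)) \<longlonglongrightarrow> \<Phi> (x * y)"
      by (rule \<Phi>_left_limit) (use x y h in \<open>auto intro!: tendsto_intros simp: mult_le_one\<close>)
    ultimately show ?thesis using LIMSEQ_unique by fastforce
  qed
  have pow: "\<Phi> (x ^ Suc k) = \<Phi> x ^ Suc k" if x: "0 < x" "x \<le> 1" for x k
  proof (induction k)
    case (Suc k)
    have "x ^ Suc k \<le> 1" using x by (intro power_le_one) auto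
    then show ?case using mult[of x "x ^ Suc k"] x Suc by simp
  qed simp
  \<comment> \<open>Some \<open>g\<close> of density below 1 has a positive value. If its density is
    0, it bounds \<Phi> from below everywhere; otherwise \<Phi> is positive at the powers of the
    density, which fall below any \<open>x\<close>.\<close>
  have pos\<Phi>: "0 < \<Phi> x" if x: "0 < x" "x \<le> 1" for x
  proof -
    have "0 < \<Phi> 1" using \<Phi>1 by simp
    then obtain g where g: "g \<in> G" "sg g = 1" "fix_ratio g < 1" "0 < val g" by (rule \<Phi>_lower[rotated 2]) simp_all
    show ?thesis
    proof (cases "fix_ratio g = 0")
      case True
      then show ?thesis using \<Phi>_upper[OF g(1,2), of x] x g(4) by simp
    next
      case False
      then have f: "0 < fix_ratio g" "fix_ratio g \<le> 1" using fix_ratio_nonneg[OF g(1)] g(3) by simp_all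
      obtain k where k: "fix_ratio g ^ k < x" using real_arch_pow_inv[OF x(1) g(3)] by blast
      have "fix_ratio g ^ Suc k \<le> fix_ratio g ^ k" using f by (intro power_decreasing) auto
      then have "fix_ratio g ^ Suc k \<le> x" using k by linarith
      moreover have "fix_ratio g ^ Suc k > 0" using f(1) by (rule zero_less_power)
      ultimately have "\<Phi> (fix_ratio g ^ Suc k) \<le> \<Phi> x" by (intro \<Phi>_mono x(2))
      moreover have "\<Phi> (fix_ratio g ^ Suc k) > 0"
        unfolding pow[OF f] using val_\<Phi>[OF g(1,2) f(1)] g(4) by simp
      ultimately show ?thesis by linarith
    qed
  qed
  obtain s where s: "s \<ge> 0" "\<forall>x. 0 < x \<longrightarrow> x \<le> 1 \<longrightarrow> \<Phi> x = x powr s"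
    using monotone_multiplicative_powr[OF \<Phi>_mono mult pos\<Phi>] by blast
  have "val g = fix_ratio g powr s" if "g \<in> G" "sg g = 1" "fix_ratio g > 0" for g
    using val_\<Phi>[OF that] s(2) that(3) fix_ratio_le_1[OF that(1)] by simp
  then show ?thesis using s by blast
qed

text \<open>The fibrewise involutions \<open>t S\<close> form a group under symmetric difference, so positivity against
  the signs \<open>(- 1) ^ card S\<close> is the non-negativity of an iterated difference.\<close>

lemma exponent_nonneg_difference:
  assumes val: "\<And>g. g \<in> G \<Longrightarrow> sg g = 1 \<Longrightarrow> fix_ratio g > 0 \<Longrightarrow> val g = fix_ratio g powr s"
  shows "\<exists>d>0. real r * d < 1 \<and> backward_diff d r (\<lambda>x. x powr s) 1 \<ge> 0"
proof -
  \<comment> \<open>With at least \<open>Suc r\<close> residues, some residue is moved by no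
    \<open>t S\<close> with \<open>S \<subseteq> {..<r}\<close>, so all densities stay
    positive.\<close>
  define k where "k = Suc r"
  let ?N = "level n k"
  have N: "?N > 0" "?N \<ge> Suc r" using pos level_ge[of k] by (simp_all add: k_def)
  obtain j where j: "j \<ge> k" "level n j = ?N * (level n j div ?N)" "level n j div ?N \<ge> 4"
    using level_quotient_ge by blast
  define Q where "Q = level n j div ?N"
  have lev: "level n j = ?N * Q" and Q4: "4 \<le> Q" using j by (simp_all add: Q_def)
  have Q: "Q > 0" using Q4 by simp
  have j1: "j \<ge> 1" using j(1) by (simp add: k_def)
  \<comment> \<open>Each residue in \<open>S\<close> contributes four moved points at stage
    \<open>j\<close>, hence lowers the density of \<open>t S\<close> by \<open>d\<close>.\<close>
  define d where "d = 4 / real (level n j)"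
  have d0: "d > 0" using pos[of j] by (simp add: d_def)
  have rd: "real r * d < 1"
  proof -
    have "4 * r < 4 * Suc r" by simp
    also have "\<dots> \<le> Q * ?N" using Q4 N(2) by (intro mult_le_mono)
    finally have "real (4 * r) < real (level n j)" unfolding lev by (simp only: of_nat_less_iff mult.commute)
    then show ?thesis using pos[of j] by (simp add: d_def divide_less_eq mult.commute)
  qed
  define z where "z = periodic Q (\<lambda>y. if y < 4 then (y + 1) mod 4 else y)"
  note z = periodic_involution_fixed[OF Q4, folded z_def]
  define v where "v = z \<circ> z"
  define t where "t S = twist ?N S (\<lambda>_. v)" for S
  have v: "v \<in> stage Q" unfolding v_def using z(1) perm_group.comp_mem[OF stage_group[OF Q]] by blast
  have tb: "t S \<in> stage (level n j)" for S unfolding t_def lev by (rule twist_stage[OF N(1) Q v])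
  have tG: "t S \<in> G" for S by (rule stage_G[OF tb])
  have teven: "sg (t S) = 1" for S
  proof -
    have "twist ?N S (\<lambda>_. z) \<in> stage (level n j)" unfolding lev by (rule twist_stage[OF N(1) Q z(1)])
    then have "twist ?N S (\<lambda>_. z) \<in> G" by (rule stage_G)
    moreover have "t S = twist ?N S (\<lambda>_. z) \<circ> twist ?N S (\<lambda>_. z)"
      unfolding t_def v_def by (rule twist_comp[OF N(1), symmetric])
    ultimately show ?thesis using sg_square by simp
  qed
  have tt: "t S \<circ> t T = t (sym_diff S T)" for S T
    unfolding t_def twist_def fibrewise_comp[OF N(1)]
    by (rule arg_cong[of _ _ "fibrewise ?N"], rule ext) (auto simp: z(3) v_def z(2)[folded v_def] z(2))
  have tinv: "iv (t S) = t S" for S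
  proof -
    have "t {} = id" unfolding t_def twist_def by (simp add: fibrewise_id)
    then have "t S \<circ> t S = id" using tt[of S S] by simp
    then show ?thesis by (metis inv_unique_comp)
  qed
  have tfx: "fix_ratio (t S) = 1 - real (card S) * d" if S: "S \<subseteq> {..<r}" for S
  proof -
    have "x \<in> supp (t S) \<longleftrightarrow> x mod ?N \<in> S \<and> v (x div ?N) \<noteq> x div ?N" for x
    proof -
      have "t S x = x \<longleftrightarrow> t S x div ?N = x div ?N"
        using fibrewise_mod[OF N(1), of "\<lambda>a. if a \<in> S then v else id" x] unfolding t_def twist_def
        by (metis mult_div_mod_eq)
      then show ?thesis unfolding supp_def t_def twist_def by (simp add: fibrewise_div[OF N(1)])
    qed
    then have "supp (t S) \<inter> {..<level n j} = {x \<in> {..<?N * Q}. x mod ?N \<in> S \<and> v (x div ?N) \<noteq> x div ?N}"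
      unfolding lev by auto
    then have "card (supp (t S) \<inter> {..<level n j}) = card {a \<in> {..<?N}. a \<in> S} * 4"
      using card_digits[OF N(1), of Q "\<lambda>a. a \<in> S" "\<lambda>y. v y \<noteq> y"] z(3) by (simp add: v_def)
    moreover have "{a \<in> {..<?N}. a \<in> S} = S" using S N(2) by auto
    ultimately have "real (card S) * 4 = (1 - fix_ratio (t S)) * real (level n j)"
      using fix_ratio_stage_supp[OF tb j1, of S] by simp
    then show ?thesis using pos[of j] by (simp add: d_def field_simps)
  qed
  let ?F = "\<lambda>S. (1 - real (card S) * d) powr s"
  have t\<chi>: "\<chi> (t S) = of_real (?F S)" if S: "S \<subseteq> {..<r}" for S
  proof -
    have "card S \<le> r" using card_mono[OF _ S] by simp
    then have "real (card S) * d \<le> real r * d" using d0 by (intro mult_right_mono) auto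
    then have "fix_ratio (t S) > 0" using tfx[OF S] rd by simp
    then show ?thesis using even_val[OF tG teven] val[OF tG teven] tfx[OF S] by simp
  qed
  let ?P = "Pow {..<r}"
  let ?D = "\<Sum>U\<in>?P. (- 1) ^ card U * ?F U"
  have "qform \<chi> ?P t (\<lambda>S. (- 1) ^ card S) = (\<Sum>S\<in>?P. \<Sum>T\<in>?P. of_real ((- 1) ^ card (sym_diff S T) * ?F (sym_diff S T)))"
    unfolding qform_def
  proof (intro sum.cong refl)
    fix S T assume ST: "S \<in> ?P" "T \<in> ?P"
    then have fin: "finite S" "finite T" and sub: "sym_diff S T \<subseteq> {..<r}" using finite_subset by auto
    have "cnj ((- 1) ^ card S) * \<chi> (t S \<circ> iv (t T)) * (- 1) ^ card T =
        of_real ((- 1) ^ card S * (- 1) ^ card T * ?F (sym_diff S T))"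
      unfolding tinv tt t\<chi>[OF sub] by simp
    then show "cnj ((- 1) ^ card S) * \<chi> (t S \<circ> iv (t T)) * (- 1) ^ card T =
        of_real ((- 1) ^ card (sym_diff S T) * ?F (sym_diff S T))"
      unfolding card_sym_diff_parity[OF fin] .
  qed
  \<comment> \<open>Symmetric difference with \<open>S\<close> permutes the subsets, so every row of
    the form has the same sum.\<close>
  also have "\<dots> = (\<Sum>S\<in>?P. of_real ?D)"
  proof (rule sum.cong[OF refl])
    fix S assume S: "S \<in> ?P"
    have "bij_betw (sym_diff S) ?P ?P"
      by (rule bij_betw_byWitness[where f' = "sym_diff S"]) (use S in auto)
    from sum.reindex_bij_betw[OF this, of "\<lambda>U. (- 1) ^ card U * ?F U"]
    show "(\<Sum>T\<in>?P. complex_of_real ((- 1) ^ card (sym_diff S T) * ?F (sym_diff S T))) = of_real ?D"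
      unfolding of_real_sum[symmetric] by simp
  qed
  also have "\<dots> = of_real (2 ^ r * ?D)" by (simp add: card_Pow)
  finally have "qform \<chi> ?P t (\<lambda>S. (- 1) ^ card S) = of_real (2 ^ r * ?D)" .
  moreover have "0 \<le> Re (qform \<chi> ?P t (\<lambda>S. (- 1) ^ card S))"
    by (rule pos_def_form[OF pd]) (use tG in auto)
  ultimately have "0 \<le> 2 ^ r * ?D" by (simp only: Re_complex_of_real)
  then have "0 \<le> ?D"
    using mult_pos_neg[of "2 ^ r :: real" ?D] by (meson not_le zero_less_numeral zero_less_power)
  then have "0 \<le> backward_diff d r (\<lambda>x. x powr s) 1"
    using sum_Pow_backward_diff[where f = "\<lambda>x. x powr s" and x = 1 and r = r and d = d] by simp
  then show ?thesis using d0 rd by blast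
qed

end

section \<open>Odd elements\<close>

context extremal_char
begin

text \<open>Quotients of distinct conjugates of \<open>g\<close> are even and nontrivial, so Bessel's inequality applies to
  arbitrarily many conjugates.\<close>

lemma regular_odd:
  assumes reg: "\<And>g. g \<in> G \<Longrightarrow> sg g = 1 \<Longrightarrow> g \<noteq> id \<Longrightarrow> \<chi> g = 0"
    and g: "g \<in> G" "g \<noteq> id"
  shows "\<chi> g = 0"
proof (rule ccontr)
  assume nz: "\<chi> g \<noteq> 0"
  obtain K :: nat where K: "real K > 1 / (cmod (\<chi> g))\<^sup>2" using reals_Archimedean2 by blast
  obtain k0 where k0: "k0 \<ge> 1" "g \<in> stage (level n k0)" using G_level[OF g(1)] by blast
  \<comment> \<open>The summand 2 reserves the residues \<open>x\<close> and \<open>y\<close>; at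
    least \<open>K\<close> others remain to index the conjugates.\<close>
  define k where "k = max k0 (K + 2)"
  let ?N = "level n k"
  have gk: "g \<in> stage ?N" using k0(2) stage_subset[of k0 k] by (auto simp: k_def)
  have "supp g \<noteq> {}" using supp_empty g(2) by blast
  then obtain x where x: "x < ?N" "g x \<noteq> x" using supp_mod[OF pos gk] by (auto simp: supp_def)
  define y where "y = g x"
  have y: "y < ?N" "y \<noteq> x" unfolding y_def using stage_less[OF gk x(1)] x(2) by auto
  define I where "I = {..<?N} - {x, y}"
  have cI: "card I \<ge> K" "finite I"
  proof -
    have "K + 2 \<le> k" by (simp add: k_def)
    moreover have "card I \<ge> ?N - 2"
      unfolding I_def using diff_card_le_card_Diff[of "{x, y}" "{..<?N}"] y(2) by simp
    ultimately show "card I \<ge> K" using level_ge[of k] by linarith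
  qed (simp add: I_def)
  define c where "c z = periodic ?N (transpose y z)" for z
  \<comment> \<open>The conjugates are told apart by their value at \<open>x\<close>, which is
    \<open>z\<close> for \<open>t z\<close>.\<close>
  define t where "t z = c z \<circ> g \<circ> iv (c z)" for z
  have cb: "c z \<in> stage ?N" if "z \<in> I" for z
    unfolding c_def by (rule periodic_stage[OF pos], rule permutes_swap_id) (use that y in \<open>auto simp: I_def\<close>)
  have cG: "c z \<in> G" if "z \<in> I" for z by (rule stage_G[OF cb[OF that]])
  have tG: "t z \<in> G" if "z \<in> I" for z
    unfolding t_def using cG[OF that] g(1) by (simp add: G.group_simps)
  have tx: "t z x = z" if z: "z \<in> I" for z
  proof -
    have "c z x = x" using x(1) y(2) z by (auto simp: c_def periodic_less I_def)
    then have "iv (c z) x = x" using stage_bij[OF cb[OF z]] by (metis bij_is_inj inv_f_f)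
    then show ?thesis using y(1) by (simp add: t_def c_def periodic_less y_def[symmetric])
  qed
  have gram: "\<chi> (t z \<circ> iv (t z')) = (if z = z' then 1 else 0)" if z: "z \<in> I" "z' \<in> I" for z z'
  proof (cases "z = z'")
    case True
    then show ?thesis using tG[OF z(1)] by (simp add: G.inv_right one)
  next
    case False
    have "t z \<circ> iv (t z') \<noteq> id"
    proof
      assume "t z \<circ> iv (t z') = id"
      then have "t z \<circ> iv (t z') \<circ> t z' = t z'" by simp
      then have "t z = t z'" using tG z by (simp add: G.group_simps)
      then show False using tx[OF z(1)] tx[OF z(2)] False by simp
    qed
    moreover have "sg (t z) = sg g" "sg (t z') = sg g"
      unfolding t_def using sg_conj g(1) cG z by blast+
    then have "sg (t z \<circ> iv (t z')) = 1"
      using tG z sg_cases[OF g(1)] by (auto simp: sg_comp sg_inv G.inv_mem)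
    ultimately show ?thesis using reg[of "t z \<circ> iv (t z')"] tG z False by (simp add: G.comp_mem G.inv_mem)
  qed
  have "(\<Sum>z\<in>I. cnj 1 * \<chi> (t z)) = of_nat (card I) * \<chi> g"
  proof -
    have "\<chi> (t z) = \<chi> g" if "z \<in> I" for z unfolding t_def by (rule conj_inv[OF cG[OF that] g(1)])
    then show ?thesis by simp
  qed
  moreover have "qform \<chi> I t (\<lambda>_. 1) = of_nat (card I)"
  proof -
    have "qform \<chi> I t (\<lambda>_. 1) = (\<Sum>z\<in>I. \<Sum>z'\<in>I. if z = z' then 1 else 0)"
      unfolding qform_def by (intro sum.cong refl) (simp add: gram)
    then show ?thesis using cI(2) by simp
  qed
  moreover have "(cmod (\<Sum>z\<in>I. cnj 1 * \<chi> (t z)))\<^sup>2 \<le> Re (\<chi> id) * Re (qform \<chi> I t (\<lambda>_. 1))"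
    by (rule G.pos_def_cauchy_schwarz[OF pd cI(2) tG])
  ultimately have le: "(real (card I) * cmod (\<chi> g))\<^sup>2 \<le> real (card I)"
    by (simp add: one norm_mult)
  have "1 / (cmod (\<chi> g))\<^sup>2 \<ge> 0" by simp
  then have c0: "real (card I) > 0" using K cI(1) by linarith
  have "real (card I) * (real (card I) * (cmod (\<chi> g))\<^sup>2) \<le> real (card I) * 1"
    using le by (simp add: power2_eq_square mult_ac)
  then have "real (card I) * (cmod (\<chi> g))\<^sup>2 \<le> 1" using c0 by (simp only: mult_le_cancel_left_pos)
  moreover have "real (card I) > 1 / (cmod (\<chi> g))\<^sup>2" using K cI(1) by linarith
  then have "real (card I) * (cmod (\<chi> g))\<^sup>2 > 1" using nz by (simp add: divide_less_eq)
  ultimately show False by linarith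
qed

text \<open>An even \<open>g\<close> is corrected by the square of a three-cycle, chosen so that
  \<open>d \<circ> d \<circ> g\<close> fixes \<open>x\<close> while \<open>d \<circ> d\<close> fixes
  \<open>u\<close>. Both then have positive density, and \<open>d \<circ> d\<close> lies in the
  kernel of \<chi>. This settles density 0 when the exponent is 0.\<close>

lemma trivial_on_even:
  assumes triv: "\<And>g. g \<in> G \<Longrightarrow> sg g = 1 \<Longrightarrow> fix_ratio g > 0 \<Longrightarrow> \<chi> g = 1"
    and g: "g \<in> G" "sg g = 1"
  shows "\<chi> g = 1"
proof (cases "g = id")
  case False
  obtain k0 where k0: "k0 \<ge> 1" "g \<in> stage (level n k0)" using G_level[OF g(1)] by blast
  define k where "k = max k0 4"
  let ?N = "level n k"
  have k1: "k \<ge> 1" using k0(1) by (simp add: k_def)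
  have gk: "g \<in> stage ?N" using k0(2) stage_subset[of k0 k] by (auto simp: k_def)
  have N4: "?N \<ge> 4" using level_ge[of k] by (simp add: k_def)
  have "supp g \<noteq> {}" using supp_empty False by blast
  then obtain x where x: "x < ?N" "g x \<noteq> x" using supp_mod[OF pos gk] by (auto simp: supp_def)
  define y where "y = g x"
  have y: "y < ?N" "y \<noteq> x" unfolding y_def using stage_less[OF gk x(1)] x(2) by auto
  have card3: "card ({..<?N} - F) > 0" if "card F \<le> 3" "finite F" for F
    using diff_card_le_card_Diff[OF that(2), of "{..<?N}"] that(1) N4 by simp
  have "card {x, y} \<le> 3" by (simp add: card_insert_if)
  then obtain z where z: "z < ?N" "z \<noteq> x" "z \<noteq> y"
    using card3[of "{x, y}"] by (auto simp: card_gt_0_iff)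
  have "card {x, y, z} \<le> 3" by (simp add: card_insert_if)
  then obtain u where u: "u < ?N" "u \<noteq> x" "u \<noteq> y" "u \<noteq> z"
    using card3[of "{x, y, z}"] by (auto simp: card_gt_0_iff)
  define d where "d = periodic ?N (transpose x y \<circ> transpose y z)"
  have db: "d \<in> stage ?N"
    unfolding d_def by (rule periodic_stage[OF pos], intro permutes_compose permutes_swap_id)
      (use x y z in auto)
  have dG: "d \<in> G" by (rule stage_G[OF db])
  have dd: "d \<circ> d \<in> stage ?N" using db perm_group.comp_mem[OF stage_group[OF pos]] by blast
  have dval: "d y = z" "d z = x" "d u = u"
    using x y z u by (auto simp: d_def periodic_less)
  have even: "sg (d \<circ> d) = 1" by (rule sg_square[OF dG])
  have "fix_ratio (d \<circ> d) > 0" by (rule fix_ratio_pos[OF dd k1 u(1)]) (simp add: dval)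
  then have "\<chi> (d \<circ> d) = 1" by (rule triv[OF stage_G[OF dd] even])
  then have "\<chi> (d \<circ> d \<circ> g) = \<chi> g"
    by (intro G.pos_def_kernel[OF pd stage_G[OF dd] g(1)]) (simp only: one)
  moreover have "d \<circ> d \<circ> g \<in> stage ?N" using dd gk perm_group.comp_mem[OF stage_group[OF pos]] by blast
  then have "fix_ratio (d \<circ> d \<circ> g) > 0"
    by (rule fix_ratio_pos[OF _ k1 x(1)]) (simp add: y_def[symmetric] dval)
  then have "\<chi> (d \<circ> d \<circ> g) = 1"
    by (rule triv[rotated 2]) (use dG g even in \<open>simp_all only: sg_comp G.comp_mem mult_1\<close>)
  ultimately show ?thesis by simp
qed (simp add: one)

lemma even_classification:
  "(\<forall>g\<in>G. sg g = 1 \<longrightarrow> g \<noteq> id \<longrightarrow> \<chi> g = 0) \<or>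
   (\<exists>m. \<forall>g\<in>G. sg g = 1 \<longrightarrow> \<chi> g = of_real (fix_ratio g ^ m))"
  using even_powr_or_regular
proof (elim disjE exE conjE)
  fix s assume s: "s \<ge> 0" and \<Phi>: "\<forall>x. 0 < x \<longrightarrow> x \<le> 1 \<longrightarrow> \<Phi> x = x powr s"
    and val: "\<forall>g\<in>G. sg g = 1 \<longrightarrow> fix_ratio g > 0 \<longrightarrow> val g = fix_ratio g powr s"
  have "\<exists>d>0. real r * d < 1 \<and> backward_diff d r (\<lambda>x. x powr s) 1 \<ge> 0" for r
    by (rule exponent_nonneg_difference) (use val in blast)
  then obtain m :: nat where m: "s = real m" using nonneg_differences_imp_nat[OF s] by blast
  have pos_case: "val g = fix_ratio g ^ m" if "g \<in> G" "sg g = 1" "fix_ratio g > 0" for g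
    using val that by (simp add: m powr_realpow)
  have "\<chi> g = of_real (fix_ratio g ^ m)" if g: "g \<in> G" "sg g = 1" for g
  proof (cases "m = 0")
    \<comment> \<open>At density 0 the bound of \<open>val g\<close> by \<open>x ^ m\<close> for
      small \<open>x\<close> tends to zero only for positive \<open>m\<close>, so exponent 0 is
      treated algebraically.\<close>
    case True
    have "\<chi> h = 1" if "h \<in> G" "sg h = 1" "fix_ratio h > 0" for h
      using pos_case[OF that] even_val[OF that(1,2)] True by simp
    from trivial_on_even[OF this g] show ?thesis using True by simp
  next
    case m0: False
    show ?thesis
    proof (cases "fix_ratio g > 0")
      case True
      then show ?thesis using pos_case[OF g True] even_val[OF g] by simp
    next
      case False
      then have f0: "fix_ratio g = 0" using fix_ratio_nonneg[OF g(1)] by simp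
      have "val g \<le> 0"
      proof (rule field_le_epsilon)
        fix e :: real assume e: "e > 0"
        define x where "x = min 1 e"
        have x: "0 < x" "x \<le> 1" using e by (simp_all add: x_def)
        have "val g \<le> \<Phi> x" by (rule \<Phi>_upper[OF g]) (use f0 x in simp)
        also have "\<dots> = x ^ m" using \<Phi> x by (simp add: m powr_realpow)
        also have "\<dots> \<le> x ^ 1" using x m0 by (intro power_decreasing) auto
        also have "\<dots> \<le> 0 + e" by (simp add: x_def)
        finally show "val g \<le> 0 + e" .
      qed
      then have "val g = 0" using val_nonneg[OF g] by simp
      then show ?thesis using even_val[OF g] f0 m0 by simp
    qed
  qed
  then show ?thesis by blast
qed blast

lemma fix_ratio_comp_lower: "g \<in> G \<Longrightarrow> h \<in> G \<Longrightarrow> fix_ratio g \<ge> fix_ratio (g \<circ> h) + fix_ratio h - 1"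
  using fix_ratio_comp[of "g \<circ> h" "iv h"] fix_ratio_inv[of h] by (simp add: G.group_simps)

text \<open>For odd \<open>t j\<close> with densities tending to 1, commutators with a fixed element
  are even with densities tending to 1, so the formula on even elements makes the sequence
  asymptotically central. For odd \<open>g\<close> the products \<open>g \<circ> t j\<close> are
  even with densities tending to that of \<open>g\<close>, which determines the limit of
  \<open>\<chi> g * \<chi> (t j)\<close>.\<close>

theorem odd_classification:
  assumes even: "\<And>g. g \<in> G \<Longrightarrow> sg g = 1 \<Longrightarrow> \<chi> g = of_real (fix_ratio g ^ m)"
    and odd: "g0 \<in> G" "sg g0 = - 1"
  shows "\<exists>c \<in> {1, - 1}. \<forall>g\<in>G. sg g = - 1 \<longrightarrow> \<chi> g = c * of_real (fix_ratio g ^ m)"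
proof -
  obtain k0 where k0: "k0 \<ge> 1" "g0 \<in> stage (level n k0)" using G_level[OF odd(1)] by blast
  have "\<exists>t. t \<in> G \<and> sg t = - 1 \<and> fix_ratio t \<ge> 1 - 2 / real (Suc j)" for j
  proof -
    let ?k = "max k0 (Suc j)"
    have "g0 \<in> stage (level n ?k)" using k0(2) stage_subset[of k0 ?k] by auto
    moreover have "?k \<ge> 1" by simp
    ultimately obtain t where t: "t \<in> G" "sg t = - 1" "fix_ratio t = 1 - 2 / real (level n ?k)"
      using exists_odd_transposition[OF _ odd(2)] by metis
    have "level n ?k \<ge> Suc j" using level_ge[of ?k] by simp
    then have "2 / real (level n ?k) \<le> 2 / real (Suc j)" by (intro divide_left_mono) auto
    then show ?thesis using t by auto
  qed
  then obtain t where t: "\<And>j. t j \<in> G" "\<And>j. sg (t j) = - 1" "\<And>j. fix_ratio (t j) \<ge> 1 - 2 / real (Suc j)"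
    by metis
  have tlim: "(\<lambda>j. fix_ratio (t j)) \<longlonglongrightarrow> 1"
  proof (rule real_tendsto_sandwich[of "\<lambda>j. 1 - 2 / real (Suc j)" _ _ "\<lambda>_. 1"])
    have "(\<lambda>j. 2 / real (Suc j)) \<longlonglongrightarrow> 0" using LIMSEQ_Suc[OF lim_const_over_n[of 2]] by simp
    from tendsto_diff[OF tendsto_const this] show "(\<lambda>j. 1 - 2 / real (Suc j)) \<longlonglongrightarrow> 1" by simp
  qed (use t fix_ratio_le_1 in auto)
  have near: "(\<lambda>j. fix_ratio (g \<circ> t j)) \<longlonglongrightarrow> fix_ratio g" if g: "g \<in> G" for g
  proof (rule real_tendsto_sandwich[of "\<lambda>j. fix_ratio g + fix_ratio (t j) - 1" _ _ "\<lambda>j. fix_ratio g + 1 - fix_ratio (t j)"])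
    show "(\<lambda>j. fix_ratio g + fix_ratio (t j) - 1) \<longlonglongrightarrow> fix_ratio g" "(\<lambda>j. fix_ratio g + 1 - fix_ratio (t j)) \<longlonglongrightarrow> fix_ratio g"
      using tendsto_diff[OF tendsto_add[OF tendsto_const[of "fix_ratio g"] tlim] tendsto_const[of 1]]
        tendsto_diff[OF tendsto_const[of "fix_ratio g + 1"] tlim] by simp_all
    show "\<forall>\<^sub>F j in sequentially. fix_ratio g + fix_ratio (t j) - 1 \<le> fix_ratio (g \<circ> t j)"
      using fix_ratio_comp[OF g t(1)] by simp
    have "fix_ratio (g \<circ> t j) \<le> fix_ratio g + 1 - fix_ratio (t j)" for j using fix_ratio_comp_lower[OF g t(1), of j] by linarith
    then show "\<forall>\<^sub>F j in sequentially. fix_ratio (g \<circ> t j) \<le> fix_ratio g + 1 - fix_ratio (t j)" by simp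
  qed
  have am: "(\<lambda>j. \<chi> (g \<circ> t j) - \<chi> g * \<chi> (t j)) \<longlonglongrightarrow> 0" if g: "g \<in> G" for g
  proof (rule asymptotic_multiplicativity[OF t(1) _ g])
    fix a assume a: "a \<in> G"
    let ?q = "\<lambda>j. a \<circ> t j \<circ> iv a \<circ> iv (t j)"
    have qG: "?q j \<in> G" and atG: "a \<circ> t j \<circ> iv a \<in> G" for j
      using a t(1) by (simp_all add: G.comp_mem G.inv_mem)
    have "sg (?q j) = 1" for j
      using sg_conj[OF t(1) a, of j] t(2)[of j] sg_inv[OF t(1), of j] sg_comp[OF atG G.inv_mem[OF t(1)], of j j]
      by simp
    then have val: "\<chi> (?q j) = of_real (fix_ratio (?q j) ^ m)" for j using even[OF qG] by blast
    have "(\<lambda>j. fix_ratio (?q j)) \<longlonglongrightarrow> 1"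
    proof (rule real_tendsto_sandwich[of "\<lambda>j. fix_ratio (t j) + fix_ratio (t j) - 1" _ _ "\<lambda>_. 1"])
      show "(\<lambda>j. fix_ratio (t j) + fix_ratio (t j) - 1) \<longlonglongrightarrow> 1"
        using tendsto_diff[OF tendsto_add[OF tlim tlim] tendsto_const[of 1]] by simp
      have "fix_ratio (t j) + fix_ratio (t j) - 1 \<le> fix_ratio (?q j)" for j
        using fix_ratio_comp[OF atG G.inv_mem[OF t(1)], of j j] fix_ratio_conj[OF t(1) a, of j] fix_ratio_inv[OF t(1), of j]
        by simp
      then show "\<forall>\<^sub>F j in sequentially. fix_ratio (t j) + fix_ratio (t j) - 1 \<le> fix_ratio (?q j)" by simp
      show "\<forall>\<^sub>F j in sequentially. fix_ratio (?q j) \<le> 1" using fix_ratio_le_1[OF qG] by simp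
    qed simp
    then have "(\<lambda>j. complex_of_real (fix_ratio (?q j) ^ m)) \<longlonglongrightarrow> of_real (1 ^ m)"
      by (intro tendsto_intros)
    then show "(\<lambda>j. \<chi> (?q j)) \<longlonglongrightarrow> 1" unfolding val by simp
  qed
  have lim: "(\<lambda>j. \<chi> g * \<chi> (t j)) \<longlonglongrightarrow> of_real (fix_ratio g ^ m)" if g: "g \<in> G" "sg g = - 1" for g
  proof -
    have "sg (g \<circ> t j) = 1" for j using sg_comp[OF g(1) t(1)] g(2) t(2) by simp
    then have "\<chi> (g \<circ> t j) = of_real (fix_ratio (g \<circ> t j) ^ m)" for j
      using even[OF G.comp_mem[OF g(1) t(1)]] by blast
    moreover have "(\<lambda>j. complex_of_real (fix_ratio (g \<circ> t j) ^ m)) \<longlonglongrightarrow> of_real (fix_ratio g ^ m)"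
      by (intro tendsto_intros near g(1))
    ultimately have "(\<lambda>j. \<chi> (g \<circ> t j)) \<longlonglongrightarrow> of_real (fix_ratio g ^ m)" by simp
    from tendsto_diff[OF this am[OF g(1)]] show ?thesis by simp
  qed
  \<comment> \<open>At index 3 the density is at least one half, so \<open>t 3\<close> serves as an
    odd reference element with nonzero value.\<close>
  have f4: "fix_ratio (t 3) > 0" using t(3)[of 3] by simp
  have nz: "\<chi> (t 3) \<noteq> 0"
  proof
    assume "\<chi> (t 3) = 0"
    then have "(\<lambda>j. 0) \<longlonglongrightarrow> complex_of_real (fix_ratio (t 3) ^ m)" using lim[OF t(1,2), of 3] by simp
    then have "complex_of_real (fix_ratio (t 3) ^ m) = 0" using LIMSEQ_const_iff by metis
    then show False using f4 by simp
  qed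
  define c where "c = of_real (fix_ratio (t 3) ^ m) / \<chi> (t 3)"
  have clim: "(\<lambda>j. \<chi> (t j)) \<longlonglongrightarrow> c"
    using tendsto_divide[OF lim[OF t(1,2), of 3] tendsto_const nz] nz by (simp add: c_def)
  have gc: "\<chi> g * c = of_real (fix_ratio g ^ m)" if g: "g \<in> G" "sg g = - 1" for g
    by (rule LIMSEQ_unique[OF tendsto_mult[OF tendsto_const clim] lim[OF g]])
  \<comment> \<open>Applying the relation for odd \<open>g\<close> to the sequence itself shows that
    the global constant squares to 1.\<close>
  have "(\<lambda>j. \<chi> (t j) * c) \<longlonglongrightarrow> c * c" by (intro tendsto_intros clim)
  moreover have "(\<lambda>j. \<chi> (t j) * c) \<longlonglongrightarrow> of_real (1 ^ m)"
    unfolding gc[OF t(1,2)] by (intro tendsto_intros tlim)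
  ultimately have cc: "c * c = 1" using LIMSEQ_unique by fastforce
  then have "c \<in> {1, - 1}" by (simp add: square_eq_1_iff)
  moreover have "\<chi> g = c * of_real (fix_ratio g ^ m)" if g: "g \<in> G" "sg g = - 1" for g
  proof -
    have "\<chi> g = \<chi> g * c * c" using cc by simp
    then show ?thesis using gc[OF g] by simp
  qed
  ultimately show ?thesis by blast
qed

theorem classification:
  "\<exists>p. (\<forall>g\<in>G. \<chi> g = chi_nat_pow n p g) \<or> (\<forall>g\<in>G. \<chi> g = sg g * chi_nat_pow n p g)"
  using even_classification
proof (elim disjE exE)
  assume reg: "\<forall>g\<in>G. sg g = 1 \<longrightarrow> g \<noteq> id \<longrightarrow> \<chi> g = 0"
  have "\<chi> g = chi_nat_pow n \<infinity> g" if "g \<in> G" for g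
    using regular_odd[OF _ that] reg by (auto simp: chi_nat_pow_def one_eq one)
  then show ?thesis by blast
next
  fix m assume ev: "\<forall>g\<in>G. sg g = 1 \<longrightarrow> \<chi> g = of_real (fix_ratio g ^ m)"
  have pow: "chi_nat_pow n (enat m) g = of_real (fix_ratio g ^ m)" if "g \<in> G" for g
    using chi_nat_fix_ratio[OF that] by (simp add: chi_nat_pow_def)
  show ?thesis
  proof (cases "\<exists>g0\<in>G. sg g0 = - 1")
    \<comment> \<open>No odd elements exist, as when infinitely many terms of the sequence are even;
      the sign is then trivial.\<close>
    case False
    then have "\<chi> g = chi_nat_pow n (enat m) g" if "g \<in> G" for g
      using ev pow[OF that] sg_cases[OF that] that by auto
    then show ?thesis by blast
  next
    case True
    then obtain g0 where g0: "g0 \<in> G" "sg g0 = - 1" by blast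
    obtain c where c: "c \<in> {1, - 1}" "\<forall>g\<in>G. sg g = - 1 \<longrightarrow> \<chi> g = c * of_real (fix_ratio g ^ m)"
      using odd_classification[OF _ g0] ev by blast
    from c(1) consider "c = 1" | "c = - 1" by blast
    then show ?thesis
    proof cases
      case 1
      have "\<chi> g = chi_nat_pow n (enat m) g" if "g \<in> G" for g
        using ev c(2) 1 pow[OF that] sg_cases[OF that] that by auto
      then show ?thesis by blast
    next
      case 2
      have "\<chi> g = sg g * chi_nat_pow n (enat m) g" if "g \<in> G" for g
        using ev c(2) 2 pow[OF that] sg_cases[OF that] that by auto
      then show ?thesis by blast
    qed
  qed
qed

end

text \<open>Substituting \<open>f2 = f - f1\<close> leaves \<open>(a - b) * f1 + b * f = 0\<close>,
  and evaluation at \<open>e\<close> excludes \<open>a = b\<close>.\<close>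

lemma proportional_if_dependent:
  fixes a b :: complex
  assumes ab: "a \<noteq> 0 \<or> b \<noteq> 0" and dep: "\<And>g. g \<in> S \<Longrightarrow> a * f1 g + b * f2 g = 0"
    and sum: "\<And>g. g \<in> S \<Longrightarrow> f g = f1 g + f2 g" and e: "e \<in> S" "f e = 1"
  shows "\<exists>c. \<forall>g\<in>S. f1 g = c * f g"
proof -
  have eq: "(a - b) * f1 g + b * f g = 0" if "g \<in> S" for g
    using dep[OF that] sum[OF that] by (simp add: algebra_simps)
  have "a \<noteq> b"
  proof
    assume "a = b"
    then have "b = 0" using eq[OF e(1)] e(2) by simp
    then show False using ab \<open>a = b\<close> by simp
  qed
  then have "f1 g = - b / (a - b) * f g" if "g \<in> S" for g
    using eq[OF that] by (simp add: field_simps add_eq_0_iff)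
  then show ?thesis by blast
qed

theorem theorem1p2:
  fixes n :: "nat \<Rightarrow> nat" and \<chi> :: "(nat \<Rightarrow> nat) \<Rightarrow> complex"
  assumes "\<And>k. k \<ge> 1 \<Longrightarrow> n k > 1"
    and "indecomposable_character (sym_limit n) \<chi>"
  shows "\<exists>p :: enat.
    (\<forall>\<sigma> \<in> carrier (sym_limit n). \<chi> \<sigma> = chi_nat_pow n p \<sigma>) \<or>
    (\<forall>\<sigma> \<in> carrier (sym_limit n). \<chi> \<sigma> = sgn_infinity n \<sigma> * chi_nat_pow n p \<sigma>)"
proof -
  interpret radix n by unfold_locales (rule assms(1))
  have ch: "group_character (sym_limit n) \<chi>"
    and indec: "\<not> (\<exists>f1 f2. central_function (sym_limit n) f1 \<and> positive_definite (sym_limit n) f1 \<and>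
      central_function (sym_limit n) f2 \<and> positive_definite (sym_limit n) f2 \<and>
      lin_indep_pair (sym_limit n) f1 f2 \<and> (\<forall>g \<in> carrier (sym_limit n). \<chi> g = f1 g + f2 g))"
    using assms(2) unfolding indecomposable_character_def by blast+
  have one: "\<chi> id = 1" using ch by (simp add: group_character_def one_eq)
  interpret extremal_char n \<chi>
  proof unfold_locales
    show "pos_def G \<chi>" using ch by (simp add: group_character_def positive_definite_iff)
    show "\<chi> (g \<circ> h) = \<chi> (h \<circ> g)" if "g \<in> G" "h \<in> G" for g h
      using ch that by (simp add: group_character_def central_function_iff)
    show "\<chi> id = 1" by (rule one)
    fix f1 f2 :: "(nat \<Rightarrow> nat) \<Rightarrow> complex"
    assume f: "pos_def G f1" "pos_def G f2" "\<And>g h. g \<in> G \<Longrightarrow> h \<in> G \<Longrightarrow> f1 (g \<circ> h) = f1 (h \<circ> g)"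
      "\<And>g h. g \<in> G \<Longrightarrow> h \<in> G \<Longrightarrow> f2 (g \<circ> h) = f2 (h \<circ> g)" "\<And>g. g \<in> G \<Longrightarrow> \<chi> g = f1 g + f2 g"
    have "central_function (sym_limit n) f1" "central_function (sym_limit n) f2"
      using f(3,4) by (simp_all only: central_function_iff) blast+
    moreover have "positive_definite (sym_limit n) f1" "positive_definite (sym_limit n) f2"
      using f(1,2) by (simp_all only: positive_definite_iff)
    moreover have "\<forall>g \<in> carrier (sym_limit n). \<chi> g = f1 g + f2 g" using f(5) carrier_eq by simp
    ultimately have "\<not> lin_indep_pair (sym_limit n) f1 f2" using indec by blast
    then obtain a b where ab: "a \<noteq> 0 \<or> b \<noteq> 0" "\<forall>g\<in>G. a * f1 g + b * f2 g = 0"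
      unfolding lin_indep_pair_def carrier_eq by blast
    show "\<exists>c. \<forall>g\<in>G. f1 g = c * \<chi> g"
      by (rule proportional_if_dependent[of a b G f1 f2 \<chi> id]) (use ab f(5) G.id_mem one in blast)+
  qed
  show ?thesis unfolding carrier_eq by (rule classification)
qed

end
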